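(* Let $N$ be an open connected $n$-manifold that admits a $C^{2}$ foliation by closed planes. If $\pi_1(N)$ is finitely generated, then $\pi_1(N)$ is a free group.
   Context: An open manifold is a non-compact manifold without boundary. A foliation by planes of an $n$-manifold $N$ is a $C^{2}$ codimension-one foliation $\mathcal{F}$ of $N$ all of whose leaves are diffeomorphic to $\mathbb{R}^{n-1}$. It is a foliation by closed planes if moreover every leaf is a closed subset of $N$. $N$ is not assumed orientable and the foliation is not assumed transversally orientable. The trivial group is considered free. *)

theory Defs
  imports "HOL-Analysis.Analysis" "HOL-Algebra.Generated_Groups"
begin

section \<open>Manifolds of class \<open>C\<^sup>2\<close>\<close>

definition C2_on :: "('v::real_normed_vector \<Rightarrow> 'w::real_normed_vector) \<Rightarrow> 'v set \<Rightarrow> bool" where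
  "C2_on f S \<longleftrightarrow>
     (\<exists>(f' :: 'v \<Rightarrow> 'v \<Rightarrow>\<^sub>L 'w) (f'' :: 'v \<Rightarrow> 'v \<Rightarrow>\<^sub>L ('v \<Rightarrow>\<^sub>L 'w)).
        (\<forall>x\<in>S. (f has_derivative blinfun_apply (f' x)) (at x)) \<and>
        (\<forall>x\<in>S. (f' has_derivative blinfun_apply (f'' x)) (at x)) \<and>
        continuous_on S f'')"

text \<open>A chart is a pair of its domain and its coordinate map; values of the coordinate map
  outside the domain are irrelevant. Manifolds are subsets \<open>M\<close> of an arbitrary topological
  space, with the subspace topology. Charts are onto open sets of Euclidean space, so there is
  no boundary.\<close>

type_synonym ('a, 'n) chart = "'a set \<times> ('a \<Rightarrow> real ^ 'n)"

definition is_chart :: "'a::topological_space set \<Rightarrow> ('a, 'n::finite) chart \<Rightarrow> bool" where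
  "is_chart M = (\<lambda>(U, \<phi>).
     openin (top_of_set M) U \<and> open (\<phi> ` U) \<and> homeomorphism U (\<phi> ` U) \<phi> (inv_into U \<phi>))"

definition transition :: "('a, 'n::finite) chart \<Rightarrow> ('a, 'n) chart \<Rightarrow> real ^ 'n \<Rightarrow> real ^ 'n" where
  "transition = (\<lambda>(U, \<phi>) (V, \<psi>). \<psi> \<circ> inv_into U \<phi>)"

definition transition_dom :: "('a, 'n::finite) chart \<Rightarrow> ('a, 'n) chart \<Rightarrow> (real ^ 'n) set" where
  "transition_dom = (\<lambda>(U, \<phi>) (V, \<psi>). \<phi> ` (U \<inter> V))"

definition C2_atlas :: "'a::topological_space set \<Rightarrow> ('a, 'n::finite) chart set \<Rightarrow> bool" where
  "C2_atlas M A \<longleftrightarrow>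
     (\<forall>c\<in>A. is_chart M c) \<and> (\<Union>(U, \<phi>)\<in>A. U) = M \<and>
     (\<forall>c\<in>A. \<forall>d\<in>A. C2_on (transition c d) (transition_dom c d))"

text \<open>The atlas need not be maximal. As only the \<open>C\<^sup>2\<close> structure matters for \<open>C\<^sup>2\<close>
  foliations, the manifold is only required to be of class \<open>C\<^sup>2\<close>; smooth manifolds are included.\<close>

definition C2_manifold :: "'a::topological_space set \<Rightarrow> ('a, 'n::finite) chart set \<Rightarrow> bool" where
  "C2_manifold M A \<longleftrightarrow>
     Hausdorff_space (top_of_set M) \<and> second_countable (top_of_set M) \<and> C2_atlas M A"

definition open_manifold :: "'a::topological_space set \<Rightarrow> ('a, 'n::finite) chart set \<Rightarrow> bool" where
  "open_manifold M A \<longleftrightarrow> C2_manifold M A \<and> \<not> compact M"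


section \<open>Codimension-one foliations\<close>

text \<open>The \<open>k\<close>-th coordinate of \<open>\<real>\<^sup>n\<close> serves as the transverse one, and the hyperplane on which
  it vanishes is the model of \<open>\<real>\<^sup>n\<^sup>-\<^sup>1\<close>. With \<open>n = CARD('n)\<close> this covers all \<open>n \<ge> 1\<close>, including
  \<open>n = 1\<close>, where the hyperplane is a point.\<close>

definition hyp :: "'n::finite \<Rightarrow> (real ^ 'n) set" where
  "hyp k = {x. x $ k = 0}"

definition hproj :: "'n::finite \<Rightarrow> real ^ 'n \<Rightarrow> real ^ 'n" where
  "hproj k x = (\<chi> i. if i = k then 0 else x $ i)"

text \<open>A foliated atlas: the image of each chart is a product of a disk in \<open>\<real>\<^sup>n\<^sup>-\<^sup>1\<close> and an open
  interval, and the coordinate changes are, locally, of the form \<open>(x, y) \<mapsto> (h\<^sub>1(x, y), h\<^sub>2(y))\<close>.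
  It must be compatible with the given \<open>C\<^sup>2\<close> structure, but neither atlas need be maximal.
  No transverse orientation is imposed, as \<open>h\<^sub>2\<close> may be decreasing.\<close>

definition C2_foliation ::
    "'n::finite \<Rightarrow> 'a::topological_space set \<Rightarrow> ('a, 'n) chart set \<Rightarrow> ('a, 'n) chart set \<Rightarrow> bool" where
  "C2_foliation k M A F \<longleftrightarrow>
     C2_atlas M F \<and> C2_atlas M (A \<union> F) \<and>
     (\<forall>(U, \<phi>)\<in>F. \<exists>a r s. r > 0 \<and> s > 0 \<and>
        \<phi> ` U = {x. dist (hproj k x) (hproj k a) < r \<and> dist (x $ k) (a $ k) < s}) \<and>
     (\<forall>c\<in>F. \<forall>d\<in>F. \<forall>x\<in>transition_dom c d. \<exists>W. open W \<and> x \<in> W \<and> W \<subseteq> transition_dom c d \<and>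
        (\<forall>y\<in>W. \<forall>z\<in>W. y $ k = z $ k \<longrightarrow> transition c d y $ k = transition c d z $ k))"

definition plaque :: "'n::finite \<Rightarrow> ('a, 'n) chart \<Rightarrow> real \<Rightarrow> 'a set" where
  "plaque k = (\<lambda>(U, \<phi>) t. {q \<in> U. \<phi> q $ k = t})"

text \<open>Leaves are the classes of points that can be joined by a finite chain of plaques, each
  meeting the next.\<close>

definition plaque_rel :: "'n::finite \<Rightarrow> ('a, 'n) chart set \<Rightarrow> ('a \<times> 'a) set" where
  "plaque_rel k F = {(p, q). \<exists>c\<in>F. \<exists>t. p \<in> plaque k c t \<and> q \<in> plaque k c t}"

definition leaves :: "'n::finite \<Rightarrow> 'a set \<Rightarrow> ('a, 'n) chart set \<Rightarrow> 'a set set" where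
  "leaves k M F = M // (plaque_rel k F)\<^sup>*"

text \<open>Class \<open>C\<^sup>2\<close> for a map defined on a relatively open subset of the hyperplane: the map is
  extended to be constant in the \<open>k\<close>-th coordinate.\<close>

definition hyp_C2_on :: "'n::finite \<Rightarrow> (real ^ 'n \<Rightarrow> real ^ 'n) \<Rightarrow> (real ^ 'n) set \<Rightarrow> bool" where
  "hyp_C2_on k f S \<longleftrightarrow> C2_on (f \<circ> hproj k) {x. hproj k x \<in> S}"

text \<open>The leaf \<open>L\<close> carries its intrinsic structure, whose charts are the maps \<open>hproj k \<circ> \<phi>\<close> on
  the plaques contained in \<open>L\<close>; these are injective on plaques. A diffeomorphism from \<open>L\<close> onto
  the hyperplane is a bijection taking plaques to open sets which is of class \<open>C\<^sup>2\<close> in both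
  directions when read in these charts.\<close>

definition leaf_diffeo ::
    "'n::finite \<Rightarrow> ('a, 'n) chart set \<Rightarrow> 'a set \<Rightarrow> ('a \<Rightarrow> real ^ 'n) \<Rightarrow> bool" where
  "leaf_diffeo k F L h \<longleftrightarrow>
     bij_betw h L (hyp k) \<and>
     (\<forall>(U, \<phi>)\<in>F. \<forall>t. let P = plaque k (U, \<phi>) t; \<xi> = hproj k \<circ> \<phi> in
        P \<subseteq> L \<longrightarrow>
          openin (top_of_set (hyp k)) (h ` P) \<and>
          hyp_C2_on k (h \<circ> inv_into P \<xi>) (\<xi> ` P) \<and>
          hyp_C2_on k (\<xi> \<circ> inv_into P h) (h ` P))"

definition foliation_by_planes ::
    "'n::finite \<Rightarrow> 'a::topological_space set \<Rightarrow> ('a, 'n) chart set \<Rightarrow> ('a, 'n) chart set \<Rightarrow> bool" where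
  "foliation_by_planes k M A F \<longleftrightarrow>
     C2_foliation k M A F \<and> (\<forall>L\<in>leaves k M F. \<exists>h. leaf_diffeo k F L h)"

definition foliation_by_closed_planes ::
    "'n::finite \<Rightarrow> 'a::topological_space set \<Rightarrow> ('a, 'n) chart set \<Rightarrow> ('a, 'n) chart set \<Rightarrow> bool" where
  "foliation_by_closed_planes k M A F \<longleftrightarrow>
     foliation_by_planes k M A F \<and> (\<forall>L\<in>leaves k M F. closedin (top_of_set M) L)"


section \<open>Fundamental group\<close>

definition loops :: "'a::topological_space set \<Rightarrow> 'a \<Rightarrow> (real \<Rightarrow> 'a) set" where
  "loops M p = {g. path g \<and> path_image g \<subseteq> M \<and> pathstart g = p \<and> pathfinish g = p}"

definition homotopy_class :: "'a::topological_space set \<Rightarrow> (real \<Rightarrow> 'a) \<Rightarrow> (real \<Rightarrow> 'a) set" where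
  "homotopy_class M g = {h. homotopic_paths M g h}"

definition fundamental_group :: "'a::topological_space set \<Rightarrow> 'a \<Rightarrow> (real \<Rightarrow> 'a) set monoid" where
  "fundamental_group M p =
     \<lparr>carrier = homotopy_class M ` loops M p,
      mult = (\<lambda>X Y. \<Union>g\<in>X. \<Union>h\<in>Y. homotopy_class M (g +++ h)),
      one = homotopy_class M (\<lambda>_. p)\<rparr>"


section \<open>Finitely generated and free groups\<close>

definition finitely_generated :: "('g, 'b) monoid_scheme \<Rightarrow> bool" where
  "finitely_generated G \<longleftrightarrow> (\<exists>S. finite S \<and> S \<subseteq> carrier G \<and> generate G S = carrier G)"

text \<open>A letter \<open>(b, True)\<close> stands for \<open>b\<close> and \<open>(b, False)\<close> for its inverse.\<close>

definition reduced_words :: "'g set \<Rightarrow> ('g \<times> bool) list set" where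
  "reduced_words B =
     {w. fst ` set w \<subseteq> B \<and> successively (\<lambda>x y. \<not> (fst x = fst y \<and> snd x \<noteq> snd y)) w}"

definition word_eval :: "('g, 'b) monoid_scheme \<Rightarrow> ('g \<times> bool) list \<Rightarrow> 'g" where
  "word_eval G w = foldr (\<lambda>(b, s) x. (if s then b else inv\<^bsub>G\<^esub> b) \<otimes>\<^bsub>G\<^esub> x) w \<one>\<^bsub>G\<^esub>"

text \<open>A group is free if every element is the value of exactly one reduced word over some subset
  \<open>B\<close>. The trivial group is free, with \<open>B\<close> empty.\<close>

definition free_group :: "('g, 'b) monoid_scheme \<Rightarrow> bool" where
  "free_group G \<longleftrightarrow>
     group G \<and> (\<exists>B \<subseteq> carrier G. bij_betw (word_eval G) (reduced_words B) (carrier G))"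

end

theory Submission
  imports Defs "HOL-Algebra.Bij"
begin

text \<open>
  Let \<open>\<Gamma>\<close> be the fundamental group of \<open>N\<close>. Finitely many loops, and a homotopy that
  contracts a product of them, lie in a union \<open>N0\<close> of finitely many cells contained in charts of the
  foliation. Inside \<open>N0\<close> the class in \<open>\<Gamma>\<close> of a loop depends only on an element of a free group,
  namely on the record of how the loop passes through finitely many leaves, and this record is
  invariant under homotopies in \<open>N0\<close> (\<open>free_factorization\<close>). Hence finitely many elements of \<open>\<Gamma>\<close>
  that satisfy a relation lift to elements of a free group, with a homomorphism back to \<open>\<Gamma>\<close>, that
  satisfy the same relation. A finitely generated group with this lifting property is free
  (\<open>free_group_criterion\<close>): if a generating set of the least possible size \<open>r\<close> satisfied a nontrivial
  relation, then so would \<open>r\<close> elements of a free group, these would generate a subgroup that fewer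
  than \<open>r\<close> elements generate (\<open>relation_lowers_rank\<close>), and the images of those would generate \<open>\<Gamma>\<close>.
  That the rank drops follows from the Nielsen-Schreier theorem and a count of homomorphisms into
  a finite permutation group.

  The free group arises as follows. A leaf is a countable union of plaques, and it is closed, so by
  the Baire theorem it meets each transversal in a discrete set (\<open>levels_isolated\<close>); it therefore meets
  the cells of \<open>N0\<close> in finitely many plaques. Being a plane, it carries no nontrivial loops
  (\<open>leaf_section\<close>). By compactness both facts extend to a neighbourhood: each point has a
  neighbourhood \<open>W\<close> in \<open>N0\<close> that is bounded by finitely many leaves and whose loops are all
  contractible in \<open>N\<close> (\<open>adapted_nbhd\<close>). Finitely many such \<open>W\<close> cover \<open>N0\<close>. Cut \<open>N0\<close> along the finitely
  many leaves that bound them. Every component of the rest, and every component of a leaf in \<open>N0\<close>,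
  lies in one of the sets \<open>W\<close>. So the class of a path changes only where the path passes between a
  component \<open>C\<close> of the complement and an adjacent piece \<open>E\<close> of a leaf. The pairs \<open>(C, E)\<close> are the
  letters of the free group. There is nothing to impose on them, since pieces of leaves are mutually
  disjoint and so are the components of the complement.

  Path classes and records are both treated as local systems: elements of a group attached to pairs
  of points in a common small box, multiplicative and compatible with shrinking the box. The one
  existence theorem on their sections, over convex sets (\<open>sec_convex_exists\<close>), is applied to the unit
  interval to define the value on a path, to the unit square for homotopy invariance, and to the
  hyperplane for the leaves.
\<close>

section \<open>Free groups\<close>

definition linv :: "'l \<times> bool \<Rightarrow> 'l \<times> bool" where
  "linv x = (fst x, \<not> snd x)"

definition reduced :: "('l \<times> bool) list \<Rightarrow> bool" where
  "reduced w \<longleftrightarrow> successively (\<lambda>x y. \<not> (fst x = fst y \<and> snd x \<noteq> snd y)) w"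

text \<open>Left multiplication of a reduced word by a letter.\<close>

definition ccons :: "'l \<times> bool \<Rightarrow> ('l \<times> bool) list \<Rightarrow> ('l \<times> bool) list" where
  "ccons x w = (case w of [] \<Rightarrow> [x] | y # ys \<Rightarrow> if y = linv x then ys else x # w)"

text \<open>The free group on all letters of a type. Its elements are the reduced words themselves, so that no
  quotient has to be formed; a product cancels where the factors meet.\<close>

definition FG :: "('l \<times> bool) list monoid" where
  "FG = \<lparr>carrier = {w. reduced w}, mult = (\<lambda>u v. foldr ccons u v), one = []\<rparr>"

text \<open>The homomorphism that sends each letter \<open>l\<close> to \<open>f l\<close>; \<open>word_eval\<close> is the case of words whose letters
  are elements of the group.\<close>

definition ev :: "('g, 'b) monoid_scheme \<Rightarrow> ('l \<Rightarrow> 'g) \<Rightarrow> ('l \<times> bool) list \<Rightarrow> 'g" where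
  "ev G f w = foldr (\<lambda>(l, s) x. (if s then f l else inv\<^bsub>G\<^esub> (f l)) \<otimes>\<^bsub>G\<^esub> x) w \<one>\<^bsub>G\<^esub>"

lemma FG_simps [simp]:
  "carrier FG = {w. reduced w}" "u \<otimes>\<^bsub>FG\<^esub> v = foldr ccons u v" "\<one>\<^bsub>FG\<^esub> = []"
  by (auto simp: FG_def)

lemma linv_simps [simp]: "linv (linv x) = x" "fst (linv x) = fst x" "snd (linv x) = (\<not> snd x)"
  "linv x \<noteq> x" "x \<noteq> linv x"
  by (auto simp: linv_def prod_eq_iff)

lemma reduced_Nil [simp]: "reduced []"
  by (simp add: reduced_def)

lemma reduced_Cons: "reduced (x # w) \<longleftrightarrow> reduced w \<and> (w = [] \<or> hd w \<noteq> linv x)"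
  by (auto simp: reduced_def successively_Cons linv_def prod_eq_iff)

lemma reduced_single [simp]: "reduced [x]"
  by (simp add: reduced_Cons)

lemma reduced_words_eq: "reduced_words B = {w. fst ` set w \<subseteq> B \<and> reduced w}"
  by (simp add: reduced_words_def reduced_def)

lemma ccons_simps [simp]:
  "ccons x [] = [x]" "ccons x (y # ys) = (if y = linv x then ys else x # y # ys)"
  by (auto simp: ccons_def)

lemma ccons_reduced: "reduced w \<Longrightarrow> reduced (ccons x w)"
  by (auto simp: ccons_def reduced_Cons split: list.split)

lemma ccons_eq_Cons: "reduced (x # w) \<Longrightarrow> ccons x w = x # w"
  by (auto simp: ccons_def reduced_Cons split: list.split)

lemma ccons_linv: "ccons (linv x) (x # w) = w"
  by (simp add: ccons_def)

lemma ccons_cancel: "reduced w \<Longrightarrow> ccons (linv x) (ccons x w) = w"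
  by (cases w) (auto simp: ccons_def reduced_Cons split: list.split)

lemma ccons_cancel': "reduced w \<Longrightarrow> ccons x (ccons (linv x) w) = w"
  using ccons_cancel[of w "linv x"] by simp

lemma foldr_ccons_reduced: "reduced v \<Longrightarrow> reduced (foldr ccons u v)"
  by (induction u) (auto intro: ccons_reduced)

text \<open>Multiplication by a letter permutes the reduced words, its inverse being multiplication by the
  inverse letter. This makes cancelled pairs act trivially, whence associativity.\<close>

lemma foldr_ccons_ccons: "reduced v \<Longrightarrow> foldr ccons (ccons x u) v = ccons x (foldr ccons u v)"
proof (cases u)
  case (Cons y ys)
  assume "reduced v"
  then show ?thesis
    by (cases "y = linv x") (simp_all add: Cons ccons_def[of x "_ # _"] ccons_cancel' foldr_ccons_reduced)
qed (simp add: ccons_def[of x "[]"])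

lemma foldr_ccons_assoc:
  "reduced v \<Longrightarrow> foldr ccons (foldr ccons u w) v = foldr ccons u (foldr ccons w v)"
  by (induction u) (auto simp: foldr_ccons_ccons)

lemma foldr_ccons_Nil: "reduced u \<Longrightarrow> foldr ccons u [] = u"
  by (induction u) (auto simp: ccons_eq_Cons reduced_Cons)

lemma group_FG: "group (FG :: ('l \<times> bool) list monoid)"
proof (rule groupI)
  fix w :: "('l \<times> bool) list"
  assume w: "w \<in> carrier FG"
  define v where "v = foldr ccons (map linv (rev w)) []"
  have "foldr ccons (map linv (rev w)) w = []"
    by (induction w) (auto simp: ccons_linv)
  then have "v \<otimes>\<^bsub>FG\<^esub> w = \<one>\<^bsub>FG\<^esub>"
    using w by (simp add: v_def foldr_ccons_assoc)
  moreover have "v \<in> carrier FG"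
    by (simp add: v_def foldr_ccons_reduced)
  ultimately show "\<exists>v\<in>carrier FG. v \<otimes>\<^bsub>FG\<^esub> w = \<one>\<^bsub>FG\<^esub>"
    by blast
qed (auto simp: foldr_ccons_reduced foldr_ccons_assoc)

interpretation FG: group FG
  by (rule group_FG)

lemma word_eval_eq_ev: "word_eval G w = ev G (\<lambda>b. b) w"
  by (simp add: word_eval_def ev_def)

lemma ev_Nil [simp]: "ev G f [] = \<one>\<^bsub>G\<^esub>"
  and ev_Cons: "ev G f (x # w) = (if snd x then f (fst x) else inv\<^bsub>G\<^esub> f (fst x)) \<otimes>\<^bsub>G\<^esub> ev G f w"
  by (auto simp: ev_def split: prod.split)

lemma ccons_letters: "fst ` set (ccons x w) \<subseteq> insert (fst x) (fst ` set w)"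
  by (auto simp: ccons_def split: list.splits if_splits)

lemma foldr_ccons_letters: "fst ` set (foldr ccons u v) \<subseteq> fst ` set u \<union> fst ` set v"
proof (induction u)
  case (Cons x u)
  then show ?case
    using ccons_letters[of x "foldr ccons u v"] by (simp, blast)
qed simp

context group
begin

lemma ev_closed: "(\<And>l. l \<in> fst ` set w \<Longrightarrow> f l \<in> carrier G) \<Longrightarrow> ev G f w \<in> carrier G"
  by (induction w) (auto simp: ev_Cons)

lemma ev_ccons:
  assumes "f (fst x) \<in> carrier G" "\<And>l. l \<in> fst ` set w \<Longrightarrow> f l \<in> carrier G"
  shows "ev G f (ccons x w) = (if snd x then f (fst x) else inv f (fst x)) \<otimes> ev G f w"
proof (cases w)
  case Nil
  then show ?thesis using assms by (simp add: ccons_def ev_Cons)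
next
  case (Cons y ys)
  have c: "f (fst x) \<in> carrier G" "ev G f ys \<in> carrier G" 
    using assms Cons by (auto intro!: ev_closed)
  show ?thesis
  proof (cases "y = linv x")
    case True
    have "ev G f (ccons x w) = ev G f ys"
      using True by (simp add: ccons_def Cons)
    also have "\<dots> = (if snd x then f (fst x) else inv f (fst x)) \<otimes> ev G f w"
      using c by (auto simp: ev_Cons Cons True m_assoc[symmetric])
    finally show ?thesis .
  next
    case False
    then show ?thesis using Cons by (auto simp: ccons_def ev_Cons)
  qed
qed

lemma ev_mult:
  assumes "\<And>l. l \<in> fst ` set u \<union> fst ` set v \<Longrightarrow> f l \<in> carrier G"
  shows "ev G f (foldr ccons u v) = ev G f u \<otimes> ev G f v"
  using assms
proof (induction u)
  case Nil
  then show ?case by (simp add: ev_closed)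
next
  case (Cons x u)
  have c: "f (fst x) \<in> carrier G" "ev G f u \<in> carrier G" "ev G f v \<in> carrier G"
    using Cons.prems by (auto intro!: ev_closed)
  have "ev G f (foldr ccons (x # u) v)
      = (if snd x then f (fst x) else inv f (fst x)) \<otimes> ev G f (foldr ccons u v)"
    unfolding foldr.simps o_apply
  proof (rule ev_ccons)
    show "f l \<in> carrier G" if "l \<in> fst ` set (foldr ccons u v)" for l
      using Cons.prems[of l] foldr_ccons_letters[of u v] that by (simp, blast)
  qed (use Cons.prems in auto)
  then show ?case
    using Cons c by (auto simp: ev_Cons m_assoc)
qed

lemma ev_mult_FG:
  "f \<in> UNIV \<rightarrow> carrier G \<Longrightarrow> ev G f (u \<otimes>\<^bsub>FG\<^esub> v) = ev G f u \<otimes> ev G f v"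
  by (simp add: ev_mult Pi_iff)

lemma ev_inv_FG:
  assumes f: "f \<in> UNIV \<rightarrow> carrier G" and u: "u \<in> carrier FG"
  shows "ev G f (inv\<^bsub>FG\<^esub> u) = inv ev G f u"
proof -
  have "ev G f (inv\<^bsub>FG\<^esub> u) \<otimes> ev G f u = ev G f (inv\<^bsub>FG\<^esub> u \<otimes>\<^bsub>FG\<^esub> u)"
    using f ev_mult_FG by metis
  also have "\<dots> = \<one>"
    using FG.l_inv[OF u] by simp
  finally show ?thesis
    using f by (metis inv_equality ev_closed Pi_iff UNIV_I)
qed

lemma hom_ev:
  assumes P: "group P" and H: "subgroup H G"
    and chi: "\<And>x. x \<in> H \<Longrightarrow> \<theta> x \<in> carrier P"
      "\<And>x y. x \<in> H \<Longrightarrow> y \<in> H \<Longrightarrow> \<theta> (x \<otimes> y) = \<theta> x \<otimes>\<^bsub>P\<^esub> \<theta> y"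
    and f: "\<And>l. l \<in> fst ` set w \<Longrightarrow> f l \<in> H"
  shows "\<theta> (ev G f w) = ev P (\<theta> \<circ> f) w \<and> ev G f w \<in> H"
proof -
  interpret P: group P by (rule P)
  interpret H: subgroup H G by (rule H)
  have one: "\<theta> \<one> = \<one>\<^bsub>P\<^esub>"
  proof -
    have "\<theta> \<one> \<otimes>\<^bsub>P\<^esub> \<theta> \<one> = \<theta> \<one>"
      using chi(2)[of \<one> \<one>] H.one_closed by simp
    then show ?thesis
      using chi(1)[OF H.one_closed] P.l_cancel_one by blast
  qed
  have inv: "\<theta> (inv x) = inv\<^bsub>P\<^esub> \<theta> x" if "x \<in> H" for x
    using chi(2)[of "inv x" x] chi(1) that H.m_inv_closed[OF that] H.mem_carrier[OF that] one
    by (metis P.inv_equality l_inv)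
  show ?thesis
    using f by (induction w) (auto simp: ev_Cons one inv chi H.m_inv_closed H.m_closed)
qed

lemma hom_eq_on_generate:
  assumes P: "group P" and S: "S \<subseteq> carrier G"
    and chi: "\<And>x. x \<in> generate G S \<Longrightarrow> \<theta> x \<in> carrier P"
      "\<And>x y. x \<in> generate G S \<Longrightarrow> y \<in> generate G S \<Longrightarrow> \<theta> (x \<otimes> y) = \<theta> x \<otimes>\<^bsub>P\<^esub> \<theta> y"
    and psi: "\<And>x. x \<in> generate G S \<Longrightarrow> \<psi> x \<in> carrier P"
      "\<And>x y. x \<in> generate G S \<Longrightarrow> y \<in> generate G S \<Longrightarrow> \<psi> (x \<otimes> y) = \<psi> x \<otimes>\<^bsub>P\<^esub> \<psi> y"
    and eq: "\<And>x. x \<in> S \<Longrightarrow> \<theta> x = \<psi> x"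
    and z: "z \<in> generate G S"
  shows "\<theta> z = \<psi> z"
  using z
proof (induction z rule: generate.induct)
  interpret P: group P by (rule P)
  have H: "subgroup (generate G S) G"
    using S by (rule generate_is_subgroup)
  have one: "\<theta> \<one> = \<one>\<^bsub>P\<^esub>" "\<psi> \<one> = \<one>\<^bsub>P\<^esub>"
    using hom_ev[OF P H chi, of "[]"] hom_ev[OF P H psi, of "[]"] by simp_all
  case one
  then show ?case using \<open>\<theta> \<one> = \<one>\<^bsub>P\<^esub>\<close> \<open>\<psi> \<one> = \<one>\<^bsub>P\<^esub>\<close> by simp
next
  case (incl h)
  then show ?case using eq by simp
next
  interpret P: group P by (rule P)
  have H: "subgroup (generate G S) G"
    using S by (rule generate_is_subgroup)
  case (inv h)
  have h: "h \<in> generate G S" using inv by (rule generate.incl)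
  have hc: "h \<in> carrier G" using inv S by auto
  have "\<theta> (inv h) = inv\<^bsub>P\<^esub> \<theta> h"
    using hom_ev[OF P H chi, of "[(h, False)]" "\<lambda>x. x"] h hc chi(1)[OF h] by (simp add: ev_Cons)
  moreover have "\<psi> (inv h) = inv\<^bsub>P\<^esub> \<psi> h"
    using hom_ev[OF P H psi, of "[(h, False)]" "\<lambda>x. x"] h hc psi(1)[OF h] by (simp add: ev_Cons)
  ultimately show ?case using eq[OF inv] by simp
next
  case (eng h1 h2)
  then show ?case using chi(2) psi(2) by simp
qed

lemma generate_imp_ev:
  assumes "S \<subseteq> carrier G" "z \<in> generate G S"
  shows "\<exists>w. reduced w \<and> fst ` set w \<subseteq> S \<and> ev G (\<lambda>b. b) w = z"
  using assms(2)
proof (induction z rule: generate.induct)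
  case one
  then show ?case by (intro exI[of _ "[]"]) simp
next
  case (incl h)
  then show ?case using assms by (intro exI[of _ "[(h, True)]"]) (auto simp: ev_Cons)
next
  case (inv h)
  then show ?case using assms by (intro exI[of _ "[(h, False)]"]) (auto simp: ev_Cons)
next
  case (eng h1 h2)
  then obtain w1 w2 where w: "reduced w1" "fst ` set w1 \<subseteq> S" "ev G (\<lambda>b. b) w1 = h1"
    "reduced w2" "fst ` set w2 \<subseteq> S" "ev G (\<lambda>b. b) w2 = h2" by blast
  have "ev G (\<lambda>b. b) (foldr ccons w1 w2) = h1 \<otimes> h2"
    using w assms(1) by (subst ev_mult) auto
  moreover have "reduced (foldr ccons w1 w2)"
    using w by (simp add: foldr_ccons_reduced)
  moreover have "fst ` set (foldr ccons w1 w2) \<subseteq> S"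
    using w foldr_ccons_letters[of w1 w2] by blast
  ultimately show ?case by blast
qed

end

section \<open>Subgroups of free groups\<close>

text \<open>Words are built from the left, so multiplication by a letter from the right is analysed separately.\<close>

lemma foldr_ccons_snoc:
  assumes "reduced u"
  obtains "foldr ccons u [x] = u @ [x]"
  | v where "u = v @ [linv x]" "foldr ccons u [x] = v"
proof -
  have "foldr ccons u [x] = u @ [x] \<or> (\<exists>v. u = v @ [linv x] \<and> foldr ccons u [x] = v)"
    using assms
  proof (induction u)
    case Nil
    then show ?case by simp
  next
    case (Cons y u)
    show ?case
    proof (cases "u = []")
      case True
      then show ?thesis by auto
    next
      case False
      have red: "reduced u" "hd u \<noteq> linv y"
        using Cons.prems False by (auto simp: reduced_Cons)
      consider "foldr ccons u [x] = u @ [x]"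
        | v where "u = v @ [linv x]" "foldr ccons u [x] = v"
        using Cons.IH[OF red(1)] by blast
      then show ?thesis
      proof cases
        case 1
        then have "foldr ccons (y # u) [x] = ccons y (u @ [x])" by simp
        then show ?thesis using red False by (cases u) auto
      next
        case 2
        have "ccons y v = y # v"
          using red 2 by (cases v) auto
        then show ?thesis using 2 by auto
      qed
    qed
  qed
  then show ?thesis using that by blast
qed

lemma reduced_appendD: "reduced (u @ v) \<Longrightarrow> reduced u"
  by (induction u) (auto simp: reduced_Cons hd_append split: if_splits)

text \<open>Schreier's method. Each right coset of \<open>H\<close> is represented by its least element in a shortlex order;
  the initial segments of representatives are then representatives again (\<open>rep_prefix\<close>), that is, the
  representatives form a spanning tree of the coset graph. The edges outside the tree give the basis.\<close>

locale free_subgroup =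
  fixes H :: "('l \<times> bool) list set"
  assumes subH: "subgroup H FG"
begin

interpretation H: subgroup H FG by (rule subH)

text \<open>Words are compared by length first; ties are broken by an arbitrary well-order of the letters.\<close>

definition wo :: "(('l \<times> bool) list \<times> ('l \<times> bool) list) set" where
  "wo = (SOME r. \<exists>s :: (('l \<times> bool) \<times> ('l \<times> bool)) set. wf s \<and> total s \<and> r = lenlex s)"

lemma wo: "\<exists>s :: (('l \<times> bool) \<times> ('l \<times> bool)) set. wf s \<and> total s \<and> wo = lenlex s"
proof -
  obtain r :: "(('l \<times> bool) \<times> ('l \<times> bool)) set" where r: "well_order_on UNIV r"
    using well_order_on by blast
  then have "wf (r - Id)" "total (r - Id)"
    by (auto simp: well_order_on_def linear_order_on_def total_on_def)
  then have "\<exists>s :: (('l \<times> bool) \<times> ('l \<times> bool)) set. wf s \<and> total s \<and> lenlex (r - Id) = lenlex s"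
    by blast
  then show ?thesis
    unfolding wo_def by (rule someI)
qed

definition in_coset :: "('l \<times> bool) list \<Rightarrow> ('l \<times> bool) list \<Rightarrow> bool" where
  "in_coset w v \<longleftrightarrow> (\<exists>h\<in>H. v = h \<otimes>\<^bsub>FG\<^esub> w)"

definition is_rep :: "('l \<times> bool) list \<Rightarrow> ('l \<times> bool) list \<Rightarrow> bool" where
  "is_rep w v \<longleftrightarrow> in_coset w v \<and> (\<forall>v'. in_coset w v' \<longrightarrow> v' = v \<or> (v, v') \<in> wo)"

definition rep :: "('l \<times> bool) list \<Rightarrow> ('l \<times> bool) list" where
  "rep w = (SOME v. is_rep w v)"

lemma in_coset_self: "reduced w \<Longrightarrow> in_coset w w"
  unfolding in_coset_def by (intro bexI[of _ "\<one>\<^bsub>FG\<^esub>"]) (use H.one_closed in auto)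

lemma is_rep_ex:
  assumes "reduced w"
  shows "is_rep w (rep w)"
proof -
  obtain s :: "(('l \<times> bool) \<times> ('l \<times> bool)) set" where s: "wf s" "total s" "wo = lenlex s"
    using wo by blast
  have "wf wo" unfolding s(3) by (rule wf_lenlex[OF s(1)])
  then obtain v where "in_coset w v" "\<And>v'. (v', v) \<in> wo \<Longrightarrow> \<not> in_coset w v'"
    using in_coset_self[OF assms] wfE_min[of wo w "Collect (in_coset w)"] by auto
  moreover have "total wo" unfolding s(3) by (rule total_lenlex[OF s(2)])
  ultimately have "is_rep w v"
    unfolding is_rep_def total_on_def by blast
  then show ?thesis unfolding rep_def by (rule someI)
qed

lemma is_rep_unique: "is_rep w u \<Longrightarrow> is_rep w v \<Longrightarrow> u = v"
proof -
  obtain s :: "(('l \<times> bool) \<times> ('l \<times> bool)) set" where s: "wf s" "total s" "wo = lenlex s"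
    using wo by blast
  have "wf wo" unfolding s(3) by (rule wf_lenlex[OF s(1)])
  then show "is_rep w u \<Longrightarrow> is_rep w v \<Longrightarrow> u = v"
    unfolding is_rep_def by (metis wf_not_sym)
qed

lemma in_coset_cong:
  assumes "h \<in> H" "reduced w"
  shows "in_coset (h \<otimes>\<^bsub>FG\<^esub> w) = in_coset w"
proof (rule ext)
  fix v
  have h: "h \<in> carrier FG" using H.mem_carrier assms(1) .
  have w: "w \<in> carrier FG" using assms(2) by simp
  show "in_coset (h \<otimes>\<^bsub>FG\<^esub> w) v = in_coset w v"
  proof
    assume "in_coset (h \<otimes>\<^bsub>FG\<^esub> w) v"
    then obtain g where g: "g \<in> H" "v = g \<otimes>\<^bsub>FG\<^esub> (h \<otimes>\<^bsub>FG\<^esub> w)"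
      unfolding in_coset_def by blast
    then have "v = (g \<otimes>\<^bsub>FG\<^esub> h) \<otimes>\<^bsub>FG\<^esub> w"
      using FG.m_assoc[of g h w] h w H.mem_carrier[OF g(1)] by argo
    then show "in_coset w v"
      unfolding in_coset_def using H.m_closed[OF g(1) assms(1)] by blast
  next
    assume "in_coset w v"
    then obtain g where g: "g \<in> H" "v = g \<otimes>\<^bsub>FG\<^esub> w"
      unfolding in_coset_def by blast
    have "(g \<otimes>\<^bsub>FG\<^esub> inv\<^bsub>FG\<^esub> h) \<otimes>\<^bsub>FG\<^esub> (h \<otimes>\<^bsub>FG\<^esub> w) = g \<otimes>\<^bsub>FG\<^esub> (inv\<^bsub>FG\<^esub> h \<otimes>\<^bsub>FG\<^esub> (h \<otimes>\<^bsub>FG\<^esub> w))"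
      using h w H.mem_carrier[OF g(1)] by (intro FG.m_assoc FG.inv_closed FG.m_closed)
    also have "\<dots> = g \<otimes>\<^bsub>FG\<^esub> ((inv\<^bsub>FG\<^esub> h \<otimes>\<^bsub>FG\<^esub> h) \<otimes>\<^bsub>FG\<^esub> w)"
      by (subst FG.m_assoc[OF FG.inv_closed[OF h] h w]) (rule refl)
    also have "\<dots> = v"
      using g(2) FG.l_inv[OF h] FG.l_one[OF w] by metis
    finally show "in_coset (h \<otimes>\<^bsub>FG\<^esub> w) v"
      unfolding in_coset_def using H.m_closed[OF g(1) H.m_inv_closed[OF assms(1)]] by metis
  qed
qed

lemma rep_cong: "h \<in> H \<Longrightarrow> reduced w \<Longrightarrow> rep (h \<otimes>\<^bsub>FG\<^esub> w) = rep w"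
  by (simp only: rep_def is_rep_def in_coset_cong)

lemma rep_in: 
  assumes "reduced w" 
  obtains h where "h \<in> H" "rep w = h \<otimes>\<^bsub>FG\<^esub> w"
  using is_rep_ex[OF assms] unfolding is_rep_def in_coset_def by blast

lemma rep_carrier: "reduced w \<Longrightarrow> rep w \<in> carrier FG"
  by (metis rep_in FG.m_closed H.mem_carrier mem_Collect_eq FG_simps(1))

lemma rep_reduced: "reduced w \<Longrightarrow> reduced (rep w)"
  using rep_carrier by simp

lemma rep_rep: "reduced w \<Longrightarrow> rep (rep w) = rep w"
  by (metis rep_in rep_cong)

lemma rep_mult_rep:
  assumes "reduced w" "reduced u"
  shows "rep (rep w \<otimes>\<^bsub>FG\<^esub> u) = rep (w \<otimes>\<^bsub>FG\<^esub> u)"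
proof -
  obtain h where h: "h \<in> H" "rep w = h \<otimes>\<^bsub>FG\<^esub> w" using rep_in assms by blast
  have "rep w \<otimes>\<^bsub>FG\<^esub> u = h \<otimes>\<^bsub>FG\<^esub> (w \<otimes>\<^bsub>FG\<^esub> u)"
    unfolding h(2) using assms H.mem_carrier[OF h(1)] by (intro FG.m_assoc) auto
  then show ?thesis
    using rep_cong[OF h(1)] assms foldr_ccons_reduced by (metis FG_simps(2))
qed

lemma rep_H: "h \<in> H \<Longrightarrow> rep h = []"
proof -
  obtain s :: "(('l \<times> bool) \<times> ('l \<times> bool)) set" where s: "wf s" "total s" "wo = lenlex s"
    using wo by blast
  assume h: "h \<in> H"
  have "rep (h \<otimes>\<^bsub>FG\<^esub> []) = rep []"
    using rep_cong[OF h, of "[]"] by simp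
  moreover have "h \<otimes>\<^bsub>FG\<^esub> [] = h"
    using H.mem_carrier[OF h] by (simp add: foldr_ccons_Nil)
  moreover have "is_rep [] []"
    using in_coset_self[of "[]"] by (auto simp: is_rep_def s)
  ultimately show ?thesis
    using is_rep_unique is_rep_ex[of "[]"] by simp
qed

text \<open>If the coset of \<open>u\<close> contained an element smaller than \<open>u\<close>, then its product with \<open>x\<close> would be an
  element of the coset of \<open>u @ [x]\<close> smaller than \<open>u @ [x]\<close>.\<close>

lemma rep_prefix:
  assumes w: "reduced w" and eq: "rep w = u @ [x]"
  shows "rep u = u"
proof (rule ccontr)
  assume neq: "rep u \<noteq> u"
  obtain s :: "(('l \<times> bool) \<times> ('l \<times> bool)) set" where s: "wf s" "total s" "wo = lenlex s"
    using wo by blast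
  have wf: "wf wo" unfolding s(3) by (rule wf_lenlex[OF s(1)])
  have red: "reduced (u @ [x])" using rep_reduced[OF w] eq by simp
  have u: "reduced u" using red reduced_appendD by blast
  define v where "v = rep u"
  have vu: "(v, u) \<in> wo"
    using is_rep_ex[OF u] in_coset_self[OF u] neq unfolding is_rep_def v_def by metis
  have v: "reduced v" using rep_reduced[OF u] v_def by simp
  have ux: "u \<otimes>\<^bsub>FG\<^esub> [x] = u @ [x]"
    using red u by (cases rule: foldr_ccons_snoc[OF u, of x])
      (auto simp: reduced_def successively_append_iff linv_def)
  have "rep (v \<otimes>\<^bsub>FG\<^esub> [x]) = rep (u \<otimes>\<^bsub>FG\<^esub> [x])"
    unfolding v_def using u by (intro rep_mult_rep) auto
  also have "\<dots> = rep w"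
    using ux eq rep_rep[OF w] by simp
  finally have rw: "rep (v \<otimes>\<^bsub>FG\<^esub> [x]) = u @ [x]" using eq by simp
  have vx: "reduced (v \<otimes>\<^bsub>FG\<^esub> [x])" using v by (simp add: foldr_ccons_reduced)
  have "v \<otimes>\<^bsub>FG\<^esub> [x] = u @ [x] \<or> (u @ [x], v \<otimes>\<^bsub>FG\<^esub> [x]) \<in> wo"
    using is_rep_ex[OF vx] in_coset_self[OF vx] unfolding is_rep_def rw by blast
  moreover have "(v \<otimes>\<^bsub>FG\<^esub> [x], u @ [x]) \<in> wo"
  proof (cases rule: foldr_ccons_snoc[OF v, of x])
    case 1
    then show ?thesis using vu lenlex_append1[of v u s "[x]" "[x]"] by (simp add: s)
  next
    case (2 v')
    have "length v \<le> length u" using vu lenlex_length s by auto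
    then show ?thesis using 2 by (auto simp: s lenlex_conv)
  qed
  ultimately show False
    using wf by (metis wf_not_sym wf_irrefl)
qed

text \<open>The element of \<open>H\<close> that belongs to the edge labelled \<open>l\<close> from the coset of \<open>w\<close>: out along the tree,
  over the edge, and back along the tree. It depends on the coset only.\<close>

definition schreier_gen :: "('l \<times> bool) list \<Rightarrow> 'l \<Rightarrow> ('l \<times> bool) list" where
  "schreier_gen w l = rep w \<otimes>\<^bsub>FG\<^esub> [(l, True)] \<otimes>\<^bsub>FG\<^esub> inv\<^bsub>FG\<^esub> rep (w \<otimes>\<^bsub>FG\<^esub> [(l, True)])"

lemma mult_red: "reduced u \<Longrightarrow> reduced v \<Longrightarrow> reduced (u \<otimes>\<^bsub>FG\<^esub> v)"
  by (simp add: foldr_ccons_reduced)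

lemma rep_mult_inv_in_H:
  assumes w: "reduced w" and u: "reduced u"
  shows "rep w \<otimes>\<^bsub>FG\<^esub> u \<otimes>\<^bsub>FG\<^esub> inv\<^bsub>FG\<^esub> rep (w \<otimes>\<^bsub>FG\<^esub> u) \<in> H"
proof -
  define v where "v = rep w \<otimes>\<^bsub>FG\<^esub> u"
  have v: "reduced v" unfolding v_def by (intro mult_red rep_reduced w u)
  obtain h where h: "h \<in> H" "rep v = h \<otimes>\<^bsub>FG\<^esub> v" using rep_in v by blast
  have hc: "h \<in> carrier FG" "v \<in> carrier FG" using h H.mem_carrier v by auto
  have "v \<otimes>\<^bsub>FG\<^esub> inv\<^bsub>FG\<^esub> rep v = v \<otimes>\<^bsub>FG\<^esub> (inv\<^bsub>FG\<^esub> v \<otimes>\<^bsub>FG\<^esub> inv\<^bsub>FG\<^esub> h)"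
    unfolding h(2) by (simp only: FG.inv_mult_group hc)
  also have "\<dots> = inv\<^bsub>FG\<^esub> h"
    using hc by (metis FG.inv_closed FG.m_assoc FG.r_inv FG.l_one)
  finally have "v \<otimes>\<^bsub>FG\<^esub> inv\<^bsub>FG\<^esub> rep v \<in> H"
    using H.m_inv_closed[OF h(1)] by simp
  moreover have "rep v = rep (w \<otimes>\<^bsub>FG\<^esub> u)"
    unfolding v_def using w u by (rule rep_mult_rep)
  ultimately show ?thesis by (simp only: v_def)
qed

lemma schreier_gen_in_H: "reduced w \<Longrightarrow> schreier_gen w l \<in> H"
  unfolding schreier_gen_def by (rule rep_mult_inv_in_H) auto

definition basis :: "('l \<times> bool) list set" where
  "basis = {schreier_gen w l | w l. reduced w} - {[]}"

lemma basis_sub: "basis \<subseteq> H"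
  unfolding basis_def using schreier_gen_in_H by auto

lemma schreier_gen_in_generate: "reduced w \<Longrightarrow> schreier_gen w l \<in> generate FG basis"
  by (cases "schreier_gen w l = []") (auto simp: basis_def intro: generate.incl generate.one[of FG, simplified])

text \<open>An inverse letter traverses an edge backwards, from the coset of \<open>w\<close> to the coset where the edge starts.\<close>

lemma schreier_gen_inv:
  assumes w: "reduced w"
  shows "rep w \<otimes>\<^bsub>FG\<^esub> [(l, False)] \<otimes>\<^bsub>FG\<^esub> inv\<^bsub>FG\<^esub> rep (w \<otimes>\<^bsub>FG\<^esub> [(l, False)])
    = inv\<^bsub>FG\<^esub> schreier_gen (w \<otimes>\<^bsub>FG\<^esub> [(l, False)]) l"
proof -
  define v where "v = w \<otimes>\<^bsub>FG\<^esub> [(l, False)]"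
  have v: "reduced v" unfolding v_def by (intro mult_red w) auto
  have inv: "inv\<^bsub>FG\<^esub> [(l, True)] = [(l, False)]"
    by (rule FG.inv_equality) (auto simp: linv_def)
  have "v \<otimes>\<^bsub>FG\<^esub> [(l, True)] = w \<otimes>\<^bsub>FG\<^esub> ([(l, False)] \<otimes>\<^bsub>FG\<^esub> [(l, True)])"
    unfolding v_def using w by (intro FG.m_assoc) auto
  also have "\<dots> = w"
    using w by (simp add: ccons_def linv_def foldr_ccons_Nil)
  finally have vl: "v \<otimes>\<^bsub>FG\<^esub> [(l, True)] = w" .
  have c: "rep v \<in> carrier FG" "rep w \<in> carrier FG" "[(l, True)] \<in> carrier FG"
    using rep_carrier v w by auto
  have "inv\<^bsub>FG\<^esub> (rep v \<otimes>\<^bsub>FG\<^esub> [(l, True)] \<otimes>\<^bsub>FG\<^esub> inv\<^bsub>FG\<^esub> rep w)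
      = rep w \<otimes>\<^bsub>FG\<^esub> (inv\<^bsub>FG\<^esub> [(l, True)] \<otimes>\<^bsub>FG\<^esub> inv\<^bsub>FG\<^esub> rep v)"
    using c by (simp only: FG.inv_mult_group FG.inv_inv FG.inv_closed FG.m_closed)
  also have "\<dots> = rep w \<otimes>\<^bsub>FG\<^esub> [(l, False)] \<otimes>\<^bsub>FG\<^esub> inv\<^bsub>FG\<^esub> rep v"
    unfolding inv[symmetric] by (intro FG.m_assoc[symmetric] FG.inv_closed c)
  finally show ?thesis
    unfolding schreier_gen_def v_def[symmetric] vl by (rule sym)
qed

lemma step_in_generate:
  assumes "reduced w"
  shows "rep w \<otimes>\<^bsub>FG\<^esub> [x] \<otimes>\<^bsub>FG\<^esub> inv\<^bsub>FG\<^esub> rep (w \<otimes>\<^bsub>FG\<^esub> [x]) \<in> generate FG basis"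
proof (cases "snd x")
  case True
  then show ?thesis
    using schreier_gen_in_generate[OF assms, of "fst x"] by (cases x) (auto simp: schreier_gen_def simp del: FG_simps)
next
  case False
  then obtain l where x: "x = (l, False)" by (cases x) auto
  have "basis \<subseteq> carrier FG" using basis_sub H.subset by auto
  moreover have "reduced (w \<otimes>\<^bsub>FG\<^esub> [(l, False)])" using assms by (intro mult_red) auto
  ultimately show ?thesis
    unfolding x schreier_gen_inv[OF assms] by (intro FG.generate_m_inv_closed schreier_gen_in_generate)
qed

text \<open>Telescoping: a word is the product of the elements that belong to the edges it traverses.\<close>

lemma rep_walk_in_generate:
  assumes "reduced w" "reduced u"
  shows "rep w \<otimes>\<^bsub>FG\<^esub> u \<otimes>\<^bsub>FG\<^esub> inv\<^bsub>FG\<^esub> rep (w \<otimes>\<^bsub>FG\<^esub> u) \<in> generate FG basis"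
  using assms
proof (induction u arbitrary: w)
  case Nil
  then have "rep w \<otimes>\<^bsub>FG\<^esub> [] \<otimes>\<^bsub>FG\<^esub> inv\<^bsub>FG\<^esub> rep (w \<otimes>\<^bsub>FG\<^esub> []) = \<one>\<^bsub>FG\<^esub>"
    using FG.r_one[of "rep w"] FG.r_one[of w] rep_carrier[of w] FG.r_inv[of "rep w"]
    by (simp only: FG_simps(3)) simp
  then show ?case by (simp only: generate.one)
next
  case (Cons x u)
  have u: "reduced u" using Cons.prems by (simp add: reduced_Cons)
  define v where "v = w \<otimes>\<^bsub>FG\<^esub> [x]"
  have v: "reduced v" unfolding v_def using Cons.prems by (intro mult_red) auto
  have xu: "x # u = [x] \<otimes>\<^bsub>FG\<^esub> u" using Cons.prems by (simp add: ccons_eq_Cons)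
  have c: "w \<in> carrier FG" "[x] \<in> carrier FG" "u \<in> carrier FG" "rep w \<in> carrier FG" "rep v \<in> carrier FG"
    using Cons.prems u rep_carrier v by auto
  have vu: "v \<otimes>\<^bsub>FG\<^esub> u = w \<otimes>\<^bsub>FG\<^esub> (x # u)"
    unfolding v_def xu by (rule FG.m_assoc) (use c in auto)
  define r where "r = rep (w \<otimes>\<^bsub>FG\<^esub> (x # u))"
  have r: "r \<in> carrier FG" unfolding r_def by (intro rep_carrier mult_red Cons.prems)
  have 1: "rep w \<otimes>\<^bsub>FG\<^esub> [x] \<otimes>\<^bsub>FG\<^esub> inv\<^bsub>FG\<^esub> rep v \<in> generate FG basis"
    unfolding v_def using Cons.prems by (intro step_in_generate)
  have 2: "rep v \<otimes>\<^bsub>FG\<^esub> u \<otimes>\<^bsub>FG\<^esub> inv\<^bsub>FG\<^esub> r \<in> generate FG basis"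
    using Cons.IH[OF v u] unfolding vu r_def .
  have "(rep w \<otimes>\<^bsub>FG\<^esub> [x] \<otimes>\<^bsub>FG\<^esub> inv\<^bsub>FG\<^esub> rep v) \<otimes>\<^bsub>FG\<^esub> (rep v \<otimes>\<^bsub>FG\<^esub> u \<otimes>\<^bsub>FG\<^esub> inv\<^bsub>FG\<^esub> r)
     = rep w \<otimes>\<^bsub>FG\<^esub> [x] \<otimes>\<^bsub>FG\<^esub> ((inv\<^bsub>FG\<^esub> rep v \<otimes>\<^bsub>FG\<^esub> rep v) \<otimes>\<^bsub>FG\<^esub> (u \<otimes>\<^bsub>FG\<^esub> inv\<^bsub>FG\<^esub> r))"
    using c r by (simp only: FG.m_assoc FG.m_closed FG.inv_closed)
  also have "\<dots> = rep w \<otimes>\<^bsub>FG\<^esub> ([x] \<otimes>\<^bsub>FG\<^esub> u) \<otimes>\<^bsub>FG\<^esub> inv\<^bsub>FG\<^esub> r"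
    using c r by (simp only: FG.l_inv FG.l_one FG.m_assoc FG.m_closed FG.inv_closed)
  finally have "rep w \<otimes>\<^bsub>FG\<^esub> (x # u) \<otimes>\<^bsub>FG\<^esub> inv\<^bsub>FG\<^esub> r \<in> generate FG basis"
    unfolding xu using generate.eng[OF 1 2] by argo
  then show ?case unfolding r_def .
qed

lemma generate_basis: "generate FG basis = H"
proof
  show "generate FG basis \<subseteq> H"
    using basis_sub subH by (rule FG.generate_subgroup_incl)
  show "H \<subseteq> generate FG basis"
  proof
    fix h assume h: "h \<in> H"
    have "rep [] = []" using rep_H[OF H.one_closed] by simp
    moreover have "[] \<otimes>\<^bsub>FG\<^esub> h = h" by simp
    moreover have "inv\<^bsub>FG\<^esub> [] = ([] :: ('l \<times> bool) list)" using FG.inv_one by simp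
    moreover have "h \<otimes>\<^bsub>FG\<^esub> [] = h" using H.mem_carrier[OF h] by (simp add: foldr_ccons_Nil)
    ultimately show "h \<in> generate FG basis"
      using rep_walk_in_generate[of "[]" h] H.mem_carrier[OF h] rep_H[OF h] by (simp only: FG_simps) simp
  qed
qed

text \<open>A map \<open>f\<close> on the basis extends to a homomorphism on \<open>H\<close>: let a word walk through the coset graph and
  multiply the values of the Schreier generators of the edges it traverses. Walks whose
  starting points differ by an element of \<open>H\<close> on the left traverse the same edges, so that walking is multiplicative on \<open>H\<close>, and
  walks in the tree contribute nothing, so that each basis element is sent to its prescribed value.\<close>

context
  fixes P :: "('p, 'q) monoid_scheme" and f :: "('l \<times> bool) list \<Rightarrow> 'p"
  assumes P: "group P" and f: "f \<in> basis \<rightarrow> carrier P"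
begin

interpretation P: group P by (rule P)

text \<open>Tree edges give the trivial Schreier generator; \<open>f\<close> is arbitrary there.\<close>

definition val :: "('l \<times> bool) list \<Rightarrow> 'p" where
  "val v = (if v = [] then \<one>\<^bsub>P\<^esub> else f v)"

fun transport :: "('l \<times> bool) list \<Rightarrow> ('l \<times> bool) list \<Rightarrow> 'p" where
  "transport w [] = \<one>\<^bsub>P\<^esub>"
| "transport w (x # u) =
     (if snd x then val (schreier_gen w (fst x)) else inv\<^bsub>P\<^esub> val (schreier_gen (foldr ccons w [x]) (fst x)))
       \<otimes>\<^bsub>P\<^esub> transport (foldr ccons w [x]) u"

definition step :: "('l \<times> bool) list \<Rightarrow> 'l \<times> bool \<Rightarrow> 'p" where
  "step w x = (if snd x then val (schreier_gen w (fst x)) else inv\<^bsub>P\<^esub> val (schreier_gen (foldr ccons w [x]) (fst x)))"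

lemma transport_Cons: "transport w (x # u) = step w x \<otimes>\<^bsub>P\<^esub> transport (foldr ccons w [x]) u"
  by (simp add: step_def)

declare transport.simps(2) [simp del]

lemma val_closed: "reduced w \<Longrightarrow> val (schreier_gen w l) \<in> carrier P"
  using f by (auto simp: val_def basis_def)

lemma step_closed: "reduced w \<Longrightarrow> step w x \<in> carrier P"
  by (auto simp: step_def intro!: val_closed P.inv_closed foldr_ccons_reduced)

lemma transport_closed: "reduced w \<Longrightarrow> transport w u \<in> carrier P"
  by (induction u arbitrary: w) (auto simp: transport_Cons step_closed foldr_ccons_reduced)

lemma walk_back: "reduced w \<Longrightarrow> foldr ccons (foldr ccons w [x]) [linv x] = w"
  by (simp add: foldr_ccons_assoc foldr_ccons_Nil)

lemma step_linv: "reduced w \<Longrightarrow> step (foldr ccons w [x]) (linv x) = inv\<^bsub>P\<^esub> step w x"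
  using walk_back[of w x] val_closed[of "foldr ccons w [x]" "fst x"]
  by (simp add: step_def foldr_ccons_reduced)

lemma transport_ccons:
  assumes w: "reduced w"
  shows "transport w (ccons x u) = step w x \<otimes>\<^bsub>P\<^esub> transport (foldr ccons w [x]) u"
proof (cases "\<exists>u'. u = linv x # u'")
  case True
  then obtain u' where u: "u = linv x # u'" by blast
  have "step w x \<otimes>\<^bsub>P\<^esub> transport (foldr ccons w [x]) u = 
      step w x \<otimes>\<^bsub>P\<^esub> (inv\<^bsub>P\<^esub> step w x \<otimes>\<^bsub>P\<^esub> transport w u')"
    by (simp add: u transport_Cons step_linv walk_back w)
  also have "\<dots> = transport w u'"
    using step_closed[OF w, of x] transport_closed[OF w, of u'] by (simp add: P.m_assoc[symmetric])
  finally show ?thesis by (simp add: u)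
next
  case False
  then have "ccons x u = x # u" by (cases u) auto
  then show ?thesis by (simp add: transport_Cons)
qed

lemma transport_mult:
  "reduced w \<Longrightarrow> reduced u \<Longrightarrow> reduced v \<Longrightarrow>
    transport w (foldr ccons u v) = transport w u \<otimes>\<^bsub>P\<^esub> transport (foldr ccons w u) v"
proof (induction u arbitrary: w)
  case Nil
  then show ?case by (simp add: foldr_ccons_Nil transport_closed)
next
  case (Cons x u)
  have wx: "reduced (foldr ccons w [x])" by (simp add: foldr_ccons_reduced)
  have u: "reduced u" using Cons.prems by (simp add: reduced_Cons)
  have "foldr ccons w (x # u) = foldr ccons (foldr ccons w [x]) u"
    using foldr_ccons_assoc[of u w "[x]"] u Cons.prems by (simp add: ccons_eq_Cons)
  moreover have "step w x \<otimes>\<^bsub>P\<^esub> transport (foldr ccons w [x]) u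
        \<otimes>\<^bsub>P\<^esub> transport (foldr ccons (foldr ccons w [x]) u) v
      = step w x \<otimes>\<^bsub>P\<^esub> (transport (foldr ccons w [x]) u
        \<otimes>\<^bsub>P\<^esub> transport (foldr ccons (foldr ccons w [x]) u) v)"
    by (intro P.m_assoc step_closed transport_closed foldr_ccons_reduced Cons.prems u wx)
  ultimately show ?case
    using Cons.IH[OF wx u Cons.prems(3)] Cons.prems(1) by (simp add: transport_ccons transport_Cons)
qed

lemma schreier_gen_cong:
  assumes "h \<in> H" "reduced w"
  shows "schreier_gen (h \<otimes>\<^bsub>FG\<^esub> w) l = schreier_gen w l"
proof -
  have "(h \<otimes>\<^bsub>FG\<^esub> w) \<otimes>\<^bsub>FG\<^esub> [(l, True)] = h \<otimes>\<^bsub>FG\<^esub> (w \<otimes>\<^bsub>FG\<^esub> [(l, True)])"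
    using assms H.mem_carrier[OF assms(1)] by (intro FG.m_assoc) auto
  then show ?thesis
    unfolding schreier_gen_def using rep_cong[OF assms(1)] assms(2) mult_red[of w "[(l, True)]"]
    by (metis reduced_single)
qed

lemma step_cong:
  assumes "h \<in> H" "reduced w"
  shows "step (foldr ccons h w) x = step w x"
proof -
  have "foldr ccons (foldr ccons h w) [x] = foldr ccons h (foldr ccons w [x])"
    by (simp add: foldr_ccons_assoc)
  then show ?thesis
    using schreier_gen_cong[OF assms(1)] assms(2) foldr_ccons_reduced[of "[x]" w] by (simp add: step_def)
qed

lemma transport_cong:
  "h \<in> H \<Longrightarrow> reduced w \<Longrightarrow> transport (foldr ccons h w) u = transport w u"
proof (induction u arbitrary: w)
  case (Cons x u)
  have "foldr ccons (foldr ccons h w) [x] = foldr ccons h (foldr ccons w [x])"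
    by (simp add: foldr_ccons_assoc)
  then show ?case
    using Cons foldr_ccons_reduced[of "[x]" w] by (simp add: transport_Cons step_cong)
qed simp

lemma val_Nil: "val [] = \<one>\<^bsub>P\<^esub>"
  by (simp add: val_def)

lemma snoc_mult: "reduced (u @ [x]) \<Longrightarrow> foldr ccons u [x] = u @ [x]"
  by (rule foldr_ccons_snoc[OF reduced_appendD, of u "[x]" x])
    (auto simp: reduced_def successively_append_iff linv_def)

lemma step_along_rep:
  assumes red: "reduced (u @ [x])" and rep: "rep (u @ [x]) = u @ [x]"
  shows "step u x = \<one>\<^bsub>P\<^esub>"
proof -
  have u: "reduced u" using red reduced_appendD by blast
  have repu: "rep u = u" using rep_prefix[OF red rep] .
  have ux: "u \<otimes>\<^bsub>FG\<^esub> [x] = u @ [x]" using snoc_mult[OF red] by simp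
  have one: "u \<otimes>\<^bsub>FG\<^esub> [x] \<otimes>\<^bsub>FG\<^esub> inv\<^bsub>FG\<^esub> (u @ [x]) = []"
    unfolding ux using FG.r_inv[of "u @ [x]"] red by simp
  show ?thesis
  proof (cases "snd x")
    case True
    then have x: "[(fst x, True)] = [x]" by (cases x) auto
    have "schreier_gen u (fst x) = []"
      unfolding schreier_gen_def x repu ux rep using one ux by simp
    then show ?thesis using True by (simp add: step_def val_Nil)
  next
    case False
    then have x: "(fst x, True) = linv x" by (cases x) (auto simp: linv_def)
    have "(u @ [x]) \<otimes>\<^bsub>FG\<^esub> [linv x] = u"
      using walk_back[OF u, of x] ux by simp
    then have "schreier_gen (u @ [x]) (fst x) = u \<otimes>\<^bsub>FG\<^esub> inv\<^bsub>FG\<^esub> u"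
      unfolding schreier_gen_def x rep by (simp add: repu)
    also have "\<dots> = []"
      using FG.r_inv[of u] u by simp
    finally show ?thesis using False ux by (simp add: step_def val_Nil)
  qed
qed

lemma transport_snoc:
  assumes "reduced (u @ [x])"
  shows "transport [] (u @ [x]) = transport [] u \<otimes>\<^bsub>P\<^esub> step u x"
proof -
  have u: "reduced u" using assms reduced_appendD by blast
  have "transport [] (u @ [x]) = transport [] (foldr ccons u [x])"
    by (simp add: snoc_mult[OF assms])
  also have "\<dots> = transport [] u \<otimes>\<^bsub>P\<^esub> step u x"
    using u step_closed[OF u] by (subst transport_mult) (auto simp: transport_Cons)
  finally show ?thesis .
qed

lemma transport_rep: "reduced r \<Longrightarrow> rep r = r \<Longrightarrow> transport [] r = \<one>\<^bsub>P\<^esub>"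
proof (induction r rule: rev_induct)
  case (snoc x u)
  then have "rep u = u" "reduced u" using rep_prefix reduced_appendD by blast+
  then show ?case using snoc by (simp add: transport_snoc step_along_rep)
qed simp

lemma transport_inv_rep:
  assumes "reduced r" "rep r = r"
  shows "transport r (inv\<^bsub>FG\<^esub> r) = \<one>\<^bsub>P\<^esub>"
proof -
  have ri: "reduced (inv\<^bsub>FG\<^esub> r)" using FG.inv_closed[of r] assms by simp
  have "transport [] (foldr ccons r (inv\<^bsub>FG\<^esub> r)) = transport [] r \<otimes>\<^bsub>P\<^esub> transport r (inv\<^bsub>FG\<^esub> r)"
    using assms ri by (subst transport_mult) auto
  moreover have "foldr ccons r (inv\<^bsub>FG\<^esub> r) = []"
    using FG.r_inv[of r] assms by simp
  ultimately show ?thesis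
    using transport_rep[OF assms] transport_closed[OF assms(1)] by simp
qed

lemma transport_schreier_gen:
  assumes w: "reduced w"
  shows "transport [] (schreier_gen w l) = val (schreier_gen w l)"
proof -
  define r where "r = rep w"
  define v where "v = r \<otimes>\<^bsub>FG\<^esub> [(l, True)]"
  define r' where "r' = rep v"
  have r: "reduced r" "rep r = r" unfolding r_def by (auto simp: rep_reduced rep_rep w)
  have v: "reduced v" unfolding v_def by (intro mult_red r) auto
  have r': "reduced r'" "rep r' = r'" unfolding r'_def by (auto simp: rep_reduced rep_rep v)
  have r'_eq: "r' = rep (w \<otimes>\<^bsub>FG\<^esub> [(l, True)])"
    unfolding r'_def v_def r_def using w by (intro rep_mult_rep) auto
  have s: "schreier_gen w l = v \<otimes>\<^bsub>FG\<^esub> inv\<^bsub>FG\<^esub> r'"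
    unfolding schreier_gen_def r'_eq[symmetric] v_def r_def ..
  have s': "schreier_gen r l = schreier_gen w l"
    unfolding s unfolding schreier_gen_def r(2) v_def[symmetric] r'_def[symmetric] ..
  have ri: "reduced (inv\<^bsub>FG\<^esub> r')" using FG.inv_closed[of r'] r' by simp
  have "transport v (inv\<^bsub>FG\<^esub> r') = transport r' (inv\<^bsub>FG\<^esub> r')"
  proof -
    obtain h where h: "h \<in> H" "r' = h \<otimes>\<^bsub>FG\<^esub> v" using rep_in v r'_def by blast
    then show ?thesis using transport_cong[OF h(1) v] by simp
  qed
  then have "transport [] (schreier_gen w l) = transport [] v"
    using v ri transport_inv_rep[OF r'] transport_closed by (simp add: s transport_mult)
  also have "\<dots> = step r (l, True)"
    using r transport_rep[OF r] step_closed by (simp add: v_def transport_mult transport_Cons)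
  also have "\<dots> = val (schreier_gen w l)"
    by (simp add: step_def s')
  finally show ?thesis .
qed

lemma basis_extension:
  "\<exists>\<theta>. (\<forall>x\<in>H. \<theta> x \<in> carrier P) \<and> (\<forall>x\<in>H. \<forall>y\<in>H. \<theta> (x \<otimes>\<^bsub>FG\<^esub> y) = \<theta> x \<otimes>\<^bsub>P\<^esub> \<theta> y) \<and>
    (\<forall>b\<in>basis. \<theta> b = f b)"
proof (intro exI[of _ "transport []"] conjI ballI)
  show "transport [] x \<in> carrier P" for x
    by (simp add: transport_closed)
  show "transport [] (x \<otimes>\<^bsub>FG\<^esub> y) = transport [] x \<otimes>\<^bsub>P\<^esub> transport [] y"
    if "x \<in> H" "y \<in> H" for x y
    using that transport_mult[of "[]" x y] transport_cong[of x "[]" y] H.mem_carrier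
    by (auto simp: foldr_ccons_Nil)
  show "transport [] b = f b" if b: "b \<in> basis" for b
    using b transport_schreier_gen by (auto simp: basis_def val_def)
qed

end

end

text \<open>The Nielsen-Schreier theorem, with freeness expressed as the extension of maps on the basis to
  homomorphisms into a given group.\<close>

theorem subgroup_of_free_group:
  assumes "subgroup H (FG :: ('l \<times> bool) list monoid)" and "group P"
  obtains B where "B \<subseteq> H" "generate FG B = H"
    "\<And>f. f \<in> B \<rightarrow> carrier P \<Longrightarrow>
      \<exists>\<theta>. (\<forall>x\<in>H. \<theta> x \<in> carrier P) \<and> (\<forall>x\<in>H. \<forall>y\<in>H. \<theta> (x \<otimes>\<^bsub>FG\<^esub> y) = \<theta> x \<otimes>\<^bsub>P\<^esub> \<theta> y) \<and>
        (\<forall>b\<in>B. \<theta> b = f b)"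
proof -
  interpret free_subgroup H by (rule free_subgroup.intro) (rule assms)
  show ?thesis
    by (rule that[OF basis_sub generate_basis basis_extension]) (use assms in auto)
qed

section \<open>Free groups have no laws in finite groups\<close>

lemma partial_injection_extends:
  assumes X: "finite X" and R: "R \<subseteq> X \<times> X" and sv: "single_valued R" "single_valued (R\<inverse>)"
  obtains f where "f \<in> Bij X" "\<And>x y. (x, y) \<in> R \<Longrightarrow> f x = y"
proof -
  define A where "A = Domain R"
  define B where "B = Range R"
  define r where "r x = (THE y. (x, y) \<in> R)" for x
  have r: "r x = y" if "(x, y) \<in> R" for x y
    unfolding r_def using that sv(1) by (auto simp: single_valued_def)
  have sub: "A \<subseteq> X" "B \<subseteq> X" using R by (auto simp: A_def B_def)
  have bij: "bij_betw r A B"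
    unfolding bij_betw_def
  proof
    show "inj_on r A"
    proof (rule inj_onI)
      fix x x' assume "x \<in> A" "x' \<in> A" "r x = r x'"
      then have "(x, r x) \<in> R" "(x', r x) \<in> R" using r by (auto simp: A_def)
      then show "x = x'" using sv(2) by (auto simp: single_valued_def)
    qed
    show "r ` A = B" using r by (force simp: A_def B_def)
  qed
  have fin: "finite A" "finite B" using sub X finite_subset by auto
  have "card (X - A) = card (X - B)"
    using sub fin bij_betw_same_card[OF bij] by (simp add: card_Diff_subset)
  then obtain g where g: "bij_betw g (X - A) (X - B)"
    using X finite_same_card_bij[of "X - A" "X - B"] by auto
  define f where "f = (\<lambda>x\<in>X. if x \<in> A then r x else g x)"
  have "bij_betw (\<lambda>x. if x \<in> A then r x else g x) (A \<union> (X - A)) (B \<union> (X - B))"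
    by (rule bij_betw_disjoint_Un[OF bij g]) auto
  moreover have "A \<union> (X - A) = X" "B \<union> (X - B) = X" using sub by auto
  ultimately have "bij_betw (\<lambda>x. if x \<in> A then r x else g x) X X" by metis
  moreover have "bij_betw f X X = bij_betw (\<lambda>x. if x \<in> A then r x else g x) X X"
    by (rule bij_betw_cong) (simp add: f_def)
  ultimately have "bij_betw f X X" by blast
  then have "f \<in> Bij X" by (simp add: Bij_def f_def)
  moreover have "f x = y" if "(x, y) \<in> R" for x y
    using that r R by (auto simp: f_def A_def)
  ultimately show ?thesis using that by blast
qed

lemma reduced_nth: "reduced w \<Longrightarrow> Suc i < length w \<Longrightarrow> w ! Suc i \<noteq> linv (w ! i)"
proof (induction w arbitrary: i)
  case (Cons x w)
  then show ?case by (cases i) (auto simp: reduced_Cons hd_conv_nth)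
qed simp

text \<open>Let \<open>n\<close> be the length of the word, and let its letters act on \<open>0, ..., n\<close> such that, read from the
  right, they move \<open>n\<close> to \<open>n - 1\<close>, then to \<open>n - 2\<close>, and so on down to \<open>0\<close>. These requirements define partial
  injections precisely because the word is reduced.\<close>

lemma nontrivial_word_not_law:
  fixes e :: "('l \<times> bool) list"
  assumes red: "reduced e" and ne: "e \<noteq> []"
  obtains \<theta> :: "'l \<Rightarrow> nat \<Rightarrow> nat" where "\<theta> \<in> UNIV \<rightarrow> carrier (BijGroup {..length e})"
    "ev (BijGroup {..length e}) \<theta> e \<noteq> \<one>\<^bsub>BijGroup {..length e}\<^esub>"
proof -
  define n where "n = length e"
  define X where "X = {..n}"
  define R where "R g = {(Suc i, i) | i. i < n \<and> e ! i = (g, True)} \<union> {(i, Suc i) | i. i < n \<and> e ! i = (g, False)}" for g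
  have cancel: False if "Suc i < n" "e ! i = (g, b)" "e ! Suc i = (g, \<not> b)" for i g b
    using reduced_nth[OF red, of i] that by (auto simp: linv_def n_def)
  have "single_valued (R g)" for g
    using cancel[of _ g True] cancel[of _ g False] by (auto simp: single_valued_def R_def)
  moreover have "single_valued ((R g)\<inverse>)" for g
    using cancel[of _ g True] cancel[of _ g False] by (auto simp: single_valued_def R_def)
  moreover have "R g \<subseteq> X \<times> X" for g
    by (auto simp: R_def X_def)
  ultimately have "\<exists>f. f \<in> Bij X \<and> (\<forall>x y. (x, y) \<in> R g \<longrightarrow> f x = y)" for g
    using partial_injection_extends[of X "R g"] by (metis X_def finite_atMost)
  then obtain \<theta> where \<theta>: "\<And>g. \<theta> g \<in> Bij X" "\<And>g x y. (x, y) \<in> R g \<Longrightarrow> \<theta> g x = y"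
    by metis
  interpret G: group "BijGroup X" by (rule group_BijGroup)
  have car: "carrier (BijGroup X) = Bij X" by (simp add: BijGroup_def)
  have \<theta>c: "\<theta> g \<in> carrier (BijGroup X)" for g using \<theta> car by simp
  have evc: "ev (BijGroup X) \<theta> w \<in> Bij X" for w
    using G.ev_closed[of w \<theta>] \<theta>c car by simp
  have "ev (BijGroup X) \<theta> (drop i e) n = i" if "i \<le> n" for i
    using that
  proof (induction i rule: inc_induct)
    case base
    then show ?case by (simp add: n_def BijGroup_def X_def)
  next
    case (step i)
    obtain g b where gb: "e ! i = (g, b)" by (cases "e ! i") auto
    define t where "t = (if b then \<theta> g else inv\<^bsub>BijGroup X\<^esub> \<theta> g)"
    have t: "t \<in> Bij X" using \<theta>c G.inv_closed car by (auto simp: t_def)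
    have iX: "i \<in> X" "Suc i \<in> X" "n \<in> X" using step by (auto simp: X_def)
    have "t (Suc i) = i"
    proof (cases b)
      case True
      then show ?thesis using \<theta>(2)[of "Suc i" i g] step gb by (auto simp: t_def R_def)
    next
      case False
      then have "\<theta> g i = Suc i" using \<theta>(2)[of i "Suc i" g] step gb by (auto simp: R_def)
      moreover have "inj_on (\<theta> g) X" using \<theta>(1)[of g] by (simp add: Bij_def bij_betw_def)
      ultimately show ?thesis
        using False iX \<theta>(1)[of g] inv_into_f_f[of "\<theta> g" X i] by (simp add: t_def inv_BijGroup)
    qed
    moreover have "drop i e = (g, b) # drop (Suc i) e"
      using step gb by (metis Cons_nth_drop_Suc n_def)
    ultimately have "ev (BijGroup X) \<theta> (drop i e) = t \<otimes>\<^bsub>BijGroup X\<^esub> ev (BijGroup X) \<theta> (drop (Suc i) e)"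
      by (simp add: ev_Cons t_def)
    also have "\<dots> = compose X t (ev (BijGroup X) \<theta> (drop (Suc i) e))"
      using t evc by (simp add: BijGroup_def)
    finally show ?case
      using step.IH iX \<open>t (Suc i) = i\<close> by (simp add: compose_eq)
  qed
  from this[of 0] have "ev (BijGroup X) \<theta> e n = 0" by simp
  moreover have "\<one>\<^bsub>BijGroup X\<^esub> n = n" by (simp add: BijGroup_def X_def)
  moreover have "n \<noteq> 0" using ne by (simp add: n_def)
  ultimately have "ev (BijGroup X) \<theta> e \<noteq> \<one>\<^bsub>BijGroup X\<^esub>" by metis
  then show ?thesis using that[of \<theta>] \<theta>c by (simp add: X_def n_def)
qed

section \<open>Relations lower the rank\<close>

text \<open>Otherwise the subgroup \<open>H\<close> has \<open>card S\<close> distinct basis elements. Homomorphisms from \<open>H\<close> to a finite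
  group \<open>P\<close> are determined by their values at \<open>y ` S\<close>, and there is one for each choice of values at these
  basis elements, which makes at least as many as there are maps from \<open>S\<close> to \<open>P\<close>. So every map from
  \<open>S\<close> to \<open>P\<close> arises from a homomorphism and satisfies the relation \<open>e\<close>; but \<open>e\<close> is not a law of the
  permutation group chosen for \<open>P\<close>.\<close>

theorem relation_lowers_rank:
  fixes y :: "'g \<Rightarrow> ('l \<times> bool) list" and e :: "('g \<times> bool) list"
  assumes S: "finite S" and y: "y ` S \<subseteq> carrier FG"
    and e: "reduced e" "e \<noteq> []" "fst ` set e \<subseteq> S" and rel: "ev FG y e = []"
  obtains B where "finite B" "card B < card S" "B \<subseteq> carrier FG" "generate FG B = generate FG (y ` S)"
proof -
  define P :: "(nat \<Rightarrow> nat) monoid" where "P = BijGroup {..length e}"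
  have P: "group P" unfolding P_def by (rule group_BijGroup)
  interpret P: group P by (rule P)
  have "Bij {..length e} \<subseteq> {..length e} \<rightarrow>\<^sub>E {..length e}"
    by (auto simp: Bij_def PiE_def extensional_def bij_betw_def)
  then have finP: "finite (carrier P)"
    unfolding P_def BijGroup_def by (auto intro: finite_subset finite_PiE)
  have cardP: "card (carrier P) > 0" using finP P.one_closed by (auto simp: card_gt_0_iff)
  define H where "H = generate FG (y ` S)"
  have subH: "subgroup H FG" unfolding H_def using y by (rule FG.generate_is_subgroup)
  have yH: "y g \<in> H" if "g \<in> S" for g unfolding H_def using that by (auto intro: generate.incl)
  obtain B where B: "B \<subseteq> H" "generate FG B = H" and ext: "\<And>f. f \<in> B \<rightarrow> carrier P \<Longrightarrow>
      \<exists>\<theta>. (\<forall>x\<in>H. \<theta> x \<in> carrier P) \<and> (\<forall>x\<in>H. \<forall>y\<in>H. \<theta> (x \<otimes>\<^bsub>FG\<^esub> y) = \<theta> x \<otimes>\<^bsub>P\<^esub> \<theta> y) \<and>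
        (\<forall>b\<in>B. \<theta> b = f b)"
    using subgroup_of_free_group[OF subH P] by blast
  have Bc: "B \<subseteq> carrier FG" using B(1) subgroup.subset[OF subH] by blast
  show ?thesis
  proof (cases "finite B \<and> card B < card S")
    case True
    then show ?thesis using that B(2) Bc H_def by metis
  next
    case False
    then obtain B' where B': "B' \<subseteq> B" "finite B'" "card B' = card S"
      by (metis obtain_subset_with_card_n infinite_arbitrarily_large not_less)
    define F where "F = (B' \<rightarrow>\<^sub>E carrier P)"
    define good where "good f \<theta> \<longleftrightarrow> (\<forall>x\<in>H. \<theta> x \<in> carrier P) \<and>
      (\<forall>x\<in>H. \<forall>y\<in>H. \<theta> (x \<otimes>\<^bsub>FG\<^esub> y) = \<theta> x \<otimes>\<^bsub>P\<^esub> \<theta> y) \<and> (\<forall>b\<in>B'. \<theta> b = f b)" for f \<theta>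
    have "\<exists>\<theta>. good f \<theta>" if "f \<in> F" for f
    proof -
      have "(\<lambda>b. if b \<in> B' then f b else \<one>\<^bsub>P\<^esub>) \<in> B \<rightarrow> carrier P"
        using that by (auto simp: F_def)
      from ext[OF this] obtain \<theta> where \<theta>: "\<forall>x\<in>H. \<theta> x \<in> carrier P"
        "\<forall>x\<in>H. \<forall>y\<in>H. \<theta> (x \<otimes>\<^bsub>FG\<^esub> y) = \<theta> x \<otimes>\<^bsub>P\<^esub> \<theta> y"
        "\<forall>b\<in>B. \<theta> b = (if b \<in> B' then f b else \<one>\<^bsub>P\<^esub>)" by blast
      have "\<forall>b\<in>B'. \<theta> b = f b" using \<theta>(3) B'(1) by (metis subsetD)
      with \<theta>(1,2) show ?thesis unfolding good_def by blast
    qed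
    then obtain h where h: "\<And>f. f \<in> F \<Longrightarrow> good f (h f)" by metis
    have h_hom: "\<And>x. x \<in> H \<Longrightarrow> h f x \<in> carrier P"
      "\<And>x y. x \<in> H \<Longrightarrow> y \<in> H \<Longrightarrow> h f (x \<otimes>\<^bsub>FG\<^esub> y) = h f x \<otimes>\<^bsub>P\<^esub> h f y"
      "\<And>b. b \<in> B' \<Longrightarrow> h f b = f b" if "f \<in> F" for f
      using h[OF that] unfolding good_def by blast+
    define \<Phi> where "\<Phi> f = (\<lambda>g\<in>S. h f (y g))" for f
    have maps: "\<Phi> ` F \<subseteq> (S \<rightarrow>\<^sub>E carrier P)"
      using h_hom(1) yH by (auto simp: \<Phi>_def)
    have inj: "inj_on \<Phi> F"
    proof (rule inj_onI)
      fix f f' assume f: "f \<in> F" "f' \<in> F" and eq: "\<Phi> f = \<Phi> f'"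
      have eq': "h f x = h f' x" if "x \<in> y ` S" for x
      proof -
        obtain g where g: "g \<in> S" "x = y g" using \<open>x \<in> y ` S\<close> by blast
        from fun_cong[OF eq, of g] g show ?thesis by (simp add: \<Phi>_def)
      qed
      have "h f z = h f' z" if "z \<in> H" for z
        by (rule FG.hom_eq_on_generate[OF P y h_hom(1,2)[OF f(1), unfolded H_def] h_hom(1,2)[OF f(2), unfolded H_def] eq'])
          (use that in \<open>simp_all only: H_def\<close>)
      then have eqB: "f b = f' b" if "b \<in> B'" for b
        using h_hom(3)[OF f(1) that] h_hom(3)[OF f(2) that] that B'(1) B(1) by force
      show "f = f'"
        by (rule PiE_ext[OF f[unfolded F_def] eqB])
    qed
    have "card F = card (S \<rightarrow>\<^sub>E carrier P)"
      unfolding F_def using B'(2,3) S by (simp add: card_PiE)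
    moreover have fin: "finite (S \<rightarrow>\<^sub>E carrier P)" using S finP by (intro finite_PiE) auto
    ultimately have surj: "\<Phi> ` F = (S \<rightarrow>\<^sub>E carrier P)"
      using maps inj by (metis card_image card_subset_eq)
    obtain \<theta> :: "'g \<Rightarrow> nat \<Rightarrow> nat" where \<theta>: "\<theta> \<in> UNIV \<rightarrow> carrier P" "ev P \<theta> e \<noteq> \<one>\<^bsub>P\<^esub>"
      using nontrivial_word_not_law[OF e(1,2)] unfolding P_def by blast
    have "restrict \<theta> S \<in> \<Phi> ` F" unfolding surj using \<theta> by auto
    then obtain f where f: "f \<in> F" "\<Phi> f = restrict \<theta> S" by force
    have hf: "h f (y g) = \<theta> g" if "g \<in> S" for g
      using fun_cong[OF f(2), of g] that by (simp add: \<Phi>_def)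
    have "h f (ev FG y e) = ev P (h f \<circ> y) e"
      by (rule conjunct1[OF FG.hom_ev[OF P subH h_hom(1,2)[OF f(1)]]]) (use yH e(3) in auto)
    also have "\<dots> = ev P \<theta> e"
      unfolding ev_def using e(3) hf by (intro foldr_cong) (auto split: prod.split)
    finally have "h f [] = ev P \<theta> e" by (simp add: rel)
    moreover have "h f [] = \<one>\<^bsub>P\<^esub>"
      using FG.hom_ev[OF P subH h_hom(1,2)[OF f(1)], of "[]" "\<lambda>x. x"] by simp
    ultimately show ?thesis using \<theta>(2) by simp
  qed
qed

section \<open>A criterion for freeness\<close>

lemma foldr_ccons_right_inverse: "foldr ccons v (map linv (rev v)) = []"
proof -
  have "foldr ccons v (map linv (rev v) @ u) = u" for u
  proof (induction v arbitrary: u)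
    case (Cons x v)
    have "foldr ccons v (map linv (rev v) @ [linv x] @ u) = [linv x] @ u"
      by (rule Cons.IH)
    then show ?case by simp
  qed simp
  from this[of "[]"] show ?thesis by simp
qed

text \<open>The generating set \<open>S\<close> of least size is a basis: a nontrivial relation between its elements would, lifted
  to a free group, produce a smaller generating set.\<close>

theorem free_group_criterion:
  fixes G :: "('g, 'b) monoid_scheme"
  assumes G: "group G" and fg: "finitely_generated G"
    and lift: "\<And>S e. finite S \<Longrightarrow> S \<subseteq> carrier G \<Longrightarrow> fst ` set e \<subseteq> S \<Longrightarrow> word_eval G e = \<one>\<^bsub>G\<^esub> \<Longrightarrow>
      \<exists>(f :: 'l \<Rightarrow> 'g) y. f \<in> UNIV \<rightarrow> carrier G \<and> y ` S \<subseteq> carrier FG \<and>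
        (\<forall>g\<in>S. ev G f (y g) = g) \<and> ev FG y e = []"
  shows "free_group G"
proof -
  interpret G: group G by (rule G)
  define good where "good S \<longleftrightarrow> finite S \<and> S \<subseteq> carrier G \<and> generate G S = carrier G" for S
  have "\<exists>S. good S" using fg by (simp add: finitely_generated_def good_def)
  then obtain S where S: "good S" and min: "\<And>S'. good S' \<Longrightarrow> card S \<le> card S'"
    using ex_has_least_nat[of good _ card] by blast
  have Sc: "finite S" "S \<subseteq> carrier G" "generate G S = carrier G" using S by (auto simp: good_def)
  have no_rel: "e = []" if e: "reduced e" "fst ` set e \<subseteq> S" "ev G (\<lambda>b. b) e = \<one>\<^bsub>G\<^esub>" for e
  proof (rule ccontr)
    assume ne: "e \<noteq> []"
    obtain f :: "'l \<Rightarrow> 'g" and y where fy: "f \<in> UNIV \<rightarrow> carrier G" "y ` S \<subseteq> carrier FG"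
      "\<And>g. g \<in> S \<Longrightarrow> ev G f (y g) = g" "ev FG y e = []"
      using lift[OF Sc(1,2) e(2)] e(3) unfolding word_eval_eq_ev by blast
    obtain B where B: "finite B" "card B < card S" "B \<subseteq> carrier FG"
      "generate FG B = generate FG (y ` S)"
      using relation_lowers_rank[OF Sc(1) fy(2) e(1) ne e(2) fy(4)] by blast
    have ec: "ev G f w \<in> carrier G" for w using fy(1) by (intro G.ev_closed) auto
    have "ev G f z \<in> generate G (ev G f ` B)" if "z \<in> generate FG B" for z
      using that
    proof (induction z rule: generate.induct)
      case one
      then show ?case by (simp add: generate.one)
    next
      case (inv h)
      then have "h \<in> carrier FG" using B(3) by blast
      then have "ev G f (inv\<^bsub>FG\<^esub> h) = inv\<^bsub>G\<^esub> ev G f h" by (rule G.ev_inv_FG[OF fy(1)])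
      then show ?case using inv by (auto intro: generate.inv)
    next
      case (eng h1 h2)
      then show ?case using G.ev_mult_FG[OF fy(1)] by (metis generate.eng)
    qed (auto intro: generate.incl)
    moreover have "y g \<in> generate FG B" if "g \<in> S" for g
      unfolding B(4) using that by (auto intro: generate.incl)
    ultimately have SB: "S \<subseteq> generate G (ev G f ` B)" using fy(3) by (metis subsetI)
    have BG: "ev G f ` B \<subseteq> carrier G" using ec by auto
    have "carrier G \<subseteq> generate G (ev G f ` B)"
      using G.generate_subgroup_incl[OF SB G.generate_is_subgroup[OF BG]] Sc(3) by simp
    then have "good (ev G f ` B)"
      using B(1) BG G.generate_incl[OF BG] by (auto simp: good_def)
    from min[OF this] B(2) card_image_le[OF B(1), of "ev G f"] show False by simp
  qed
  have "bij_betw (word_eval G) (reduced_words S) (carrier G)"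
    unfolding bij_betw_def
  proof
    show "inj_on (word_eval G) (reduced_words S)"
    proof (rule inj_onI)
      fix u v assume u: "u \<in> reduced_words S" and v: "v \<in> reduced_words S" 
        and eq: "word_eval G u = word_eval G v"
      have ur: "reduced u" "fst ` set u \<subseteq> S" and vr: "reduced v" "fst ` set v \<subseteq> S"
        using u v by (auto simp: reduced_words_eq)
      define v' where "v' = map linv (rev v)"
      define w where "w = foldr ccons v' u"
      have v'l: "fst ` set v' \<subseteq> S" using vr by (auto simp: v'_def)
      have wr: "reduced w" unfolding w_def using ur by (simp add: foldr_ccons_reduced)
      have wl: "fst ` set w \<subseteq> S" unfolding w_def using foldr_ccons_letters[of v' u] ur v'l by blast
      have v'v: "foldr ccons v' v = []"
        unfolding v'_def by (induction v) (auto simp: ccons_linv)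
      have evs: "ev G (\<lambda>b. b) (foldr ccons v' t) = ev G (\<lambda>b. b) v' \<otimes>\<^bsub>G\<^esub> ev G (\<lambda>b. b) t"
        if "fst ` set t \<subseteq> S" for t
        using that v'l Sc(2) by (intro G.ev_mult) auto
      have "ev G (\<lambda>b. b) w = ev G (\<lambda>b. b) (foldr ccons v' v)"
        unfolding w_def using evs[OF ur(2)] evs[OF vr(2)] eq by (simp add: word_eval_eq_ev)
      then have "w = []" using no_rel wr wl v'v by simp
      then have 0: "foldr ccons v' u = foldr ccons v' v" by (simp add: w_def v'v)
      have "foldr ccons v (foldr ccons v' t) = t" if "reduced t" for t
      proof -
        have "foldr ccons v v' = []"
          unfolding v'_def by (rule foldr_ccons_right_inverse)
        moreover have "foldr ccons (foldr ccons v v') t = foldr ccons v (foldr ccons v' t)"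
          by (rule foldr_ccons_assoc[OF that])
        ultimately show ?thesis by (metis foldr.simps(1) id_apply)
      qed
      from this[OF ur(1)] this[OF vr(1)] 0 show "u = v" by argo
    qed
    show "word_eval G ` reduced_words S = carrier G"
    proof
      show "word_eval G ` reduced_words S \<subseteq> carrier G"
        using Sc(2) by (auto simp: word_eval_eq_ev reduced_words_eq intro!: G.ev_closed)
      show "carrier G \<subseteq> word_eval G ` reduced_words S"
      proof
        fix z assume "z \<in> carrier G"
        then have "z \<in> generate G S" using Sc(3) by simp
        from G.generate_imp_ev[OF Sc(2) this] show "z \<in> word_eval G ` reduced_words S"
          unfolding word_eval_eq_ev reduced_words_eq by blast
      qed
    qed
  qed
  then show ?thesis unfolding free_group_def using G Sc(2) by blast
qed

section \<open>Local systems\<close>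

text \<open>A local system attaches an element of \<open>G\<close> to each pair of points of a small open set. It encodes a
  homomorphism on path classes: the product over a fine subdivision of a path depends only on the homotopy
  class of the path (\<open>transp_homotopic\<close>). Stating the axioms for the members of a base of the topology, with
  compatibility for smaller members, avoids any choice of a fine enough cover.\<close>

locale local_system = group G for G :: "('g, 'h) monoid_scheme" (structure) +
  fixes M :: "'a::topological_space set" and \<B> :: "'a set set" and c :: "'a set \<Rightarrow> 'a \<Rightarrow> 'a \<Rightarrow> 'g"
  assumes base_open: "V \<in> \<B> \<Longrightarrow> openin (top_of_set M) V"
    and base: "\<And>x T. x \<in> T \<Longrightarrow> openin (top_of_set M) T \<Longrightarrow> \<exists>V\<in>\<B>. x \<in> V \<and> V \<subseteq> T"
    and c_closed [simp]: "V \<in> \<B> \<Longrightarrow> a \<in> V \<Longrightarrow> b \<in> V \<Longrightarrow> c V a b \<in> carrier G"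
    and c_cocycle: "V \<in> \<B> \<Longrightarrow> a \<in> V \<Longrightarrow> b \<in> V \<Longrightarrow> d \<in> V \<Longrightarrow> c V a b \<otimes> c V b d = c V a d"
    and c_restrict: "V \<in> \<B> \<Longrightarrow> W \<in> \<B> \<Longrightarrow> W \<subseteq> V \<Longrightarrow> a \<in> W \<Longrightarrow> b \<in> W \<Longrightarrow> c W a b = c V a b"
begin

text \<open>A section along \<open>f\<close> is a primitive of the local system pulled back by \<open>f\<close>.\<close>

definition sec :: "'x::topological_space set \<Rightarrow> ('x \<Rightarrow> 'a) \<Rightarrow> ('x \<Rightarrow> 'g) \<Rightarrow> bool" where
  "sec X f m \<longleftrightarrow> (\<forall>x\<in>X. m x \<in> carrier G) \<and>
     (\<forall>x\<in>X. \<forall>V\<in>\<B>. f x \<in> V \<longrightarrow> (\<forall>\<^sub>F y in at x within X. m y = m x \<otimes> c V (f x) (f y)))"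

lemma base_sub: "V \<in> \<B> \<Longrightarrow> V \<subseteq> M"
  using base_open openin_imp_subset by blast

lemma base_at: "x \<in> M \<Longrightarrow> \<exists>V\<in>\<B>. x \<in> V"
  using base[of x M] by auto

lemma c_self [simp]: "V \<in> \<B> \<Longrightarrow> a \<in> V \<Longrightarrow> c V a a = \<one>"
  using c_cocycle[of V a a a] by (metis c_closed l_cancel_one)

lemma eventually_in_open:
  assumes "continuous_on X f" "f ` X \<subseteq> M" "x \<in> X" "openin (top_of_set M) T" "f x \<in> T"
  shows "\<forall>\<^sub>F y in at x within X. f y \<in> T"
proof -
  obtain S where S: "open S" "T = M \<inter> S"
    using assms(4) by (auto simp: openin_open)
  have "(f \<longlongrightarrow> f x) (at x within X)"
    using assms by (auto simp: continuous_on_def)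
  then have "\<forall>\<^sub>F y in at x within X. f y \<in> S"
    using S assms(5) by (auto intro: topological_tendstoD)
  moreover have "\<forall>\<^sub>F y in at x within X. y \<in> X"
    by (auto simp: eventually_at_topological)
  ultimately show ?thesis
    by eventually_elim (use assms S in auto)
qed

lemma c_eventually_eq:
  assumes "continuous_on X f" "f ` X \<subseteq> M" "x \<in> X" and V: "V \<in> \<B>" "f x \<in> V" and W: "W \<in> \<B>" "f x \<in> W"
  shows "\<forall>\<^sub>F y in at x within X. c V (f x) (f y) = c W (f x) (f y)"
proof -
  have "openin (top_of_set M) (V \<inter> W)"
    using base_open V W by auto
  then obtain T where T: "T \<in> \<B>" "f x \<in> T" "T \<subseteq> V \<inter> W"
    using base[of "f x" "V \<inter> W"] V W by auto
  have "\<forall>\<^sub>F y in at x within X. f y \<in> T"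
    using assms T base_open by (intro eventually_in_open) auto
  then show ?thesis
  proof eventually_elim
    case (elim y)
    then show ?case
      using c_restrict[of V T] c_restrict[of W T] V W T by auto
  qed
qed

lemma sec_closed: "sec X f m \<Longrightarrow> x \<in> X \<Longrightarrow> m x \<in> carrier G"
  by (simp add: sec_def)

lemma sec_at:
  "sec X f m \<Longrightarrow> x \<in> X \<Longrightarrow> V \<in> \<B> \<Longrightarrow> f x \<in> V \<Longrightarrow> \<forall>\<^sub>F y in at x within X. m y = m x \<otimes> c V (f x) (f y)"
  by (simp add: sec_def)

text \<open>One small set at each point suffices, because different ones agree near the point.\<close>

lemma secI:
  assumes f: "continuous_on X f" "f ` X \<subseteq> M"
    and m: "\<And>x. x \<in> X \<Longrightarrow> m x \<in> carrier G"
    and ex: "\<And>x. x \<in> X \<Longrightarrow> \<exists>V\<in>\<B>. f x \<in> V \<and> (\<forall>\<^sub>F y in at x within X. m y = m x \<otimes> c V (f x) (f y))"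
  shows "sec X f m"
  unfolding sec_def
proof (intro conjI ballI impI)
  fix x V assume x: "x \<in> X" and V: "V \<in> \<B>" "f x \<in> V"
  obtain W where W: "W \<in> \<B>" "f x \<in> W" "\<forall>\<^sub>F y in at x within X. m y = m x \<otimes> c W (f x) (f y)"
    using ex[OF x] by blast
  from W(3) c_eventually_eq[OF f x V W(1,2)]
  show "\<forall>\<^sub>F y in at x within X. m y = m x \<otimes> c V (f x) (f y)"
    by eventually_elim simp
qed (rule m)

lemma sec_cong:
  assumes "sec X f m" "\<And>x. x \<in> X \<Longrightarrow> f x = f' x" "\<And>x. x \<in> X \<Longrightarrow> m x = m' x"
  shows "sec X f' m'"
  unfolding sec_def
proof (intro conjI ballI impI)
  fix x V assume x: "x \<in> X" and V: "V \<in> \<B>" "f' x \<in> V"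
  have "\<forall>\<^sub>F y in at x within X. y \<in> X" by (auto simp: eventually_at_topological)
  with sec_at[OF assms(1) x V(1)] V(2) assms(2)[OF x]
  have "\<forall>\<^sub>F y in at x within X. m y = m x \<otimes> c V (f x) (f y) \<and> y \<in> X"
    by (auto intro: eventually_conj)
  then show "\<forall>\<^sub>F y in at x within X. m' y = m' x \<otimes> c V (f' x) (f' y)"
    by eventually_elim (use assms x in auto)
qed (use assms sec_closed in force)

lemma sec_compose:
  assumes s: "sec X f m" and \<theta>: "continuous_on Y \<theta>" "\<theta> ` Y \<subseteq> X"
  shows "sec Y (\<lambda>y. f (\<theta> y)) (\<lambda>y. m (\<theta> y))"
  unfolding sec_def
proof (intro conjI ballI impI)
  fix y V assume y: "y \<in> Y" and V: "V \<in> \<B>" "f (\<theta> y) \<in> V"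
  let ?P = "\<lambda>x. m x = m (\<theta> y) \<otimes> c V (f (\<theta> y)) (f x)"
  have yX: "\<theta> y \<in> X" using \<theta> y by auto
  obtain T where T: "open T" "\<theta> y \<in> T" "\<And>x. x \<in> T \<Longrightarrow> x \<noteq> \<theta> y \<Longrightarrow> x \<in> X \<Longrightarrow> ?P x"
    using sec_at[OF s yX V] unfolding eventually_at_topological by blast
  have P: "?P x" if "x \<in> T" "x \<in> X" for x
    using T(3)[OF that(1) _ that(2)] V sec_closed[OF s yX] by (cases "x = \<theta> y") auto
  have "(\<theta> \<longlongrightarrow> \<theta> y) (at y within Y)"
    using \<theta> y by (auto simp: continuous_on_def)
  then have "\<forall>\<^sub>F z in at y within Y. \<theta> z \<in> T"
    using T by (auto intro: topological_tendstoD)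
  moreover have "\<forall>\<^sub>F z in at y within Y. z \<in> Y" by (auto simp: eventually_at_topological)
  ultimately show "\<forall>\<^sub>F z in at y within Y. ?P (\<theta> z)"
    by eventually_elim (use P \<theta> in auto)
qed (use assms sec_closed in blast)

lemma sec_subset: "sec X f m \<Longrightarrow> Y \<subseteq> X \<Longrightarrow> sec Y f m"
  using sec_compose[of X f m Y "\<lambda>y. y"] by auto

lemma sec_lmult:
  assumes s: "sec X f m" and f: "f ` X \<subseteq> M" "continuous_on X f" and k: "k \<in> carrier G"
  shows "sec X f (\<lambda>x. k \<otimes> m x)"
  unfolding sec_def
proof (intro conjI ballI impI)
  fix x V assume x: "x \<in> X" and V: "V \<in> \<B>" "f x \<in> V"
  from sec_at[OF s x V] eventually_in_open[OF f(2,1) x base_open[OF V(1)] V(2)]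
  show "\<forall>\<^sub>F y in at x within X. k \<otimes> m y = k \<otimes> m x \<otimes> c V (f x) (f y)"
    by eventually_elim (use sec_closed[OF s x] k V in \<open>simp add: m_assoc\<close>)
qed (use k sec_closed[OF s] in auto)

text \<open>Two sections differ by a locally constant factor.\<close>

lemma sec_unique:
  assumes X: "connected X" and f: "continuous_on X f" "f ` X \<subseteq> M"
    and s: "sec X f m" "sec X f m'" and ab: "a \<in> X" "b \<in> X"
  shows "m a \<otimes> inv m' a = m b \<otimes> inv m' b"
proof (rule connected_local_const[OF X ab], intro ballI)
  fix x assume x: "x \<in> X"
  then obtain V where V: "V \<in> \<B>" "f x \<in> V" using base_at f by blast
  from sec_at[OF s(1) x V] sec_at[OF s(2) x V] eventually_in_open[OF f x base_open[OF V(1)] V(2)]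
  show "\<forall>\<^sub>F y in at x within X. m x \<otimes> inv m' x = m y \<otimes> inv m' y"
  proof eventually_elim
    case (elim y)
    have c: "m x \<in> carrier G" "m' x \<in> carrier G" "c V (f x) (f y) \<in> carrier G"
      using sec_closed s x V elim by auto
    have "m y \<otimes> inv m' y = (m x \<otimes> c V (f x) (f y)) \<otimes> (inv c V (f x) (f y) \<otimes> inv m' x)"
      unfolding elim(1,2) using c by (simp add: inv_mult_group)
    also have "\<dots> = m x \<otimes> (c V (f x) (f y) \<otimes> inv c V (f x) (f y)) \<otimes> inv m' x"
      using c by (simp only: m_assoc m_closed inv_closed)
    finally show ?case using c by simp
  qed
qed

lemma sec_unique':
  assumes X: "connected X" and f: "continuous_on X f" "f ` X \<subseteq> M"
    and s: "sec X f m" "sec X f m'" and ab: "a \<in> X" "b \<in> X"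
  shows "inv m a \<otimes> m b = inv m' a \<otimes> m' b"
proof -
  have c: "m a \<in> carrier G" "m b \<in> carrier G" "m' a \<in> carrier G" "m' b \<in> carrier G"
    using sec_closed s ab by auto
  have "m a \<otimes> (inv m' a \<otimes> m' b) = m b"
    using sec_unique[OF assms] c by (metis inv_closed m_assoc l_inv r_one)
  then show ?thesis using c by (metis inv_closed m_assoc l_inv l_one m_closed)
qed

lemma sec_in_base:
  assumes f: "continuous_on X f" "f ` X \<subseteq> V" and V: "V \<in> \<B>" and a: "a \<in> V"
  shows "sec X f (\<lambda>x. c V a (f x))"
proof (rule secI)
  show "f ` X \<subseteq> M" using f V base_sub by blast
  have fV: "f y \<in> V" if "y \<in> X" for y using f that by blast
  fix x assume x: "x \<in> X"
  have "\<forall>\<^sub>F y in at x within X. y \<in> X" by (auto simp: eventually_at_topological)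
  then have "\<forall>\<^sub>F y in at x within X. c V a (f y) = c V a (f x) \<otimes> c V (f x) (f y)"
    by eventually_elim (use c_cocycle[OF V a fV[OF x] fV] in simp)
  then show "\<exists>W\<in>\<B>. f x \<in> W \<and> (\<forall>\<^sub>F y in at x within X. c V a (f y) = c V a (f x) \<otimes> c W (f x) (f y))"
    using f V x by blast
qed (use assms in auto)

lemma sec_diff_in_base:
  assumes X: "connected X" and f: "continuous_on X f" "f ` X \<subseteq> V" and V: "V \<in> \<B>"
    and s: "sec X f m" and ab: "a \<in> X" "b \<in> X"
  shows "inv m a \<otimes> m b = c V (f a) (f b)"
proof -
  have fa: "f a \<in> V" "f b \<in> V" using f ab by auto
  have "f ` X \<subseteq> M" using f V base_sub by blast
  then have "inv m a \<otimes> m b = inv c V (f a) (f a) \<otimes> c V (f a) (f b)"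
    by (rule sec_unique'[OF X f(1) _ s sec_in_base[OF f V fa(1)] ab])
  then show ?thesis using V fa by simp
qed

lemma sec_step_in_base:
  assumes "connected X" "continuous_on X f" "f ` X \<subseteq> V" "V \<in> \<B>" "sec X f m" "a \<in> X" "b \<in> X"
  shows "m b = m a \<otimes> c V (f a) (f b)"
proof -
  have c: "m a \<in> carrier G" "m b \<in> carrier G" using sec_closed assms by auto
  show ?thesis unfolding sec_diff_in_base[OF assms, symmetric] using c
    by (simp add: m_assoc[symmetric])
qed

lemma sec_Un_closed:
  assumes "closed X" "closed Y" "sec X f m" "sec Y f m"
  shows "sec (X \<union> Y) f m"
  unfolding sec_def
proof (intro conjI ballI impI)
  fix x V assume x: "x \<in> X \<union> Y" and V: "V \<in> \<B>" "f x \<in> V"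
  have *: "\<forall>\<^sub>F y in at x within Z. m y = m x \<otimes> c V (f x) (f y)" if "closed Z" "sec Z f m" for Z
  proof (cases "x \<in> Z")
    case True
    then show ?thesis using sec_at that V by blast
  next
    case False
    then show ?thesis using that(1) unfolding eventually_at_topological
      by (intro exI[of _ "- Z"]) auto
  qed
  show "\<forall>\<^sub>F y in at x within X \<union> Y. m y = m x \<otimes> c V (f x) (f y)"
    unfolding at_within_union eventually_sup using * assms by blast
qed (use assms sec_closed in blast)

text \<open>Sections exist over short intervals, and sections over adjacent intervals match after one of them is
  multiplied by a constant.\<close>

lemma sec_interval_exists:
  fixes f :: "real \<Rightarrow> 'a"
  assumes st: "s \<le> t" and f: "continuous_on {s..t} f" "f ` {s..t} \<subseteq> M"
  shows "\<exists>m. sec {s..t} f m"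
proof -
  have "s \<le> s \<and> t \<le> t \<longrightarrow> (\<exists>m. sec {s..t} f m)"
  proof (rule Bolzano[OF st, where P = "\<lambda>a b. s \<le> a \<and> b \<le> t \<longrightarrow> (\<exists>m. sec {a..b} f m)"])
    fix a b d
    assume 1: "s \<le> a \<and> b \<le> t \<longrightarrow> (\<exists>m. sec {a..b} f m)" 
      and 2: "s \<le> b \<and> d \<le> t \<longrightarrow> (\<exists>m. sec {b..d} f m)" and ab: "a \<le> b" "b \<le> d"
    show "s \<le> a \<and> d \<le> t \<longrightarrow> (\<exists>m. sec {a..d} f m)"
    proof
      assume ad: "s \<le> a \<and> d \<le> t"
      obtain m m' where m: "sec {a..b} f m" and m': "sec {b..d} f m'"
        using 1 2 ab ad by force
      have c: "m b \<in> carrier G" "m' b \<in> carrier G"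
        using sec_closed[OF m, of b] sec_closed[OF m', of b] ab by auto
      define k where "k = m b \<otimes> inv m' b"
      define n where "n x = (if x \<le> b then m x else k \<otimes> m' x)" for x
      have "k \<otimes> m' b = m b" using c by (simp add: k_def m_assoc)
      have "{a..b} \<subseteq> {s..t}" "{b..d} \<subseteq> {s..t}" using ab ad by auto
      then have fs: "f ` {b..d} \<subseteq> M" "continuous_on {b..d} f"
        using f by (blast, blast intro: continuous_on_subset)
      have "sec {a..b} f n"
        by (rule sec_cong[OF m]) (auto simp: n_def)
      moreover have "sec {b..d} f n"
        by (rule sec_cong[OF sec_lmult[OF m' fs, of k]])
          (use c \<open>k \<otimes> m' b = m b\<close> in \<open>auto simp: n_def k_def\<close>)
      moreover have "{a..d} = {a..b} \<union> {b..d}" using ab by auto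
      ultimately show "\<exists>m. sec {a..d} f m"
        using sec_Un_closed[of "{a..b}" "{b..d}"] by auto
    qed
  next
    fix x assume x: "s \<le> x" "x \<le> t"
    then obtain V where V: "V \<in> \<B>" "f x \<in> V" using base_at f by fastforce
    have "\<forall>\<^sub>F y in at x within {s..t}. f y \<in> V"
      using f x V base_open by (intro eventually_in_open) auto
    then obtain d where d: "d > 0" "\<And>y. y \<in> {s..t} \<Longrightarrow> dist y x < d \<Longrightarrow> f y \<in> V"
      using V unfolding eventually_at by (metis zero_less_dist_iff)
    show "\<exists>d>0. \<forall>a b. a \<le> x \<and> x \<le> b \<and> b - a < d \<longrightarrow> s \<le> a \<and> b \<le> t \<longrightarrow> (\<exists>m. sec {a..b} f m)"
    proof (intro exI[of _ d] conjI allI impI)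
      fix a b assume ab: "a \<le> x \<and> x \<le> b \<and> b - a < d" "s \<le> a \<and> b \<le> t"
      have "f ` {a..b} \<subseteq> V"
        using ab by (auto intro!: d(2) simp: dist_real_def abs_less_iff)
      moreover have "continuous_on {a..b} f"
        by (rule continuous_on_subset[OF f(1)]) (use ab in auto)
      ultimately show "\<exists>m. sec {a..b} f m"
        using sec_in_base V by blast
    qed (rule d)
  qed
  then show ?thesis by simp
qed

text \<open>Take sections along the segments that start at a fixed point \<open>x0\<close>, normalized there; their values at
  the ends are a section over \<open>X\<close>. For this, compare the segments to \<open>x\<close> and to a point \<open>y\<close> near \<open>x\<close>,
  moving along both in small simultaneous steps.\<close>

theorem sec_convex_exists:
  fixes f :: "'x::real_normed_vector \<Rightarrow> 'a"
  assumes X: "convex X" and f: "continuous_on X f" "f ` X \<subseteq> M"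
  shows "\<exists>m. sec X f m"
proof (cases "X = {}")
  case True
  then show ?thesis by (simp add: sec_def)
next
  case False
  then obtain x0 where x0: "x0 \<in> X" by blast
  define \<gamma> where "\<gamma> y s = x0 + s *\<^sub>R (y - x0)" for y :: 'x and s :: real
  define F where "F y s = f (\<gamma> y s)" for y s
  have \<gamma>: "\<gamma> y s \<in> X" if "y \<in> X" "s \<in> {0..1}" for y s
  proof -
    have "\<gamma> y s = (1 - s) *\<^sub>R x0 + s *\<^sub>R y" by (simp add: \<gamma>_def algebra_simps)
    then show ?thesis using X x0 that by (auto simp: convex_alt)
  qed
  have F_M: "F y s \<in> M" if "y \<in> X" "s \<in> {0..1}" for y s
    using \<gamma>[OF that] f by (auto simp: F_def)
  have F_cont2: "continuous_on (X \<times> {0..1}) (\<lambda>z. F (fst z) (snd z))"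
    unfolding F_def
    by (rule continuous_on_compose2[OF f(1)]) (auto simp: \<gamma>_def[abs_def] intro!: continuous_intros \<gamma>[unfolded \<gamma>_def])
  have F_cont: "continuous_on {0..1} (F y)" if "y \<in> X" for y
    unfolding F_def using \<gamma> that
    by (intro continuous_on_compose2[OF f(1)]) (auto simp: \<gamma>_def[abs_def] intro!: continuous_intros)
  have F_cont': "continuous_on X (\<lambda>y. F y s)" if "s \<in> {0..1}" for s
    unfolding F_def using \<gamma> that
    by (intro continuous_on_compose2[OF f(1)]) (auto simp: \<gamma>_def[abs_def] intro!: continuous_intros)
  have "\<exists>m. sec {0..1} (F y) m \<and> m 0 = \<one>" if y: "y \<in> X" for y
  proof -
    have FM: "F y ` {0..1} \<subseteq> M" using F_M y by auto
    obtain m where m: "sec {0..1} (F y) m"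
      using sec_interval_exists[OF _ F_cont[OF y] FM] by auto
    have m0: "m 0 \<in> carrier G" using sec_closed[OF m, of 0] by simp
    then have "sec {0..1} (F y) (\<lambda>x. inv m 0 \<otimes> m x)"
      by (intro sec_lmult m F_cont FM y inv_closed)
    then show ?thesis using m0 by (intro exI[of _ "\<lambda>x. inv m 0 \<otimes> m x"]) simp
  qed
  then obtain m where m: "\<And>y. y \<in> X \<Longrightarrow> sec {0..1} (F y) (m y)" "\<And>y. y \<in> X \<Longrightarrow> m y 0 = \<one>"
    by metis
  have mc: "m y s \<in> carrier G" if "y \<in> X" "s \<in> {0..1}" for y s
    using sec_closed m(1) that by blast
  have in_X: "\<forall>\<^sub>F y in at x within X. y \<in> X" for x
    by (auto simp: eventually_at_topological)
  have main: "\<forall>\<^sub>F y in at x within X. m y 1 = m x 1 \<otimes> c W (f x) (f y)"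
    if x: "x \<in> X" and W: "W \<in> \<B>" "f x \<in> W" for x W
  proof -
    (* The square with vertices F x a, F y a, F y b and F x b commutes. *)
    define P where "P a b \<longleftrightarrow> (0 \<le> a \<and> a \<le> b \<and> b \<le> 1 \<longrightarrow> (\<forall>U\<in>\<B>. \<forall>V\<in>\<B>. F x a \<in> U \<longrightarrow> F x b \<in> V \<longrightarrow>
      (\<forall>\<^sub>F y in at x within X. c U (F x a) (F y a) \<otimes> (inv m y a \<otimes> m y b)
         = (inv m x a \<otimes> m x b) \<otimes> c V (F x b) (F y b))))" for a b
    have "P 0 1"
    proof (rule Bolzano)
      fix a b d assume P: "P a b" "P b d" and ab: "a \<le> b" "b \<le> d"
      show "P a d"
        unfolding P_def
      proof (intro impI ballI)
        fix U V assume ad: "0 \<le> a \<and> a \<le> d \<and> d \<le> 1" and U: "U \<in> \<B>" "F x a \<in> U" and V: "V \<in> \<B>" "F x d \<in> V"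
        have I: "a \<in> {0..1}" "b \<in> {0..1}" "d \<in> {0..1}" using ab ad by auto
        obtain T where T: "T \<in> \<B>" "F x b \<in> T" using base_at F_M[OF x I(2)] by blast
        have 1: "\<forall>\<^sub>F y in at x within X. c U (F x a) (F y a) \<otimes> (inv m y a \<otimes> m y b)
         = (inv m x a \<otimes> m x b) \<otimes> c T (F x b) (F y b)"
          using P(1) U T ab ad unfolding P_def by auto
        have 2: "\<forall>\<^sub>F y in at x within X. c T (F x b) (F y b) \<otimes> (inv m y b \<otimes> m y d)
         = (inv m x b \<otimes> m x d) \<otimes> c V (F x d) (F y d)"
          using P(2) V T ab ad unfolding P_def by auto
        have im: "(\<lambda>y. F y s) ` X \<subseteq> M" if "s \<in> {0..1}" for s using F_M that by auto
        note ev = eventually_in_open[OF F_cont' im x base_open]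
        show "\<forall>\<^sub>F y in at x within X. c U (F x a) (F y a) \<otimes> (inv m y a \<otimes> m y d)
         = (inv m x a \<otimes> m x d) \<otimes> c V (F x d) (F y d)"
          using 1 2 in_X ev[OF I(1) I(1) U] ev[OF I(2) I(2) T] ev[OF I(3) I(3) V]
        proof eventually_elim
          case (elim y)
          have cc: "m x a \<in> carrier G" "m x b \<in> carrier G" "m x d \<in> carrier G"
             "m y a \<in> carrier G" "m y b \<in> carrier G" "m y d \<in> carrier G"
            "c U (F x a) (F y a) \<in> carrier G" "c T (F x b) (F y b) \<in> carrier G" "c V (F x d) (F y d) \<in> carrier G"
            using mc x I elim U T V by auto
          have tr: "inv p \<otimes> q \<otimes> (inv q \<otimes> r) = inv p \<otimes> r"
            if "p \<in> carrier G" "q \<in> carrier G" "r \<in> carrier G" for p q r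
            using that by (metis inv_closed m_assoc r_inv l_one m_closed)
          have "c U (F x a) (F y a) \<otimes> (inv m y a \<otimes> m y d)
            = (c U (F x a) (F y a) \<otimes> (inv m y a \<otimes> m y b)) \<otimes> (inv m y b \<otimes> m y d)"
            using cc tr by (metis inv_closed m_assoc m_closed)
          also have "\<dots> = (inv m x a \<otimes> m x b) \<otimes> (c T (F x b) (F y b) \<otimes> (inv m y b \<otimes> m y d))"
            unfolding elim(1) using cc by (intro m_assoc m_closed inv_closed)
          also have "\<dots> = ((inv m x a \<otimes> m x b) \<otimes> (inv m x b \<otimes> m x d)) \<otimes> c V (F x d) (F y d)"
            unfolding elim(2) using cc by (intro m_assoc[symmetric] m_closed inv_closed)
          finally show ?case using tr cc by simp
        qed
      qed
    next
      fix t :: real assume t: "0 \<le> t" "t \<le> 1"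
      then have tI: "t \<in> {0..1}" by auto
      obtain V where V: "V \<in> \<B>" "F x t \<in> V" using base_at F_M[OF x tI] by blast
      have "\<forall>\<^sub>F z in at (x, t) within X \<times> {0..1}. F (fst z) (snd z) \<in> V"
        by (rule eventually_in_open[OF F_cont2 _ _ base_open[OF V(1)]]) (use F_M x tI V in auto)
      then obtain T where T: "open T" "(x, t) \<in> T" 
          "\<And>z. z \<in> T \<Longrightarrow> z \<in> X \<times> {0..1} \<Longrightarrow> F (fst z) (snd z) \<in> V"
        using V unfolding eventually_at_topological by (metis fst_conv snd_conv)
      then obtain A B where AB: "open A" "open B" "(x, t) \<in> A \<times> B" "A \<times> B \<subseteq> T"
        using open_prod_elim[OF T(1,2)] by metis
      then obtain d where d: "d > 0" "ball t d \<subseteq> B" using open_contains_ball by (metis mem_Sigma_iff)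
      have inV: "F y s \<in> V" if "y \<in> A" "y \<in> X" "s \<in> {0..1}" "dist t s < d" for y s
      proof -
        have "s \<in> B" using d(2) that by auto
        then show ?thesis using T(3)[of "(y, s)"] AB(4) that by auto
      qed
      show "\<exists>d>0. \<forall>a b. a \<le> t \<and> t \<le> b \<and> b - a < d \<longrightarrow> P a b"
      proof (intro exI[of _ d] conjI allI impI)
        fix a b assume ab: "a \<le> t \<and> t \<le> b \<and> b - a < d"
        show "P a b"
          unfolding P_def
        proof (intro impI ballI)
          fix U1 U2 assume ad: "0 \<le> a \<and> a \<le> b \<and> b \<le> 1" and U1: "U1 \<in> \<B>" "F x a \<in> U1" and U2: "U2 \<in> \<B>" "F x b \<in> U2"
          have I: "a \<in> {0..1}" "b \<in> {0..1}" using ad by auto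
          have sub: "F y ` {a..b} \<subseteq> V" if "y \<in> A" "y \<in> X" for y
            using inV[OF that] ab ad by (auto simp: dist_real_def)
          have diff: "inv m y a \<otimes> m y b = c V (F y a) (F y b)" if "y \<in> A" "y \<in> X" for y
          proof (rule sec_diff_in_base[OF _ _ sub[OF that] V(1)])
            show "continuous_on {a..b} (F y)"
              by (rule continuous_on_subset[OF F_cont[OF that(2)]]) (use ad in auto)
            show "sec {a..b} (F y) (m y)"
              by (rule sec_subset[OF m(1)[OF that(2)]]) (use ad in auto)
          qed (use ad in auto)
          have xA: "x \<in> A" using AB by auto
          have inV': "F y a \<in> V" "F y b \<in> V" if "y \<in> A" "y \<in> X" for y
            using sub[OF that] ad by auto
          have im: "(\<lambda>y. F y s) ` X \<subseteq> M" if "s \<in> {0..1}" for s using F_M that by auto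
          have 1: "\<forall>\<^sub>F y in at x within X. c U1 (F x a) (F y a) = c V (F x a) (F y a)"
            by (rule c_eventually_eq[OF F_cont'[OF I(1)] im[OF I(1)] x U1 V(1) inV'(1)[OF xA x]])
          have 2: "\<forall>\<^sub>F y in at x within X. c U2 (F x b) (F y b) = c V (F x b) (F y b)"
            by (rule c_eventually_eq[OF F_cont'[OF I(2)] im[OF I(2)] x U2 V(1) inV'(2)[OF xA x]])
          have 3: "\<forall>\<^sub>F y in at x within X. y \<in> A"
            using AB(1) xA by (auto simp: eventually_at_topological)
          show "\<forall>\<^sub>F y in at x within X. c U1 (F x a) (F y a) \<otimes> (inv m y a \<otimes> m y b)
             = (inv m x a \<otimes> m x b) \<otimes> c U2 (F x b) (F y b)"
            using 1 2 3 in_X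
          proof eventually_elim
            case (elim y)
            show ?case
              unfolding elim(1,2) diff[OF elim(3,4)] diff[OF xA x]
              using c_cocycle[OF V(1)] inV'[OF elim(3,4)] inV'[OF xA x] by simp
          qed
        qed
      qed (rule d)
    qed simp
    have F0: "F y 0 = f x0" and F1: "F y 1 = f y" for y
      by (auto simp: F_def \<gamma>_def)
    obtain U where U: "U \<in> \<B>" "f x0 \<in> U" using base_at f x0 by blast
    have "\<forall>\<^sub>F y in at x within X. c U (F x 0) (F y 0) \<otimes> (inv m y 0 \<otimes> m y 1)
         = (inv m x 0 \<otimes> m x 1) \<otimes> c W (F x 1) (F y 1)"
      using \<open>P 0 1\<close> U W unfolding P_def F0 F1 by auto
    then show ?thesis using in_X
    proof eventually_elim
      case (elim y)
      then show ?case
        using mc[of y 1] mc[of x 1] x m(2) U by (simp add: F0 F1)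
    qed
  qed
  have "sec X f (\<lambda>y. m y 1)"
    unfolding sec_def using main mc by auto
  then show ?thesis by blast
qed

text \<open>The value of the local system on a path; it does not depend on the section.\<close>

definition transp :: "(real \<Rightarrow> 'a) \<Rightarrow> 'g" where
  "transp g = (THE k. \<exists>m. sec {0..1} g m \<and> k = inv m 0 \<otimes> m 1)"

lemma transp_eq:
  assumes g: "path g" "path_image g \<subseteq> M" and m: "sec {0..1} g m"
  shows "transp g = inv m 0 \<otimes> m 1"
  unfolding transp_def
proof (rule the_equality)
  fix k assume "\<exists>m. sec {0..1} g m \<and> k = inv m 0 \<otimes> m 1"
  then obtain m' where m': "sec {0..1} g m'" "k = inv m' 0 \<otimes> m' 1" by blast
  show "k = inv m 0 \<otimes> m 1"
    unfolding m'(2)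
    by (rule sec_unique'[OF connected_Icc _ _ m'(1) m]) (use g in \<open>auto simp: path_def path_image_def\<close>)
qed (use m in auto)

lemma sec_path_exists:
  assumes "path g" "path_image g \<subseteq> M"
  obtains m where "sec {0..1} g m"
  using sec_interval_exists[of 0 1 g] assms by (auto simp: path_def path_image_def)

lemma transp_closed:
  assumes "path g" "path_image g \<subseteq> M"
  shows "transp g \<in> carrier G"
proof -
  obtain m where m: "sec {0..1} g m" using sec_path_exists assms by blast
  then show ?thesis using transp_eq[OF assms m] sec_closed[OF m] by auto
qed

lemma transp_join:
  assumes g: "path g" "path_image g \<subseteq> M" and h: "path h" "path_image h \<subseteq> M"
    and gh: "pathfinish g = pathstart h"
  shows "transp (g +++ h) = transp g \<otimes> transp h"
proof -
  have p: "path (g +++ h)" "path_image (g +++ h) \<subseteq> M"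
    using assms by (auto simp: path_image_join)
  obtain m where m: "sec {0..1} (g +++ h) m" using sec_path_exists p by blast
  have c: "m 0 \<in> carrier G" "m (1/2) \<in> carrier G" "m 1 \<in> carrier G"
    using sec_closed[OF m] by auto
  have "sec {0..1} (\<lambda>t. (g +++ h) (t / 2)) (\<lambda>t. m (t / 2))"
    by (rule sec_compose[OF m]) (auto intro!: continuous_intros)
  then have mg: "sec {0..1} g (\<lambda>t. m (t / 2))"
    by (rule sec_cong) (auto simp: joinpaths_def)
  have "sec {0..1} (\<lambda>t. (g +++ h) ((t + 1) / 2)) (\<lambda>t. m ((t + 1) / 2))"
    by (rule sec_compose[OF m]) (auto intro!: continuous_intros)
  then have mh: "sec {0..1} h (\<lambda>t. m ((t + 1) / 2))"
    by (rule sec_cong) (use gh in \<open>auto simp: joinpaths_def pathfinish_def pathstart_def add_divide_distrib\<close>)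
  have "transp g \<otimes> transp h = (inv m 0 \<otimes> m (1/2)) \<otimes> (inv m (1/2) \<otimes> m 1)"
    unfolding transp_eq[OF g mg] transp_eq[OF h mh] by simp
  also have "\<dots> = inv m 0 \<otimes> ((m (1/2) \<otimes> inv m (1/2)) \<otimes> m 1)"
    using c by (metis inv_closed m_assoc m_closed)
  also have "\<dots> = transp (g +++ h)"
    unfolding transp_eq[OF p m] using c by simp
  finally show ?thesis ..
qed

lemma transp_reversepath:
  assumes g: "path g" "path_image g \<subseteq> M"
  shows "transp (reversepath g) = inv transp g"
proof -
  obtain m where m: "sec {0..1} g m" using sec_path_exists g by blast
  have c: "m 0 \<in> carrier G" "m 1 \<in> carrier G" using sec_closed[OF m] by auto
  have "sec {0..1} (\<lambda>t. g (1 - t)) (\<lambda>t. m (1 - t))"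
    by (rule sec_compose[OF m]) (auto intro!: continuous_intros)
  then have "sec {0..1} (reversepath g) (\<lambda>t. m (1 - t))"
    by (rule sec_cong) (auto simp: reversepath_def)
  then have "transp (reversepath g) = inv m 1 \<otimes> m 0"
    using transp_eq[of "reversepath g"] g by simp
  then show ?thesis unfolding transp_eq[OF g m] using c by (simp add: inv_mult_group)
qed

lemma transp_const:
  assumes "p \<in> M"
  shows "transp (\<lambda>_. p) = \<one>"
proof -
  obtain V where V: "V \<in> \<B>" "p \<in> V" using base_at assms by blast
  have "sec {0..1} (\<lambda>_. p) (\<lambda>_. c V p p)" using V by (intro sec_in_base) auto
  then have "sec {0..1} (\<lambda>_. p) (\<lambda>_. \<one>)" using V by simp
  from transp_eq[OF _ _ this] assms show ?thesis
    by (simp add: path_image_def path_def image_constant_conv)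
qed

lemma sec_const_path:
  fixes m :: "real \<Rightarrow> 'g"
  assumes "p \<in> M" "sec {0..1} (\<lambda>_. p) m"
  shows "m 1 = m 0"
proof -
  obtain V where V: "V \<in> \<B>" "p \<in> V" using base_at assms by blast
  have "m 1 = m 0 \<otimes> c V p p"
    by (rule sec_step_in_base[OF _ _ _ V(1) assms(2)]) (use V in auto)
  then show ?thesis using V sec_closed[OF assms(2), of 0] by simp
qed

text \<open>A section over the unit square restricts to sections along the two paths and along the two constant
  sides.\<close>

lemma transp_homotopic:
  assumes "homotopic_paths M g h"
  shows "transp g = transp h"
proof -
  obtain H :: "real \<times> real \<Rightarrow> 'a" where H: "continuous_on ({0..1} \<times> {0..1}) H"
      "H \<in> ({0..1} \<times> {0..1}) \<rightarrow> M"
      "\<forall>x\<in>{0..1}. H (0, x) = g x" "\<forall>x\<in>{0..1}. H (1, x) = h x"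
      "\<forall>t\<in>{0..1}. pathstart (H \<circ> Pair t) = pathstart g \<and> pathfinish (H \<circ> Pair t) = pathfinish g"
    using assms unfolding homotopic_paths by blast
  have HM: "H ` ({0..1} \<times> {0..1}) \<subseteq> M" using H(2) by blast
  have H5: "\<forall>t\<in>{0..1}. H (t, 0) = g 0" "\<forall>t\<in>{0..1}. H (t, 1) = g 1"
    using H(5) by (auto simp: pathstart_def pathfinish_def)
  have p: "path g" "path_image g \<subseteq> M" "path h" "path_image h \<subseteq> M"
    using homotopic_paths_imp_path[OF assms] homotopic_paths_imp_subset[OF assms] by auto
  have "convex ({0..1} \<times> {0..1} :: (real \<times> real) set)" by (intro convex_Times) auto
  then obtain m where m: "sec ({0..1} \<times> {0..1}) H m" using sec_convex_exists[OF _ H(1) HM] by blast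
  have "sec {0..1} (\<lambda>t. H (0, t)) (\<lambda>t. m (0, t))"
    by (rule sec_compose[OF m]) (auto intro!: continuous_intros)
  then have 1: "sec {0..1} g (\<lambda>t. m (0, t))" by (rule sec_cong) (use H(3,4) H5 in auto)
  have "sec {0..1} (\<lambda>t. H (1, t)) (\<lambda>t. m (1, t))"
    by (rule sec_compose[OF m]) (auto intro!: continuous_intros)
  then have 2: "sec {0..1} h (\<lambda>t. m (1, t))" by (rule sec_cong) (use H(3,4) H5 in auto)
  have "sec {0..1} (\<lambda>t. H (t, 0)) (\<lambda>t. m (t, 0))"
    by (rule sec_compose[OF m]) (auto intro!: continuous_intros)
  then have "sec {0..1} (\<lambda>t. g 0) (\<lambda>t. m (t, 0))" by (rule sec_cong) (use H(3,4) H5 in auto)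
  then have 3: "m (1, 0) = m (0, 0)" using p(2) by (intro sec_const_path[of "g 0"]) (auto simp: path_image_def)
  have "sec {0..1} (\<lambda>t. H (t, 1)) (\<lambda>t. m (t, 1))"
    by (rule sec_compose[OF m]) (auto intro!: continuous_intros)
  then have "sec {0..1} (\<lambda>t. g 1) (\<lambda>t. m (t, 1))" by (rule sec_cong) (use H(3,4) H5 in auto)
  then have 4: "m (1, 1) = m (0, 1)" using p(2) by (intro sec_const_path[of "g 1"]) (auto simp: path_image_def)
  show ?thesis
    unfolding transp_eq[OF p(1,2) 1] transp_eq[OF p(3,4) 2] 3 4 ..
qed

end

section \<open>Charts and boxes\<close>

lemma hproj_eq: "hproj k x = x - (x $ k) *\<^sub>R axis k 1"
  by (auto simp: hproj_def vec_eq_iff axis_def)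

lemma hproj_k [simp]: "hproj k x $ k = 0"
  by (simp add: hproj_def)

lemma linear_hproj: "linear (hproj k)"
  by (auto simp: linear_iff hproj_def vec_eq_iff)

lemma continuous_on_hproj [continuous_intros]: "continuous_on S f \<Longrightarrow> continuous_on S (\<lambda>x. hproj k (f x))"
  unfolding hproj_eq by (intro continuous_intros)

lemma hproj_hyp: "x \<in> hyp k \<Longrightarrow> hproj k x = x"
  by (simp add: hyp_def hproj_eq)

lemma hproj_in_hyp [simp]: "hproj k x \<in> hyp k"
  by (simp add: hyp_def)

lemma convex_hyp: "convex (hyp k)"
  by (auto simp: hyp_def convex_def)

definition Box :: "'n::finite \<Rightarrow> real ^ 'n \<Rightarrow> real \<Rightarrow> real \<Rightarrow> (real ^ 'n) set" where
  "Box k a r s = {x. dist (hproj k x) (hproj k a) < r \<and> dist (x $ k) (a $ k) < s}"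

lemma Box_vimage: "Box k a r s = hproj k -` ball (hproj k a) r \<inter> (\<lambda>x. x $ k) -` ball (a $ k) s"
  by (auto simp: Box_def dist_commute)

lemma open_Box: "open (Box k a r s)"
  unfolding Box_vimage
  by (intro open_Int open_vimage open_ball) (auto intro!: continuous_intros)

lemma convex_Box: "convex (Box k a r s)"
  unfolding Box_vimage
  by (intro convex_Int convex_linear_vimage convex_ball linear_hproj) (auto simp: linear_iff)

lemma Box_in_ball: "Box k a e e \<subseteq> ball a (2 * e)"
proof
  fix x assume x: "x \<in> Box k a e e"
  have "x - a = (hproj k x - hproj k a) + ((x $ k) - (a $ k)) *\<^sub>R axis k 1"
    by (simp add: hproj_eq algebra_simps)
  then have "norm (x - a) \<le> norm (hproj k x - hproj k a) + norm (((x $ k) - (a $ k)) *\<^sub>R (axis k 1 :: real ^ 'a))"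
    by (metis norm_triangle_ineq)
  also have "\<dots> < 2 * e"
    using x by (simp add: Box_def dist_norm)
  finally show "x \<in> ball a (2 * e)"
    by (simp add: dist_norm norm_minus_commute)
qed

abbreviation lev :: "'n::finite \<Rightarrow> ('a, 'n) chart \<Rightarrow> 'a \<Rightarrow> real" where
  "lev k c x \<equiv> snd c x $ k"

text \<open>The part of a chart domain with coordinates in a box. Chart domains of a foliated atlas are themselves of
  this form (\<open>chart_is_box\<close>).\<close>

definition box_in :: "'n::finite \<Rightarrow> ('a, 'n) chart \<Rightarrow> real ^ 'n \<Rightarrow> real \<Rightarrow> real \<Rightarrow> 'a set" where
  "box_in k c a r s = {x \<in> fst c. snd c x \<in> Box k a r s}"

definition boxes :: "'n::finite \<Rightarrow> ('a, 'n) chart set \<Rightarrow> 'a set set" where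
  "boxes k F = {box_in k c a r s | c a r s. c \<in> F \<and> Box k a r s \<subseteq> snd c ` fst c}"

definition chinv :: "('a, 'n) chart \<Rightarrow> real ^ 'n \<Rightarrow> 'a" where
  "chinv c = inv_into (fst c) (snd c)"

text \<open>Defined for points outside \<open>N\<close> as well, where it is a singleton; \<open>leaves\<close> consists of the classes
  of the points of \<open>N\<close>.\<close>

definition leaf :: "'n::finite \<Rightarrow> ('a, 'n) chart set \<Rightarrow> 'a \<Rightarrow> 'a set" where
  "leaf k F x = (plaque_rel k F)\<^sup>* `` {x}"

locale closed_planes =
  fixes k :: "'n::finite" and N :: "'a::topological_space set" and A F :: "('a, 'n) chart set"
  assumes haus: "Hausdorff_space (top_of_set N)"
    and fol: "foliation_by_closed_planes k N A F"
begin

lemma C2_fol: "C2_foliation k N A F"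
  using fol by (simp add: foliation_by_closed_planes_def foliation_by_planes_def)

lemma atlas: "C2_atlas N F"
  using C2_fol by (simp add: C2_foliation_def)

lemma chart: "c \<in> F \<Longrightarrow> is_chart N c"
  using atlas by (simp add: C2_atlas_def)

lemma chart_cover:
  assumes "x \<in> N"
  shows "\<exists>c\<in>F. x \<in> fst c"
proof -
  have "(\<Union>(U, \<phi>)\<in>F. U) = N" using atlas by (simp add: C2_atlas_def)
  then have "x \<in> (\<Union>(U, \<phi>)\<in>F. U)" using assms by simp
  then obtain c where "c \<in> F" "x \<in> (case c of (U, \<phi>) \<Rightarrow> U)" by blast
  then show ?thesis by (intro bexI[of _ c]) (simp_all add: case_prod_beta)
qed

lemma chart_openin: "c \<in> F \<Longrightarrow> openin (top_of_set N) (fst c)"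
  using chart[of c] by (auto simp: is_chart_def split: prod.splits)

lemma chart_sub: "c \<in> F \<Longrightarrow> fst c \<subseteq> N"
  using chart_openin openin_imp_subset by blast

lemma chart_homeo: "c \<in> F \<Longrightarrow> homeomorphism (fst c) (snd c ` fst c) (snd c) (chinv c)"
  using chart[of c] by (auto simp: is_chart_def chinv_def split: prod.splits)

lemma chart_open_image: "c \<in> F \<Longrightarrow> open (snd c ` fst c)"
  using chart[of c] by (auto simp: is_chart_def split: prod.splits)

lemma chart_cont: "c \<in> F \<Longrightarrow> continuous_on (fst c) (snd c)"
  using chart_homeo homeomorphism_cont1 by blast

lemma chinv_cont: "c \<in> F \<Longrightarrow> continuous_on (snd c ` fst c) (chinv c)"
  using chart_homeo homeomorphism_cont2 by blast

lemma chinv_chart [simp]: "c \<in> F \<Longrightarrow> x \<in> fst c \<Longrightarrow> chinv c (snd c x) = x"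
  using chart_homeo homeomorphism_apply1 by blast

lemma chart_chinv [simp]: "c \<in> F \<Longrightarrow> y \<in> snd c ` fst c \<Longrightarrow> snd c (chinv c y) = y"
  by auto

lemma chinv_in [simp]: "c \<in> F \<Longrightarrow> y \<in> snd c ` fst c \<Longrightarrow> chinv c y \<in> fst c"
  by auto

lemma lev_cont: "c \<in> F \<Longrightarrow> continuous_on (fst c) (lev k c)"
  by (intro continuous_on_component chart_cont)

lemma chart_image_open:
  assumes c: "c \<in> F" and T: "openin (top_of_set N) T"
  shows "open (snd c ` (fst c \<inter> T))"
proof -
  have "openin (top_of_set (fst c)) (fst c \<inter> T)"
    using T chart_sub[OF c] by (metis openin_subtopology_Int2 inf.absorb_iff2 openin_Int openin_subset_trans chart_openin[OF c] inf_le1)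
  then have "openin (top_of_set (snd c ` fst c)) (snd c ` (fst c \<inter> T))"
    using homeomorphism_imp_open_map[OF chart_homeo[OF c]] by blast
  then show ?thesis using chart_open_image[OF c] openin_open_trans by blast
qed

lemma openin_chart_vimage:
  assumes c: "c \<in> F" and T: "open T"
  shows "openin (top_of_set N) {x \<in> fst c. snd c x \<in> T}"
proof -
  have "openin (top_of_set (fst c)) (fst c \<inter> snd c -` T)"
    using chart_cont[OF c] T by (rule continuous_openin_preimage_gen)
  then have "openin (top_of_set N) (fst c \<inter> snd c -` T)"
    using chart_openin[OF c] openin_trans by blast
  then show ?thesis by (simp add: vimage_def Int_def)
qed

lemma openin_lev_vimage:
  assumes c: "c \<in> F" and T: "open T"
  shows "openin (top_of_set N) {x \<in> fst c. lev k c x \<in> T}"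
proof -
  have "open ((\<lambda>x :: real ^ 'n. x $ k) -` T)"
    using T by (intro continuous_open_vimage) (auto intro!: continuous_intros)
  from openin_chart_vimage[OF c this] show ?thesis by simp
qed

lemma box_in_openin: "c \<in> F \<Longrightarrow> openin (top_of_set N) (box_in k c a r s)"
  unfolding box_in_def by (rule openin_chart_vimage[OF _ open_Box])

lemma boxes_openin: "V \<in> boxes k F \<Longrightarrow> openin (top_of_set N) V"
  unfolding boxes_def using box_in_openin by auto

lemma box_in_boxes: "c \<in> F \<Longrightarrow> Box k a r s \<subseteq> snd c ` fst c \<Longrightarrow> box_in k c a r s \<in> boxes k F"
  unfolding boxes_def by blast

lemma small_box:
  assumes c: "c \<in> F" "x \<in> fst c" and T: "openin (top_of_set N) T" "x \<in> T"
  obtains e where "e > 0"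
    "\<And>r s. r \<le> e \<Longrightarrow> s \<le> e \<Longrightarrow> Box k (snd c x) r s \<subseteq> snd c ` fst c"
    "\<And>r s. r \<le> e \<Longrightarrow> s \<le> e \<Longrightarrow> box_in k c (snd c x) r s \<subseteq> T"
proof -
  have "open (snd c ` (fst c \<inter> T))" "snd c x \<in> snd c ` (fst c \<inter> T)"
    using chart_image_open[OF c(1) T(1)] c(2) T(2) by auto
  then obtain e where e: "e > 0" "ball (snd c x) e \<subseteq> snd c ` (fst c \<inter> T)"
    using open_contains_ball by blast
  have sub: "Box k (snd c x) r s \<subseteq> snd c ` (fst c \<inter> T)" if "r \<le> e / 2" "s \<le> e / 2" for r s
  proof -
    have "Box k (snd c x) r s \<subseteq> Box k (snd c x) (e/2) (e/2)" using that by (auto simp: Box_def)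
    also have "\<dots> \<subseteq> ball (snd c x) e" using Box_in_ball[of k "snd c x" "e/2"] by simp
    finally show ?thesis using e(2) by blast
  qed
  show ?thesis
  proof (rule that[of "e / 2"])
    show "box_in k c (snd c x) r s \<subseteq> T" if rs: "r \<le> e / 2" "s \<le> e / 2" for r s
    proof
      fix y assume y: "y \<in> box_in k c (snd c x) r s"
      have yc: "y \<in> fst c" and "snd c y \<in> Box k (snd c x) r s"
        using y unfolding box_in_def by blast+
      then have "snd c y \<in> snd c ` (fst c \<inter> T)"
        using sub[OF rs] by blast
      then obtain z where z: "z \<in> fst c \<inter> T" "snd c y = snd c z" by blast
      have "chinv c (snd c y) = chinv c (snd c z)" by (simp only: z(2))
      then have "y = z" unfolding chinv_chart[OF c(1) yc] chinv_chart[OF c(1) IntD1[OF z(1)]] .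
      then show "y \<in> T" using z by blast
    qed
    show "Box k (snd c x) r s \<subseteq> snd c ` fst c" if rs: "r \<le> e / 2" "s \<le> e / 2" for r s
      using sub[OF rs] by blast
  qed (use e in simp)
qed

lemma self_in_box [simp]: "x \<in> fst c \<Longrightarrow> r > 0 \<Longrightarrow> s > 0 \<Longrightarrow> x \<in> box_in k c (snd c x) r s"
  by (simp add: box_in_def Box_def)

lemma boxes_base:
  assumes "x \<in> T" "openin (top_of_set N) T"
  shows "\<exists>V\<in>boxes k F. x \<in> V \<and> V \<subseteq> T"
proof -
  have "x \<in> N" using assms openin_imp_subset by blast
  then obtain c where c: "c \<in> F" "x \<in> fst c" using chart_cover by blast
  obtain e where "e > 0" "\<And>r s. r \<le> e \<Longrightarrow> s \<le> e \<Longrightarrow> Box k (snd c x) r s \<subseteq> snd c ` fst c"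
    "\<And>r s. r \<le> e \<Longrightarrow> s \<le> e \<Longrightarrow> box_in k c (snd c x) r s \<subseteq> T"
    using small_box[OF c assms(2,1)] by blast
  then show ?thesis
    using c by (intro bexI[of _ "box_in k c (snd c x) e e"] box_in_boxes) auto
qed

lemma chart_is_box:
  assumes "c \<in> F"
  obtains a r s where "snd c ` fst c = Box k a r s" "fst c = box_in k c a r s"
proof -
  have "\<forall>(U, \<phi>)\<in>F. \<exists>a r s. r > 0 \<and> s > 0 \<and> \<phi> ` U = Box k a r s"
    using C2_fol unfolding C2_foliation_def Box_def by (elim conjE)
  from bspec[OF this assms] obtain a r s where "snd c ` fst c = Box k a r s"
    unfolding case_prod_beta by blast
  moreover have "fst c = box_in k c a r s"
    unfolding box_in_def calculation[symmetric] by blast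
  ultimately show ?thesis using that by blast
qed

lemma chart_in_boxes: "c \<in> F \<Longrightarrow> fst c \<in> boxes k F"
  by (metis chart_is_box box_in_boxes order_refl)

lemma convex_chart_image: "c \<in> F \<Longrightarrow> convex (snd c ` fst c)"
  by (metis chart_is_box convex_Box)

text \<open>The segment from \<open>x\<close> to \<open>y\<close> in the coordinates of the chart \<open>c\<close>.\<close>

definition cseg :: "('a, 'n) chart \<Rightarrow> 'a \<Rightarrow> 'a \<Rightarrow> real \<Rightarrow> 'a" where
  "cseg c x y s = chinv c ((1 - s) *\<^sub>R snd c x + s *\<^sub>R snd c y)"

lemma cseg_image:
  assumes "c \<in> F" "x \<in> fst c" "y \<in> fst c" "s \<in> {0..1}"
  shows "(1 - s) *\<^sub>R snd c x + s *\<^sub>R snd c y \<in> snd c ` fst c"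
  using convex_chart_image[OF assms(1)] assms by (auto simp: convex_alt)

lemma snd_cseg:
  assumes "c \<in> F" "x \<in> fst c" "y \<in> fst c" "s \<in> {0..1}"
  shows "snd c (cseg c x y s) = (1 - s) *\<^sub>R snd c x + s *\<^sub>R snd c y"
  unfolding cseg_def using cseg_image[OF assms] assms(1) by (rule_tac chart_chinv)

lemma cseg_in_chart:
  assumes "c \<in> F" "x \<in> fst c" "y \<in> fst c" "s \<in> {0..1}"
  shows "cseg c x y s \<in> fst c"
  unfolding cseg_def using cseg_image[OF assms] assms(1) by (rule_tac chinv_in)

lemma lev_cseg:
  assumes "c \<in> F" "x \<in> fst c" "y \<in> fst c" "s \<in> {0..1}"
  shows "lev k c (cseg c x y s) = (1 - s) * lev k c x + s * lev k c y"
  by (simp add: snd_cseg[OF assms])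

lemma cseg_cont:
  assumes "c \<in> F" "x \<in> fst c" "y \<in> fst c"
  shows "continuous_on {0..1} (cseg c x y)"
  unfolding cseg_def
  by (rule continuous_on_compose2[OF chinv_cont[OF assms(1)]])
    (use cseg_image[OF assms] in \<open>auto intro!: continuous_intros\<close>)

lemma cseg_ends [simp]:
  "c \<in> F \<Longrightarrow> x \<in> fst c \<Longrightarrow> cseg c x y 0 = x" "c \<in> F \<Longrightarrow> y \<in> fst c \<Longrightarrow> cseg c x y 1 = y"
  by (auto simp: cseg_def)

lemma cseg_in_box:
  assumes "c \<in> F" "x \<in> box_in k c a r t" "y \<in> box_in k c a r t" "s \<in> {0..1}"
  shows "cseg c x y s \<in> box_in k c a r t"
proof -
  have 1: "x \<in> fst c" "y \<in> fst c" using assms by (auto simp: box_in_def)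
  have "(1 - s) *\<^sub>R snd c x + s *\<^sub>R snd c y \<in> Box k a r t"
    using convex_Box[of k a r t] assms by (auto simp: convex_alt box_in_def)
  then show ?thesis
    using cseg_in_chart[OF assms(1) 1 assms(4)] snd_cseg[OF assms(1) 1 assms(4)] by (simp add: box_in_def)
qed

lemma cseg_connected:
  assumes "c \<in> F" and "\<And>x y s. x \<in> S \<Longrightarrow> y \<in> S \<Longrightarrow> s \<in> {0..1} \<Longrightarrow> cseg c x y s \<in> S" and "S \<subseteq> fst c"
  shows "connected S"
  unfolding connected_iff_connected_component
proof (intro ballI)
  fix x y assume xy: "x \<in> S" "y \<in> S"
  have "connected (cseg c x y ` {0..1})"
    using assms xy by (intro connected_continuous_image cseg_cont) auto
  moreover have "cseg c x y ` {0..1} \<subseteq> S" using assms xy by blast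
  moreover have "x \<in> cseg c x y ` {0..1}"
    by (rule image_eqI[of _ _ 0]) (use assms xy cseg_ends(1)[of c x y] in auto)
  moreover have "y \<in> cseg c x y ` {0..1}"
    by (rule image_eqI[of _ _ 1]) (use assms(1,3) xy cseg_ends(2)[of c y x] in auto)
  ultimately show "connected_component S x y" unfolding connected_component_def by blast
qed

lemma connected_box: "V \<in> boxes k F \<Longrightarrow> connected V"
  unfolding boxes_def using cseg_in_box by (auto intro!: cseg_connected simp: box_in_def[of k _ _ _ _]) 

section \<open>Leaves\<close>

lemma plaque_rel_iff: "(x, y) \<in> plaque_rel k F \<longleftrightarrow> (\<exists>c\<in>F. x \<in> fst c \<and> y \<in> fst c \<and> lev k c x = lev k c y)"
  by (auto simp: plaque_rel_def plaque_def split: prod.splits) (metis fst_conv snd_conv)+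

lemma leaf_equiv: "equiv UNIV ((plaque_rel k F)\<^sup>*)"
proof (rule equivI)
  have "sym (plaque_rel k F)" by (auto simp: sym_def plaque_rel_iff)
  then show "sym ((plaque_rel k F)\<^sup>*)" by (rule sym_rtrancl)
qed (auto simp: refl_on_def intro: trans_rtrancl)

lemma leaf_self [simp]: "x \<in> leaf k F x"
  by (simp add: leaf_def)

lemma leaf_eq: "y \<in> leaf k F x \<Longrightarrow> leaf k F y = leaf k F x"
  unfolding leaf_def using equiv_class_eq[OF leaf_equiv] by auto

lemma leaf_same_level:
  "c \<in> F \<Longrightarrow> x \<in> fst c \<Longrightarrow> y \<in> fst c \<Longrightarrow> lev k c x = lev k c y \<Longrightarrow> leaf k F x = leaf k F y"
proof -
  assume "c \<in> F" "x \<in> fst c" "y \<in> fst c" "lev k c x = lev k c y"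
  then have "y \<in> leaf k F x" unfolding leaf_def using plaque_rel_iff by auto
  then show ?thesis using leaf_eq by simp
qed

lemma leaf_in_leaves: "x \<in> N \<Longrightarrow> leaf k F x \<in> leaves k N F"
  by (auto simp: leaves_def leaf_def quotient_def)

lemma leaf_closed: "x \<in> N \<Longrightarrow> closedin (top_of_set N) (leaf k F x)"
  using fol leaf_in_leaves by (auto simp: foliation_by_closed_planes_def)

lemma leaf_sub: "x \<in> N \<Longrightarrow> leaf k F x \<subseteq> N"
  using leaf_closed closedin_subset by fastforce

lemma leaf_diffeo_ex: "x \<in> N \<Longrightarrow> \<exists>h. leaf_diffeo k F (leaf k F x) h"
  using fol leaf_in_leaves by (auto simp: foliation_by_closed_planes_def foliation_by_planes_def)

lemma same_leaf_iff: "x \<in> leaf k F z \<Longrightarrow> y \<in> leaf k F z \<longleftrightarrow> leaf k F y = leaf k F x"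
  using leaf_eq leaf_self by metis

lemma leaf_level: 
  "c \<in> F \<Longrightarrow> x \<in> fst c \<Longrightarrow> y \<in> fst c \<Longrightarrow> lev k c x = lev k c y \<Longrightarrow> x \<in> leaf k F z \<Longrightarrow> y \<in> leaf k F z"
  using leaf_same_level same_leaf_iff by metis

end

section \<open>Closed leaves are proper\<close>

text \<open>Otherwise the complements of the points of \<open>S\<close> would be countably many dense open subsets of \<open>S\<close> with
  empty intersection, against the Baire theorem.\<close>

lemma countable_closed_has_isolated:
  fixes S :: "real set"
  assumes "closed S" "countable S" "S \<noteq> {}"
  obtains t e where "t \<in> S" "e > 0" "\<And>t'. t' \<in> S \<Longrightarrow> \<bar>t' - t\<bar> < e \<Longrightarrow> t' = t"
proof -
  have "\<exists>t\<in>S. \<not> S \<subseteq> closure (S - {t})"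
  proof (rule ccontr)
    assume *: "\<not> (\<exists>t\<in>S. \<not> S \<subseteq> closure (S - {t}))"
    have "S \<subseteq> closure (\<Inter>t\<in>S. S - {t})"
    proof (rule Baire[OF assms(1)])
      show "countable ((\<lambda>t. S - {t}) ` S)" using assms(2) by (rule countable_image)
      fix T assume "T \<in> (\<lambda>t. S - {t}) ` S"
      then obtain t where t: "t \<in> S" "T = S - {t}" by blast
      have "openin (top_of_set S) (S \<inter> (- {t}))" by (intro openin_open_Int) auto
      then show "openin (top_of_set S) T \<and> S \<subseteq> closure T"
        using t * by (auto simp: Diff_eq)
    qed
    moreover have "(\<Inter>t\<in>S. S - {t}) = {}" using assms(3) by auto
    ultimately show False using assms(3) by simp
  qed
  then obtain t z where z: "t \<in> S" "z \<in> S" "z \<notin> closure (S - {t})" by blast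
  moreover have "z \<notin> S - {t}" using z(3) closure_subset[of "S - {t}"] by blast
  ultimately have t: "t \<in> S" "t \<notin> closure (S - {t})" by auto
  from t(2) obtain e where "e > 0" "\<And>t'. t' \<in> S - {t} \<Longrightarrow> \<not> dist t' t < e"
    unfolding closure_approachable by blast
  then show ?thesis using that[OF t(1)] by (auto simp: dist_real_def)
qed

lemma hyp_C2_on_imp_continuous:
  assumes "hyp_C2_on k f S" "S \<subseteq> hyp k"
  shows "continuous_on S f"
proof -
  have "continuous_on {x. hproj k x \<in> S} (f \<circ> hproj k)"
    using assms(1) unfolding hyp_C2_on_def C2_on_def
    by (metis continuous_at_imp_continuous_on has_derivative_continuous)
  then have "continuous_on S (f \<circ> hproj k)"
    by (rule continuous_on_subset) (use assms(2) hproj_hyp in force)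
  then show ?thesis
    by (rule continuous_on_cong[THEN iffD1, rotated -1]) (use assms(2) hproj_hyp in force)+
qed

context closed_planes
begin

lemma plaque_eq: "plaque k c t = {x \<in> fst c. lev k c x = t}"
  by (auto simp: plaque_def split: prod.splits)

lemma plaque_in_leaf: "c \<in> F \<Longrightarrow> x \<in> fst c \<Longrightarrow> x \<in> leaf k F q \<Longrightarrow> plaque k c (lev k c x) \<subseteq> leaf k F q"
  unfolding plaque_eq using leaf_level by (metis (mono_tags, lifting) mem_Collect_eq subsetI)

lemma leaf_diffeoD:
  assumes h: "leaf_diffeo k F L h" and c: "c \<in> F" and P: "plaque k c t \<subseteq> L"
  shows "openin (top_of_set (hyp k)) (h ` plaque k c t)"
    "hyp_C2_on k (h \<circ> inv_into (plaque k c t) (hproj k \<circ> snd c)) ((hproj k \<circ> snd c) ` plaque k c t)"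
    "hyp_C2_on k ((hproj k \<circ> snd c) \<circ> inv_into (plaque k c t) h) (h ` plaque k c t)"
proof -
  have "\<forall>(U, \<phi>)\<in>F. \<forall>t. let P = plaque k (U, \<phi>) t; \<xi> = hproj k \<circ> \<phi> in
        P \<subseteq> L \<longrightarrow>
          openin (top_of_set (hyp k)) (h ` P) \<and>
          hyp_C2_on k (h \<circ> inv_into P \<xi>) (\<xi> ` P) \<and>
          hyp_C2_on k (\<xi> \<circ> inv_into P h) (h ` P)"
    using h unfolding leaf_diffeo_def by blast
  from bspec[OF this c] P
  show "openin (top_of_set (hyp k)) (h ` plaque k c t)"
    "hyp_C2_on k (h \<circ> inv_into (plaque k c t) (hproj k \<circ> snd c)) ((hproj k \<circ> snd c) ` plaque k c t)"
    "hyp_C2_on k ((hproj k \<circ> snd c) \<circ> inv_into (plaque k c t) h) (h ` plaque k c t)"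
    unfolding Let_def case_prod_beta prod.collapse by blast+
qed

definition levels :: "('a, 'n) chart \<Rightarrow> 'a set \<Rightarrow> real set" where
  "levels c L = lev k c ` (fst c \<inter> L)"

text \<open>The plaques of one chart in a leaf correspond to disjoint nonempty open subsets of the hyperplane.\<close>

lemma countable_levels:
  assumes c: "c \<in> F" and q: "q \<in> N"
  shows "countable (levels c (leaf k F q))"
proof -
  obtain h where h: "leaf_diffeo k F (leaf k F q) h" using leaf_diffeo_ex q by blast
  have inj: "inj_on h (leaf k F q)" using h by (simp add: leaf_diffeo_def bij_betw_def)
  define U where "U t = {x. hproj k x \<in> h ` plaque k c t}" for t
  have P: "plaque k c t \<subseteq> leaf k F q" if "t \<in> levels c (leaf k F q)" for t
    using that plaque_in_leaf[OF c] unfolding levels_def by blast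
  have hP: "h ` plaque k c t \<subseteq> hyp k" if "t \<in> levels c (leaf k F q)" for t
    using leaf_diffeoD(1)[OF h c P[OF that]] openin_imp_subset by blast
  have "open (U t)" if "t \<in> levels c (leaf k F q)" for t
  proof -
    obtain T where T: "open T" "h ` plaque k c t = hyp k \<inter> T"
      using leaf_diffeoD(1)[OF h c P[OF \<open>t \<in> levels c (leaf k F q)\<close>]] unfolding openin_open by blast
    have "U t = hproj k -` T" unfolding U_def T(2) by auto
    then show ?thesis using T(1) by (auto intro!: open_vimage continuous_intros)
  qed
  moreover have "disjnt (U t) (U t')" if "t \<in> levels c (leaf k F q)" "t' \<in> levels c (leaf k F q)" "t \<noteq> t'" for t t'
  proof -
    have "plaque k c t \<inter> plaque k c t' = {}" using that(3) by (auto simp: plaque_eq)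
    then have "h ` plaque k c t \<inter> h ` plaque k c t' = {}"
      using inj_on_image_Int[OF inj P[OF that(1)] P[OF that(2)]] by auto
    then show ?thesis unfolding U_def disjnt_def by blast
  qed
  moreover have ne: "U t \<noteq> {}" if "t \<in> levels c (leaf k F q)" for t
  proof -
    obtain x where x: "x \<in> plaque k c t"
      using \<open>t \<in> levels c (leaf k F q)\<close> unfolding levels_def plaque_eq by blast
    then have "h x \<in> hyp k" using hP[OF that] by blast
    then have "h x \<in> U t" using x hproj_hyp by (auto simp: U_def)
    then show ?thesis by blast
  qed
  ultimately have "countable (U ` levels c (leaf k F q))"
    by (intro countable_disjoint_open_subsets) (auto simp: pairwise_def)
  moreover have "inj_on U (levels c (leaf k F q))"
  proof (rule inj_onI, rule ccontr)
    fix t t' assume t: "t \<in> levels c (leaf k F q)" "t' \<in> levels c (leaf k F q)" "U t = U t'" "t \<noteq> t'"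
    then have "disjnt (U t) (U t')"
      using \<open>\<And>t t'. \<lbrakk>t \<in> levels c (leaf k F q); t' \<in> levels c (leaf k F q); t \<noteq> t'\<rbrakk> \<Longrightarrow> disjnt (U t) (U t')\<close> by blast
    then show False using t(3) ne[OF t(1)] by (simp add: disjnt_def)
  qed
  ultimately show ?thesis using countable_image_inj_on by blast
qed

text \<open>The transversal through \<open>x\<close> in the chart \<open>c\<close>, parametrized by the level.\<close>

definition vert :: "('a, 'n) chart \<Rightarrow> 'a \<Rightarrow> real \<Rightarrow> 'a" where
  "vert c x t = chinv c (snd c x + (t - lev k c x) *\<^sub>R axis k 1)"

lemma vertical:
  assumes c: "c \<in> F" "x \<in> fst c" and T: "openin (top_of_set N) T" "x \<in> T"
  obtains e where "e > 0"
    "\<And>t. \<bar>t - lev k c x\<bar> < e \<Longrightarrow> vert c x t \<in> fst c \<inter> T"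
    "\<And>t. \<bar>t - lev k c x\<bar> < e \<Longrightarrow> lev k c (vert c x t) = t"
    "continuous_on {lev k c x - e <..< lev k c x + e} (vert c x)"
proof -
  obtain e where e: "e > 0" "\<And>r s. r \<le> e \<Longrightarrow> s \<le> e \<Longrightarrow> Box k (snd c x) r s \<subseteq> snd c ` fst c"
    "\<And>r s. r \<le> e \<Longrightarrow> s \<le> e \<Longrightarrow> box_in k c (snd c x) r s \<subseteq> T"
    using small_box[OF c T] by blast
  define p where "p t = snd c x + (t - lev k c x) *\<^sub>R (axis k 1 :: real ^ 'n)" for t
  have pk: "p t $ k = t" for t by (simp add: p_def)
  have ph: "hproj k (p t) = hproj k (snd c x)" for t by (simp add: p_def hproj_eq algebra_simps)
  have pB: "p t \<in> Box k (snd c x) e e" if "\<bar>t - lev k c x\<bar> < e" for t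
    using that e(1) by (simp add: Box_def pk ph dist_real_def)
  have pI: "p t \<in> snd c ` fst c" if "\<bar>t - lev k c x\<bar> < e" for t
    using pB[OF that] e(2)[of e e] by blast
  have v: "vert c x t = chinv c (p t)" for t by (simp add: vert_def p_def)
  have vc: "vert c x t \<in> fst c" "snd c (vert c x t) = p t" if "\<bar>t - lev k c x\<bar> < e" for t
    unfolding v using chinv_in[OF c(1) pI[OF that]] chart_chinv[OF c(1) pI[OF that]] by auto
  have "vert c x t \<in> box_in k c (snd c x) e e" if "\<bar>t - lev k c x\<bar> < e" for t
    unfolding box_in_def using vc[OF that] pB[OF that] by simp
  then have 1: "vert c x t \<in> fst c \<inter> T" if "\<bar>t - lev k c x\<bar> < e" for t
    using vc(1)[OF that] e(3)[of e e] that by blast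
  have 2: "lev k c (vert c x t) = t" if "\<bar>t - lev k c x\<bar> < e" for t
    using vc(2)[OF that] pk by simp
  have "continuous_on {lev k c x - e <..< lev k c x + e} (\<lambda>t. chinv c (p t))"
  proof (rule continuous_on_compose2[OF chinv_cont[OF c(1)]])
    show "p ` {lev k c x - e <..< lev k c x + e} \<subseteq> snd c ` fst c"
      using pI by (auto simp: abs_less_iff)
  qed (auto simp: p_def[abs_def] intro!: continuous_intros)
  then have 3: "continuous_on {lev k c x - e <..< lev k c x + e} (vert c x)"
    by (simp add: v[abs_def])
  show ?thesis using that[OF e(1) 1 2 3] by blast
qed

definition isolated_level :: "('a, 'n) chart \<Rightarrow> 'a set \<Rightarrow> real \<Rightarrow> bool" where
  "isolated_level c L t \<longleftrightarrow> (\<exists>e>0. \<forall>y\<in>fst c \<inter> L. \<bar>lev k c y - t\<bar> < e \<longrightarrow> lev k c y = t)"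

text \<open>On a compact piece of a transversal, the levels of a closed leaf form a countable closed set, so one
  of them is isolated.\<close>

lemma isolated_level_exists:
  assumes c: "c \<in> F" and q: "q \<in> N" and x: "x \<in> fst c" "x \<in> leaf k F q"
  shows "\<exists>y\<in>fst c \<inter> leaf k F q. isolated_level c (leaf k F q) (lev k c y)"
proof -
  define L where "L = leaf k F q"
  define t0 where "t0 = lev k c x"
  have xN: "x \<in> N" using x(1) chart_sub[OF c] by blast
  obtain e where e: "e > 0" "\<And>t. \<bar>t - t0\<bar> < e \<Longrightarrow> vert c x t \<in> fst c"
    "\<And>t. \<bar>t - t0\<bar> < e \<Longrightarrow> lev k c (vert c x t) = t"
    "continuous_on {t0 - e <..< t0 + e} (vert c x)"
    using vertical[OF c x(1) openin_subtopology_self xN] unfolding t0_def by (metis IntD1)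
  have inL: "t \<in> levels c L \<longleftrightarrow> vert c x t \<in> L" if "\<bar>t - t0\<bar> < e" for t
  proof
    assume "t \<in> levels c L"
    then obtain y where "y \<in> fst c" "y \<in> L" "lev k c y = t" by (auto simp: levels_def)
    then show "vert c x t \<in> L"
      using leaf_level[OF c, of y "vert c x t"] e(2,3)[OF that] by (simp add: L_def)
  next
    assume "vert c x t \<in> L"
    then show "t \<in> levels c L"
      using e(2,3)[OF that] by (force simp: levels_def)
  qed
  have count: "countable (levels c L)" unfolding L_def by (rule countable_levels[OF c q])
  (* Ends that are not levels of the leaf ensure that the isolated point is interior to the piece. *)
  obtain u where u: "t0 - e < u" "u < t0" "u \<notin> levels c L"
    using real_interval_avoid_countable_set[of "t0 - e" t0 "levels c L"] e(1) count by auto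
  obtain v where v: "t0 < v" "v < t0 + e" "v \<notin> levels c L"
    using real_interval_avoid_countable_set[of t0 "t0 + e" "levels c L"] e(1) count by auto
  define S where "S = {u..v} \<inter> levels c L"
  have S_eq: "S = {u..v} \<inter> vert c x -` L"
    unfolding S_def using inL u v by (auto simp: abs_less_iff)
  have cont: "continuous_on {u..v} (vert c x)"
    by (rule continuous_on_subset[OF e(4)]) (use u v in auto)
  have "vert c x ` {u..v} \<subseteq> N"
    using e(2) chart_sub[OF c] u v by (force simp: abs_less_iff)
  then have "closedin (top_of_set {u..v}) S"
    unfolding S_eq using cont leaf_closed[OF q] unfolding L_def
    by (intro continuous_closedin_preimage_gen) auto
  then have "closed S" using closedin_closed_trans by blast
  moreover have "countable S" unfolding S_def using count by auto
  moreover have "t0 \<in> S" unfolding S_def using u v x by (auto simp: t0_def levels_def L_def)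
  ultimately obtain t d where t: "t \<in> S" "d > 0" "\<And>t'. t' \<in> S \<Longrightarrow> \<bar>t' - t\<bar> < d \<Longrightarrow> t' = t"
    using countable_closed_has_isolated[of S] by blast
  have "t \<noteq> u" "t \<noteq> v" "u \<le> t" "t \<le> v" using t(1) u(3) v(3) unfolding S_def by auto
  then have tuv: "u < t" "t < v" by auto
  define d' where "d' = min d (min (t - u) (v - t))"
  obtain y where y: "y \<in> fst c" "y \<in> L" "lev k c y = t" using t(1) by (auto simp: S_def levels_def)
  have "lev k c z = t" if "z \<in> fst c \<inter> L" "\<bar>lev k c z - t\<bar> < d'" for z
  proof (rule t(3))
    show "lev k c z \<in> S" using that unfolding S_def levels_def d'_def by (auto simp: abs_less_iff)
  qed (use that d'_def in auto)
  moreover have "d' > 0" using t(2) tuv by (simp add: d'_def)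
  ultimately have "isolated_level c L t" unfolding isolated_level_def by blast
  then show ?thesis using y unfolding L_def by blast
qed

lemma same_level_locally:
  assumes "c \<in> F" "d \<in> F" "x \<in> fst c" "x \<in> fst d"
  obtains W where "openin (top_of_set N) W" "x \<in> W" "W \<subseteq> fst c \<inter> fst d"
    "\<And>y z. y \<in> W \<Longrightarrow> z \<in> W \<Longrightarrow> lev k c y = lev k c z \<Longrightarrow> lev k d y = lev k d z"
proof -
  have dom: "transition_dom c d = snd c ` (fst c \<inter> fst d)"
    by (simp add: transition_dom_def case_prod_beta)
  have tr: "transition c d y = snd d (chinv c y)" for y
    by (simp add: transition_def chinv_def case_prod_beta)
  have all: "\<forall>c\<in>F. \<forall>d\<in>F. \<forall>x\<in>transition_dom c d. \<exists>W. open W \<and> x \<in> W \<and> W \<subseteq> transition_dom c d \<and>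
        (\<forall>y\<in>W. \<forall>z\<in>W. y $ k = z $ k \<longrightarrow> transition c d y $ k = transition c d z $ k)"
    using C2_fol unfolding C2_foliation_def by blast
  have x_dom: "snd c x \<in> transition_dom c d" unfolding dom using assms by blast
  obtain W where W: "open W" "snd c x \<in> W" "W \<subseteq> snd c ` (fst c \<inter> fst d)"
    "\<forall>y\<in>W. \<forall>z\<in>W. y $ k = z $ k \<longrightarrow> snd d (chinv c y) $ k = snd d (chinv c z) $ k"
    using bspec[OF bspec[OF bspec[OF all assms(1)] assms(2)] x_dom] unfolding dom tr by blast
  show ?thesis
  proof (rule that[of "{y \<in> fst c. snd c y \<in> W}"])
    show "openin (top_of_set N) {y \<in> fst c. snd c y \<in> W}"
      by (rule openin_chart_vimage[OF assms(1) W(1)])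
    show "{y \<in> fst c. snd c y \<in> W} \<subseteq> fst c \<inter> fst d"
    proof
      fix y assume y: "y \<in> {y \<in> fst c. snd c y \<in> W}"
      then obtain z where z: "z \<in> fst c \<inter> fst d" "snd c y = snd c z" using W(3) by blast
      have "chinv c (snd c y) = chinv c (snd c z)" by (simp only: z(2))
      then have "y = z" using chinv_chart[OF assms(1), of y] chinv_chart[OF assms(1), of z] y z(1) by simp
      then show "y \<in> fst c \<inter> fst d" using z by blast
    qed
    show "lev k d y = lev k d z" if yz: "y \<in> {y \<in> fst c. snd c y \<in> W}" "z \<in> {y \<in> fst c. snd c y \<in> W}"
      "lev k c y = lev k c z" for y z
    proof -
      have "snd d (chinv c (snd c y)) $ k = snd d (chinv c (snd c z)) $ k"
        using W(4) yz by blast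
      then show ?thesis using chinv_chart[OF assms(1)] yz by simp
    qed
  qed (use assms W in auto)
qed

text \<open>Where two charts overlap, the levels of one are locally functions of the levels of the other.\<close>

lemma isolated_level_transfer:
  assumes "c \<in> F" "d \<in> F" "x \<in> fst c" "x \<in> fst d" "x \<in> leaf k F q"
    and iso: "isolated_level c (leaf k F q) (lev k c x)"
  shows "isolated_level d (leaf k F q) (lev k d x)"
proof -
  obtain e where e: "e > 0" "\<And>y. y \<in> fst c \<inter> leaf k F q \<Longrightarrow> \<bar>lev k c y - lev k c x\<bar> < e \<Longrightarrow> lev k c y = lev k c x"
    using iso unfolding isolated_level_def by blast
  obtain W where W: "openin (top_of_set N) W" "x \<in> W" "W \<subseteq> fst c \<inter> fst d"
    "\<And>y z. y \<in> W \<Longrightarrow> z \<in> W \<Longrightarrow> lev k c y = lev k c z \<Longrightarrow> lev k d y = lev k d z"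
    using same_level_locally[OF assms(1-4)] by metis
  define T where "T = W \<inter> {y \<in> fst c. lev k c y \<in> {lev k c x - e <..< lev k c x + e}}"
  have T: "openin (top_of_set N) T" unfolding T_def
    by (intro openin_Int W openin_lev_vimage assms) auto
  have xT: "x \<in> T" using W assms e(1) by (auto simp: T_def)
  obtain e' where e': "e' > 0" "\<And>t. \<bar>t - lev k d x\<bar> < e' \<Longrightarrow> vert d x t \<in> fst d \<inter> T"
    "\<And>t. \<bar>t - lev k d x\<bar> < e' \<Longrightarrow> lev k d (vert d x t) = t"
    using vertical[OF assms(2,4) T xT] by metis
  have "lev k d y = lev k d x" if y: "y \<in> fst d \<inter> leaf k F q" "\<bar>lev k d y - lev k d x\<bar> < e'" for y
  proof -
    define z where "z = vert d x (lev k d y)"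
    have z: "z \<in> fst d" "z \<in> T" "lev k d z = lev k d y"
      using e'(2,3)[OF y(2)] by (auto simp: z_def)
    have "z \<in> leaf k F q" using leaf_level[OF assms(2), of y z] z y by simp
    then have "lev k c z = lev k c x"
      using z(2) W(3) by (intro e(2)) (auto simp: T_def abs_less_iff)
    then have "lev k d z = lev k d x" using z(2) W(2) by (intro W(4)) (auto simp: T_def)
    then show ?thesis using z by simp
  qed
  then show ?thesis unfolding isolated_level_def using e'(1) by blast
qed

text \<open>Closed leaves are proper. Isolation is a property of plaques, and it passes along chains of plaques from
  the one isolated plaque to the whole leaf.\<close>

theorem levels_isolated:
  assumes q: "q \<in> N" and c: "c \<in> F" "x \<in> fst c" "x \<in> leaf k F q"
  shows "isolated_level c (leaf k F q) (lev k c x)"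
proof -
  define good where "good y \<longleftrightarrow> (\<forall>d\<in>F. y \<in> fst d \<longrightarrow> isolated_level d (leaf k F q) (lev k d y))" for y
  obtain y where y: "y \<in> fst c" "y \<in> leaf k F q" "isolated_level c (leaf k F q) (lev k c y)"
    using isolated_level_exists[OF c(1) q c(2,3)] by blast
  have "good y" unfolding good_def using isolated_level_transfer[OF c(1) _ y(1) _ y(2,3)] by blast
  have "(y, x) \<in> (plaque_rel k F)\<^sup>*"
    using leaf_eq[OF y(2)] c(3) unfolding leaf_def by blast
  then have "x \<in> leaf k F q \<and> good x"
  proof (induction rule: rtrancl_induct)
    case base
    then show ?case using y \<open>good y\<close> by simp
  next
    case (step a b)
    then obtain d where d: "d \<in> F" "a \<in> fst d" "b \<in> fst d" "lev k d a = lev k d b"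
      unfolding plaque_rel_iff by blast
    have b: "b \<in> leaf k F q" using leaf_level[OF d] step by blast
    have "isolated_level d (leaf k F q) (lev k d a)"
      using step.IH d(1,2) unfolding good_def by blast
    then have "isolated_level d (leaf k F q) (lev k d b)" unfolding d(4) .
    then show ?case
      unfolding good_def using isolated_level_transfer[OF d(1) _ d(3) _ b] b by blast
  qed
  then show ?thesis using c by (simp add: good_def)
qed

end

section \<open>Compact pieces of leaves\<close>

context closed_planes
begin

lemma compactin_N: "compact K \<Longrightarrow> K \<subseteq> N \<Longrightarrow> compactin (top_of_set N) K"
  by (simp add: compactin_subtopology)

lemma compact_closedin: "compact K \<Longrightarrow> K \<subseteq> N \<Longrightarrow> closedin (top_of_set N) K"
  using compactin_imp_closedin[OF haus] compactin_N by blast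

lemma compact_inter:
  assumes "compact K" "K \<subseteq> N" "closedin (top_of_set N) C"
  shows "compact (C \<inter> K)"
proof -
  have "compactin (top_of_set N) (C \<inter> K)"
    using closed_Int_compactin[OF assms(3) compactin_N[OF assms(1,2)]] .
  then show ?thesis by (simp add: compactin_subtopology)
qed

text \<open>A point of two compact sets whose level in the first chart is close to \<open>\<tau>\<close> lies, by compactness, close to
  a point \<open>b\<close> of both sets whose level is \<open>\<tau>\<close>; so a small box in the overlap of the charts contains both.\<close>

lemma overlap_in_boxes:
  assumes c: "c \<in> F" and d: "d \<in> F" and K: "compact K" "K \<subseteq> fst c" and K': "compact K'" "K' \<subseteq> fst d"
  obtains e where "e > 0" "\<And>a. a \<in> K \<inter> K' \<Longrightarrow> \<bar>lev k c a - \<tau>\<bar> < e \<Longrightarrow>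
    \<exists>b\<in>K \<inter> K'. lev k c b = \<tau> \<and> (\<exists>y r s. box_in k c y r s \<in> boxes k F \<and> box_in k c y r s \<subseteq> fst c \<inter> fst d \<and>
       a \<in> box_in k c y r s \<and> b \<in> box_in k c y r s)"
proof -
  define M where "M = {b \<in> K \<inter> K'. lev k c b = \<tau>}"
  have "\<exists>V. openin (top_of_set N) V \<and> b \<in> V \<and> V \<subseteq> fst c \<inter> fst d \<and> V \<in> boxes k F \<and> (\<exists>y r s. V = box_in k c y r s)"
    if "b \<in> M" for b
  proof -
    have b: "b \<in> fst c" "b \<in> fst c \<inter> fst d" using that K K' by (auto simp: M_def)
    have "openin (top_of_set N) (fst c \<inter> fst d)" using c d by (intro openin_Int chart_openin)
    from small_box[OF c b(1) this b(2)]
    obtain e where e: "e > 0" "\<And>r s. r \<le> e \<Longrightarrow> s \<le> e \<Longrightarrow> Box k (snd c b) r s \<subseteq> snd c ` fst c"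
      "\<And>r s. r \<le> e \<Longrightarrow> s \<le> e \<Longrightarrow> box_in k c (snd c b) r s \<subseteq> fst c \<inter> fst d" by metis
    then show ?thesis
      by (intro exI[of _ "box_in k c (snd c b) e e"])
        (use b c in \<open>blast intro: box_in_openin box_in_boxes self_in_box\<close>)
  qed
  then obtain V where V: "\<And>b. b \<in> M \<Longrightarrow> openin (top_of_set N) (V b) \<and> b \<in> V b \<and> V b \<subseteq> fst c \<inter> fst d \<and>
      V b \<in> boxes k F \<and> (\<exists>y r s. V b = box_in k c y r s)" by metis
  define \<Omega> where "\<Omega> = (\<Union>b\<in>M. V b)"
  have \<Omega>: "openin (top_of_set N) \<Omega>"
    unfolding \<Omega>_def by (rule openin_Union) (use V in blast)
  define X where "X = (K' - \<Omega>) \<inter> K"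
  have sub: "K \<subseteq> N" "K' \<subseteq> N" using K K' chart_sub c d by blast+
  have X: "compact X" unfolding X_def
    by (rule compact_inter[OF K(1) sub(1) closedin_diff[OF compact_closedin[OF K'(1) sub(2)] \<Omega>]])
  have good: "\<exists>b\<in>K \<inter> K'. lev k c b = \<tau> \<and> (\<exists>y r s. box_in k c y r s \<in> boxes k F \<and> box_in k c y r s \<subseteq> fst c \<inter> fst d \<and>
       a \<in> box_in k c y r s \<and> b \<in> box_in k c y r s)" if "a \<in> \<Omega>" for a
  proof -
    obtain b where b: "b \<in> M" "a \<in> V b" using \<open>a \<in> \<Omega>\<close> unfolding \<Omega>_def by blast
    obtain y r s where eq: "V b = box_in k c y r s" using V[OF b(1)] by blast
    have bM: "b \<in> K \<inter> K'" "lev k c b = \<tau>" using b(1) unfolding M_def by blast+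
    show ?thesis
      by (rule bexI[OF _ bM(1)], intro conjI exI, rule bM(2))
        (use V[OF b(1)] b(2) in \<open>unfold eq, blast+\<close>)
  qed
  show ?thesis
  proof (cases "X = {}")
    case True
    then have "a \<in> \<Omega>" if "a \<in> K \<inter> K'" for a using that by (auto simp: X_def)
    then show ?thesis using that[of 1] good by simp
  next
    case False
    have "X \<subseteq> fst c" using K by (auto simp: X_def)
    then have "continuous_on X (\<lambda>x. \<bar>lev k c x - \<tau>\<bar>)"
      by (intro continuous_intros continuous_on_subset[OF chart_cont[OF c]])
    from continuous_attains_inf[OF X False this]
    obtain x0 where x0: "x0 \<in> X" "\<And>y. y \<in> X \<Longrightarrow> \<bar>lev k c x0 - \<tau>\<bar> \<le> \<bar>lev k c y - \<tau>\<bar>" by blast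
    have "lev k c x0 \<noteq> \<tau>"
    proof
      assume "lev k c x0 = \<tau>"
      then have "x0 \<in> M" using x0(1) by (auto simp: X_def M_def)
      then have "x0 \<in> \<Omega>" using V unfolding \<Omega>_def by blast
      then show False using x0(1) by (simp add: X_def)
    qed
    then show ?thesis
    proof (intro that[of "\<bar>lev k c x0 - \<tau>\<bar>"] good)
      fix a assume a: "a \<in> K \<inter> K'" "\<bar>lev k c a - \<tau>\<bar> < \<bar>lev k c x0 - \<tau>\<bar>"
      then show "a \<in> \<Omega>" using x0(2)[of a] by (auto simp: X_def)
    qed auto
  qed
qed

text \<open>The levels form a compact set without accumulation points.\<close>

lemma finite_levels:
  assumes c: "c \<in> F" and K: "compact K" "K \<subseteq> fst c" and q: "q \<in> N"
  shows "finite (lev k c ` (leaf k F q \<inter> K))"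
proof -
  define L where "L = leaf k F q"
  have KN: "K \<subseteq> N" using K chart_sub[OF c] by blast
  have LK: "compact (L \<inter> K)" unfolding L_def by (intro compact_inter K KN leaf_closed q)
  have "continuous_on (L \<inter> K) (lev k c)"
    by (rule continuous_on_subset[OF lev_cont[OF c]]) (use K in auto)
  then have comp: "compact (lev k c ` (L \<inter> K))" using LK by (rule compact_continuous_image)
  have "\<exists>e>0. \<forall>t\<in>lev k c ` (L \<inter> K). \<bar>t - s\<bar> < e \<longrightarrow> t = s" if s: "s \<in> lev k c ` (L \<inter> K)" for s
  proof -
    obtain x where x: "x \<in> fst c" "x \<in> L" "s = lev k c x" using s K by blast
    then have "isolated_level c L s" unfolding L_def using levels_isolated[OF q c] by blast
    then show ?thesis unfolding isolated_level_def using K by blast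
  qed
  then have "\<not> s islimpt (lev k c ` (L \<inter> K))" if "s \<in> lev k c ` (L \<inter> K)" for s
    using that unfolding islimpt_approachable dist_real_def by metis
  then show ?thesis
    using comp unfolding L_def by (metis compact_eq_Bolzano_Weierstrass order_refl)
qed

end

lemma finite_uniform_pos:
  fixes P :: "'i \<Rightarrow> real \<Rightarrow> bool"
  assumes "finite I" "\<And>i. i \<in> I \<Longrightarrow> \<exists>e>0. P i e" "\<And>i e e'. P i e \<Longrightarrow> e' \<le> e \<Longrightarrow> P i e'"
  shows "\<exists>e>0. \<forall>i\<in>I. P i e"
  using assms(1,2)
proof (induction I rule: finite_induct)
  case empty
  then show ?case by (intro exI[of _ 1]) auto
next
  case (insert i I)
  then obtain e e' where e: "e > 0" "P i e" "e' > 0" "\<forall>i\<in>I. P i e'" by blast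
  then have "min e e' > 0" "\<forall>j\<in>insert i I. P j (min e e')"
    using assms(3)[of i e "min e e'"] assms(3)[of _ e' "min e e'"] by auto
  then show ?case by blast
qed

section \<open>Local systems are trivial along leaves\<close>

locale plane_system = closed_planes k N A F + local_system G N "boxes k F" \<kappa>
  for k :: "'n::finite" and N :: "'a::topological_space set" and A F :: "('a, 'n) chart set"
    and G :: "('g, 'h) monoid_scheme" (structure) and \<kappa> :: "'a set \<Rightarrow> 'a \<Rightarrow> 'a \<Rightarrow> 'g"
begin

text \<open>On each plaque the parametrization is continuous by assumption, and plaques correspond to open subsets of
  the hyperplane.\<close>

lemma leaf_param_continuous:
  assumes q: "q \<in> N" and h: "leaf_diffeo k F (leaf k F q) h"
  shows "continuous_on (hyp k) (inv_into (leaf k F q) h)"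
  unfolding continuous_on_eq_continuous_within
proof
  define L where "L = leaf k F q"
  define g where "g = inv_into L h"
  have bij: "bij_betw h L (hyp k)" using h by (simp add: leaf_diffeo_def L_def)
  fix z assume z: "z \<in> hyp k"
  then have gz: "g z \<in> L" "h (g z) = z"
    unfolding g_def using bij by (metis bij_betw_def inv_into_into, metis bij_betw_def f_inv_into_f)
  obtain c where c: "c \<in> F" "g z \<in> fst c"
    using gz(1) chart_cover leaf_sub[OF q] unfolding L_def by blast
  define t where "t = lev k c (g z)"
  define P where "P = plaque k c t"
  have P: "P \<subseteq> L" unfolding P_def t_def L_def
    using plaque_in_leaf[OF c] gz(1) by (simp add: L_def)
  have zP: "z \<in> h ` P" using gz c by (force simp: P_def plaque_eq t_def)
  have inj: "inj_on h L" using bij by (simp add: bij_betw_def)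
  note D = leaf_diffeoD[OF h c(1) P[unfolded P_def L_def]]
  have oP: "openin (top_of_set (hyp k)) (h ` P)" using D(1) by (simp add: P_def)
  have cP: "continuous_on (h ` P) ((hproj k \<circ> snd c) \<circ> inv_into P h)"
    using hyp_C2_on_imp_continuous[OF D(3)] openin_imp_subset[OF D(1)] by (simp add: P_def)
  have inv: "inv_into P h w = g w" "g w \<in> P" if "w \<in> h ` P" for w
  proof -
    obtain p where "p \<in> P" "w = h p" using \<open>w \<in> h ` P\<close> by blast
    then show "inv_into P h w = g w" "g w \<in> P"
      unfolding g_def using inj P inj_on_subset[OF inj P] by (auto simp: inv_into_f_f subset_iff)
  qed
  define f where "f w = hproj k (snd c (g w)) + t *\<^sub>R axis k 1" for w
  have f: "f w = snd c (g w)" if "w \<in> h ` P" for w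
    using inv(2)[OF that] by (simp add: f_def P_def plaque_eq hproj_eq)
  have "continuous_on (h ` P) (\<lambda>w. hproj k (snd c (g w)))"
    using cP by (rule continuous_on_cong[THEN iffD1, rotated -1]) (auto simp: inv)
  then have "continuous_on (h ` P) f"
    unfolding f_def[abs_def] by (rule continuous_on_add[OF _ continuous_on_const])
  then have "continuous_on (h ` P) (\<lambda>w. chinv c (f w))"
    by (rule continuous_on_compose2[OF chinv_cont[OF c(1)]])
      (use f inv(2) in \<open>auto simp: P_def plaque_eq\<close>)
  then have "continuous_on (h ` P) g"
  proof (rule continuous_on_cong[THEN iffD1, rotated -1])
    fix w assume w: "w \<in> h ` P"
    have "g w \<in> fst c" using inv(2)[OF w] by (simp add: P_def plaque_eq)
    then show "chinv c (f w) = g w" using f[OF w] chinv_chart[OF c(1)] by simp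
  qed simp
  then have "continuous (at z within h ` P) g"
    using zP unfolding continuous_on_eq_continuous_within by blast
  moreover obtain T where T: "open T" "h ` P = hyp k \<inter> T" using oP by (auto simp: openin_open)
  moreover have "at z within h ` P = at z within hyp k"
    using T zP by (intro at_within_nhd[of z T]) auto
  ultimately show "continuous (at z within hyp k) (inv_into (leaf k F q) h)"
    by (simp add: g_def L_def)
qed

text \<open>The hyperplane is convex, so the local system pulled back along the parametrization of the leaf has a
  section. Two points of a plaque are joined by a segment inside the plaque, along which this section is
  compared with the local system of the chart domain.\<close>

lemma leaf_section:
  assumes q: "q \<in> N"
  obtains m where "\<And>x. x \<in> leaf k F q \<Longrightarrow> m x \<in> carrier G"
    "\<And>c x y. c \<in> F \<Longrightarrow> x \<in> fst c \<Longrightarrow> y \<in> fst c \<Longrightarrow> lev k c x = lev k c y \<Longrightarrow> x \<in> leaf k F q \<Longrightarrow>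
       \<kappa> (fst c) x y = inv m x \<otimes> m y"
proof -
  define L where "L = leaf k F q"
  obtain h where h: "leaf_diffeo k F L h" using leaf_diffeo_ex q L_def by blast
  have bij: "bij_betw h L (hyp k)" using h by (simp add: leaf_diffeo_def L_def)
  define g where "g = inv_into L h"
  have gh: "g (h x) = x" if "x \<in> L" for x
    unfolding g_def using bij that by (simp add: bij_betw_def inv_into_f_f)
  have hL: "h x \<in> hyp k" if "x \<in> L" for x using bij that by (auto simp: bij_betw_def)
  have gc: "continuous_on (hyp k) g" 
    unfolding g_def L_def by (rule leaf_param_continuous[OF q h[unfolded L_def]])
  have gL: "g ` hyp k \<subseteq> L" unfolding g_def using bij by (auto simp: bij_betw_def intro: inv_into_into)
  have gN: "g ` hyp k \<subseteq> N" using gL leaf_sub[OF q] L_def by blast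
  obtain m' where m': "sec (hyp k) g m'" using sec_convex_exists[OF convex_hyp gc gN] by blast
  show ?thesis
  proof (rule that[of "\<lambda>x. m' (h x)"])
    show "m' (h x) \<in> carrier G" if "x \<in> leaf k F q" for x
      using sec_closed[OF m'] hL that by (simp add: L_def)
    fix c x y assume c: "c \<in> F" and xy: "x \<in> fst c" "y \<in> fst c" "lev k c x = lev k c y" "x \<in> leaf k F q"
    define t where "t = lev k c x"
    define P where "P = plaque k c t"
    have P: "P \<subseteq> L" unfolding P_def t_def L_def by (rule plaque_in_leaf[OF c xy(1,4)])
    have \<gamma>P: "cseg c x y s \<in> P" if "s \<in> {0..1}" for s
      using cseg_in_chart[OF c xy(1,2) that] lev_cseg[OF c xy(1,2) that] xy(3) by (simp add: P_def plaque_eq t_def algebra_simps)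
    define \<xi> where "\<xi> = hproj k \<circ> snd c"
    have inj: "inj_on \<xi> P"
    proof (rule inj_onI)
      fix a b assume ab: "a \<in> P" "b \<in> P" "\<xi> a = \<xi> b"
      then have "snd c a = snd c b" by (simp add: P_def plaque_eq \<xi>_def hproj_eq)
      then have "chinv c (snd c a) = chinv c (snd c b)" by simp
      moreover have "a \<in> fst c" "b \<in> fst c" using ab by (auto simp: P_def plaque_eq)
      ultimately show "a = b" using chinv_chart[OF c] by metis
    qed
    have "hyp_C2_on k (h \<circ> inv_into P \<xi>) (\<xi> ` P)"
      unfolding P_def \<xi>_def by (rule leaf_diffeoD(2)[OF h c P[unfolded P_def]])
    then have "continuous_on (\<xi> ` P) (h \<circ> inv_into P \<xi>)"
      by (rule hyp_C2_on_imp_continuous) (auto simp: \<xi>_def)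
    moreover have "continuous_on {0..1} (\<lambda>s. \<xi> (cseg c x y s))"
    proof -
      have "continuous_on {0..1} (\<lambda>s. hproj k ((1 - s) *\<^sub>R snd c x + s *\<^sub>R snd c y))"
        by (intro continuous_intros)
      then show ?thesis
        by (rule continuous_on_cong[THEN iffD1, rotated -1]) (simp_all add: \<xi>_def snd_cseg[OF c xy(1,2)])
    qed
    ultimately have "continuous_on {0..1} (\<lambda>s. (h \<circ> inv_into P \<xi>) (\<xi> (cseg c x y s)))"
      by (rule continuous_on_compose2) (use \<gamma>P in auto)
    then have hc: "continuous_on {0..1} (\<lambda>s. h (cseg c x y s))"
      by (rule continuous_on_cong[THEN iffD1, rotated -1]) (simp_all add: inv_into_f_f[OF inj] \<gamma>P)
    have "sec {0..1} (\<lambda>s. g (h (cseg c x y s))) (\<lambda>s. m' (h (cseg c x y s)))"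
      by (rule sec_compose[OF m' hc]) (use \<gamma>P P hL in blast)
    then have s: "sec {0..1} (cseg c x y) (\<lambda>s. m' (h (cseg c x y s)))"
      by (rule sec_cong) (use \<gamma>P P gh in auto)
    have "inv m' (h (cseg c x y 0)) \<otimes> m' (h (cseg c x y 1)) = \<kappa> (fst c) (cseg c x y 0) (cseg c x y 1)"
      by (rule sec_diff_in_base[OF _ cseg_cont[OF c xy(1,2)] _ chart_in_boxes[OF c] s])
        (use cseg_in_chart[OF c xy(1,2)] in auto)
    then show "\<kappa> (fst c) x y = inv m' (h x) \<otimes> m' (h y)" using c xy by simp
  qed
qed

end

section \<open>Neighbourhoods bounded by leaves\<close>

text \<open>Finitely many compact cells \<open>Cl i\<close> in charts, with open parts \<open>Op i\<close> whose union \<open>N0\<close> is the set under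
  study. Compactness of the cells provides the uniform constants, openness of \<open>N0\<close> the topology.\<close>

locale plane_cells = plane_system k N A F G \<kappa>
  for k :: "'n::finite" and N :: "'a::topological_space set" and A F :: "('a, 'n) chart set"
    and G :: "('g, 'h) monoid_scheme" (structure) and \<kappa> :: "'a set \<Rightarrow> 'a \<Rightarrow> 'a \<Rightarrow> 'g" +
  fixes I :: "'i set" and ch :: "'i \<Rightarrow> ('a, 'n) chart" and Op Cl :: "'i \<Rightarrow> 'a set"
  assumes finite_I: "finite I"
    and ch: "i \<in> I \<Longrightarrow> ch i \<in> F"
    and Cl: "i \<in> I \<Longrightarrow> compact (Cl i)" "i \<in> I \<Longrightarrow> Cl i \<subseteq> fst (ch i)"
    and Op: "i \<in> I \<Longrightarrow> openin (top_of_set N) (Op i)" "i \<in> I \<Longrightarrow> Op i \<subseteq> Cl i"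
begin

definition N0 :: "'a set" where
  "N0 = (\<Union>i\<in>I. Op i)"

lemma N0_openin: "openin (top_of_set N) N0"
  unfolding N0_def by (rule openin_Union) (use Op in blast)

lemma N0_sub: "N0 \<subseteq> N"
  using N0_openin openin_imp_subset by blast

lemma Op_chart: "i \<in> I \<Longrightarrow> Op i \<subseteq> fst (ch i)"
  using Op Cl by blast

abbreviation lv :: "'i \<Rightarrow> 'a \<Rightarrow> real" where
  "lv i \<equiv> lev k (ch i)"

text \<open>As \<open>W\<close> and the rest of \<open>N0\<close> off \<open>Z\<close> are both open, \<open>W\<close> is a union of components of \<open>N0\<close> minus the leaves
  in \<open>Z\<close>: one cannot leave \<open>W\<close> without crossing one of these leaves.\<close>

definition adapted :: "'a set \<Rightarrow> 'a set set \<Rightarrow> bool" where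
  "adapted W Z \<longleftrightarrow> finite Z \<and> Z \<subseteq> leaf k F ` N \<and> openin (top_of_set N) W \<and> W \<subseteq> N0 \<and> W \<inter> \<Union>Z = {} \<and>
     openin (top_of_set N) (N0 - \<Union>Z - W) \<and> (\<exists>m. sec W (\<lambda>x. x) m)"

text \<open>The leaf \<open>L\<close> of \<open>q\<close> meets the cells in finitely many plaques. Let \<open>Z\<close> consist of the leaves that contain a
  plaque at distance \<open>\<delta>\<close> above or below one of these plaques, and let \<open>W\<close> consist of the points that, in some
  cell, are separated from a plaque of \<open>L\<close> by no leaf in \<open>Z\<close>. For small \<open>\<delta>\<close> the cell does not matter: a
  point \<open>a\<close> near \<open>L\<close> that lies in two cells shares a box with a point \<open>b\<close> of \<open>L\<close> that lies in both cells, and the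
  segment from \<open>b\<close> to \<open>a\<close> avoids \<open>Z\<close>. This segment also shows that going from \<open>a\<close> to \<open>L\<close> within either chart
  gives the same value, so the section along \<open>L\<close> extends to \<open>W\<close>. Complete leaves bound \<open>W\<close>, so that
  what is separated in one cell is separated in all of them.\<close>

lemma adapted_nbhd:
  assumes q: "q \<in> (\<Union>i\<in>I. Cl i)"
  obtains W Z T where "adapted W Z" "openin (top_of_set N) T" "q \<in> T" "T \<inter> N0 \<subseteq> W"
proof -
  define L where "L = leaf k F q"
  have qN: "q \<in> N" using q Cl(2) chart_sub ch by blast
  define S where "S i = lv i ` (L \<inter> Cl i)" for i
  have finS: "finite (S i)" if "i \<in> I" for i
    unfolding S_def L_def using that by (intro finite_levels ch Cl qN)
  (* R: the leaf L has no other level within e of the level \<tau>. Q: a point within e of the plaque at level \<tau>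
     shares a box with a point of that plaque. *)
  define R where "R i \<tau> e \<longleftrightarrow> (\<forall>y\<in>fst (ch i) \<inter> L. \<bar>lv i y - \<tau>\<bar> < e \<longrightarrow> lv i y = \<tau>)" for i \<tau> e
  define Q where "Q i j \<tau> e \<longleftrightarrow> (\<forall>a\<in>Cl i \<inter> Cl j. \<bar>lv i a - \<tau>\<bar> < e \<longrightarrow>
    (\<exists>b\<in>Cl i \<inter> Cl j. lv i b = \<tau> \<and> (\<exists>y r s. box_in k (ch i) y r s \<in> boxes k F \<and>
       box_in k (ch i) y r s \<subseteq> fst (ch i) \<inter> fst (ch j) \<and>
       a \<in> box_in k (ch i) y r s \<and> b \<in> box_in k (ch i) y r s)))" for i j \<tau> e
  define RQ where "RQ p e \<longleftrightarrow> R (fst p) (snd (snd p)) e \<and> Q (fst p) (fst (snd p)) (snd (snd p)) e" for p e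
  have "\<exists>e>0. \<forall>p\<in>(SIGMA i:I. I \<times> S i). RQ p e"
  proof (rule finite_uniform_pos)
    show "finite (SIGMA i:I. I \<times> S i)" using finite_I finS by (intro finite_SigmaI finite_cartesian_product)
  next
    show "RQ p e'" if "RQ p e" "e' \<le> e" for p e e'
      using that unfolding RQ_def R_def Q_def by (meson less_le_trans)
  next
    fix p assume p: "p \<in> (SIGMA i:I. I \<times> S i)"
    then obtain i j \<tau> where ij: "i \<in> I" "j \<in> I" "\<tau> \<in> S i" "p = (i, j, \<tau>)" by blast
    obtain x where x: "x \<in> fst (ch i)" "x \<in> L" "lv i x = \<tau>" using ij(3) Cl(2)[OF ij(1)] unfolding S_def by blast
    obtain e where e: "e > 0" "R i \<tau> e"
      using levels_isolated[OF qN ch[OF ij(1)] x(1) x(2)[unfolded L_def]] unfolding isolated_level_def R_def L_def x(3) by blast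
    obtain e' where e': "e' > 0" "Q i j \<tau> e'"
      unfolding Q_def by (rule overlap_in_boxes[OF ch[OF ij(1)] ch[OF ij(2)] Cl[OF ij(1)] Cl[OF ij(2)], of \<tau>]) blast
    have "R i \<tau> (min e e')" "Q i j \<tau> (min e e')"
      using e(2) e'(2) unfolding R_def Q_def by (meson min_less_iff_conj)+
    then have "RQ p (min e e')" unfolding RQ_def ij(4) by simp
    then show "\<exists>e>0. RQ p e" using e(1) e'(1) by (intro exI[of _ "min e e'"]) simp
  qed
  then obtain e where e1: "e > 0" and e2: "\<forall>p\<in>(SIGMA i:I. I \<times> S i). RQ p e" by blast
  have e: "e > 0" "\<And>i j \<tau>. i \<in> I \<Longrightarrow> j \<in> I \<Longrightarrow> \<tau> \<in> S i \<Longrightarrow> R i \<tau> e \<and> Q i j \<tau> e"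
  proof -
    fix i j \<tau> assume "i \<in> I" "j \<in> I" "\<tau> \<in> S i"
    then have "RQ (i, j, \<tau>) e" using e2 by blast
    then show "R i \<tau> e \<and> Q i j \<tau> e" unfolding RQ_def by simp
  qed (rule e1)
  (* Half of e, so that the leaves in Z are strictly within the range where L has the single level \<tau>. *)
  define \<delta> where "\<delta> = e / 2"
  have \<delta>: "\<delta> > 0" "\<delta> < e" using e(1) by (auto simp: \<delta>_def)
  have R: "lv i y = \<tau>" if "i \<in> I" "\<tau> \<in> S i" "y \<in> fst (ch i)" "y \<in> L" "\<bar>lv i y - \<tau>\<bar> < e" for i \<tau> y
    using e(2)[OF that(1,1,2)] that unfolding R_def by blast
  define Z where "Z = (\<Union>i\<in>I. \<Union>\<tau>\<in>S i. leaf k F ` {x \<in> fst (ch i). lv i x = \<tau> + \<delta>} \<union> leaf k F ` {x \<in> fst (ch i). lv i x = \<tau> - \<delta>})"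
  have finlev: "finite (leaf k F ` {x \<in> fst (ch i). lv i x = t})" if "i \<in> I" for i t
  proof (cases "{x \<in> fst (ch i). lv i x = t} = {}")
    case False
    then obtain x where x: "x \<in> fst (ch i)" "lv i x = t" by blast
    have "leaf k F ` {x \<in> fst (ch i). lv i x = t} \<subseteq> {leaf k F x}"
      using leaf_same_level[OF ch[OF that] _ x(1)] x(2) by auto
    then show ?thesis using finite_subset by blast
  qed (simp only: image_empty finite.emptyI)
  have finZ: "finite Z" unfolding Z_def using finite_I finS finlev by blast
  have ZN: "Z \<subseteq> leaf k F ` N" unfolding Z_def using chart_sub ch by blast
  have in_Z: "leaf k F x \<in> Z" if "i \<in> I" "\<tau> \<in> S i" "x \<in> fst (ch i)" "lv i x = \<tau> + \<delta> \<or> lv i x = \<tau> - \<delta>" for i \<tau> x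
    unfolding Z_def using that by blast
  have Z_cases: "\<exists>i\<in>I. \<exists>\<tau>\<in>S i. \<exists>x\<in>fst (ch i). M = leaf k F x \<and> (lv i x = \<tau> + \<delta> \<or> lv i x = \<tau> - \<delta>)" if "M \<in> Z" for M
    using that unfolding Z_def by blast
  have Z_sat: "y \<in> \<Union>Z" if "x \<in> \<Union>Z" "leaf k F x = leaf k F y" for x y
  proof -
    obtain M where M: "M \<in> Z" "x \<in> M" using \<open>x \<in> \<Union>Z\<close> by blast
    obtain z where "M = leaf k F z" using ZN M(1) by blast
    then have "M = leaf k F y" using leaf_eq[of x z] M(2) that(2) by simp
    then show ?thesis using M(1) leaf_self by blast
  qed
  have LZ: "L \<inter> \<Union>Z = {}"
  proof (rule ccontr)
    assume "L \<inter> \<Union>Z \<noteq> {}"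
    then obtain x M where xM: "x \<in> L" "M \<in> Z" "x \<in> M" by blast
    obtain i \<tau> y where y: "i \<in> I" "\<tau> \<in> S i" "y \<in> fst (ch i)" "M = leaf k F y" "lv i y = \<tau> + \<delta> \<or> lv i y = \<tau> - \<delta>"
      using Z_cases[OF xM(2)] by blast
    have "leaf k F x = L" using leaf_eq[of x q] xM(1) by (simp add: L_def)
    moreover have "leaf k F x = M" using leaf_eq[of x y] xM(3) y(4) by simp
    ultimately have "y \<in> L" using y(4) leaf_self by metis
    then have "lv i y = \<tau>" using R[OF y(1,2,3)] y(5) \<delta> by auto
    then show False using y(5) \<delta> by auto
  qed
  (* The levels of the chart of cell i that belong to no leaf in Z; J relates two of them that are not
     separated by such a leaf. *)
  define B where "B i = lv i ` (fst (ch i) - \<Union>Z)" for i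
  have UZ_closed: "closedin (top_of_set N) (\<Union>Z)"
  proof (rule closedin_Union[OF finZ])
    show "closedin (top_of_set N) M" if "M \<in> Z" for M using that ZN leaf_closed by blast
  qed
  have B_iff: "lv i x \<in> B i \<longleftrightarrow> x \<notin> \<Union>Z" if "i \<in> I" "x \<in> fst (ch i)" for i x
  proof
    assume "lv i x \<in> B i"
    then obtain y where y: "y \<in> fst (ch i)" "y \<notin> \<Union>Z" "lv i x = lv i y" unfolding B_def by blast
    then show "x \<notin> \<Union>Z" using Z_sat leaf_same_level[OF ch[OF that(1)] that(2) y(1,3)] by blast
  qed (use that in \<open>auto simp: B_def\<close>)
  have B_open: "open (B i)" if "i \<in> I" for i
  proof -
    have "openin (top_of_set N) (N - \<Union>Z)" using UZ_closed by (simp add: openin_diff)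
    then have "open (snd (ch i) ` (fst (ch i) \<inter> (N - \<Union>Z)))" by (rule chart_image_open[OF ch[OF that]])
    then have "open ((\<lambda>v. v $ k) ` (snd (ch i) ` (fst (ch i) \<inter> (N - \<Union>Z))))" by (rule open_image_vec_nth)
    moreover have "(\<lambda>v. v $ k) ` (snd (ch i) ` (fst (ch i) \<inter> (N - \<Union>Z))) = B i"
      using chart_sub[OF ch[OF that]] unfolding B_def image_image by blast
    ultimately show ?thesis by simp
  qed
  define J where "J i \<tau> t \<longleftrightarrow> connected_component (B i) \<tau> t" for i \<tau> t
  have J_close: "\<bar>t - \<tau>\<bar> < \<delta>" if "i \<in> I" "\<tau> \<in> S i" "J i \<tau> t" for i \<tau> t
  proof (rule ccontr)
    assume *: "\<not> \<bar>t - \<tau>\<bar> < \<delta>"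
    obtain C where C: "connected C" "C \<subseteq> B i" "\<tau> \<in> C" "t \<in> C"
      using \<open>J i \<tau> t\<close> unfolding J_def connected_component_def by blast
    have "\<tau> + \<delta> \<in> C \<or> \<tau> - \<delta> \<in> C"
    proof (cases "\<tau> \<le> t")
      case True
      then have "\<tau> + \<delta> \<in> {\<tau>..t}" using * \<delta>(1) by auto
      then show ?thesis using connected_contains_Icc[OF C(1,3,4)] by blast
    next
      case False
      then have "\<tau> - \<delta> \<in> {t..\<tau>}" using * \<delta>(1) by auto
      then show ?thesis using connected_contains_Icc[OF C(1,4,3)] by blast
    qed
    then obtain s where s: "s \<in> C" "s = \<tau> + \<delta> \<or> s = \<tau> - \<delta>" by blast
    then obtain x where x: "x \<in> fst (ch i)" "x \<notin> \<Union>Z" "s = lv i x"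
      using C(2) unfolding B_def by blast
    have x3: "lv i x = \<tau> + \<delta> \<or> lv i x = \<tau> - \<delta>" using s(2) x(3) by simp
    show False using in_Z[OF that(1,2) x(1) x3] leaf_self[of x] x(2) by blast
  qed
  have J_B: "t \<in> B i" if "J i \<tau> t" for i \<tau> t
    using that unfolding J_def using connected_component_in by blast
  (* What one cell recognizes as a point of W is recognized by every other cell that contains the point. *)
  have transfer: "\<exists>b\<in>Cl i \<inter> Cl j. b \<in> L \<and> lv i b = \<tau> \<and> J j (lv j b) (lv j a) \<and>
      (\<exists>V\<in>boxes k F. V \<subseteq> fst (ch i) \<inter> fst (ch j) \<and> a \<in> V \<and> b \<in> V)"
    if i: "i \<in> I" and j: "j \<in> I" and a: "a \<in> Op i" "a \<in> Op j" and \<tau>: "\<tau> \<in> S i" "J i \<tau> (lv i a)" for i j a \<tau>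
  proof -
    have aC: "a \<in> Cl i \<inter> Cl j" using a Op i j by blast
    have "\<bar>lv i a - \<tau>\<bar> < e" using J_close[OF i \<tau>] \<delta>(2) by simp
    then obtain b y r s where b: "b \<in> Cl i \<inter> Cl j" "lv i b = \<tau>"
      and V: "box_in k (ch i) y r s \<in> boxes k F" "box_in k (ch i) y r s \<subseteq> fst (ch i) \<inter> fst (ch j)"
       "a \<in> box_in k (ch i) y r s" "b \<in> box_in k (ch i) y r s"
      using e(2)[OF i j \<tau>(1)] aC unfolding Q_def by blast
    have ab: "a \<in> fst (ch i)" "b \<in> fst (ch i)" using aC b(1) Cl(2) i by blast+
    have bL: "b \<in> L"
    proof -
      obtain x where "x \<in> fst (ch i)" "x \<in> L" "lv i x = \<tau>" using \<tau>(1) Cl(2)[OF i] unfolding S_def by blast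
      then show ?thesis using leaf_level[OF ch[OF i] _ ab(2), of x q] b(2) by (simp add: L_def)
    qed
    define \<gamma> where "\<gamma> = cseg (ch i) b a"
    have \<gamma>V: "\<gamma> t \<in> box_in k (ch i) y r s" if "t \<in> {0..1}" for t
      unfolding \<gamma>_def by (rule cseg_in_box[OF ch[OF i] V(4,3) that])
    have \<gamma>c: "\<gamma> t \<in> fst (ch i)" "\<gamma> t \<in> fst (ch j)" if "t \<in> {0..1}" for t
      using \<gamma>V[OF that] V(2) by blast+
    obtain C where C: "connected C" "C \<subseteq> B i" "\<tau> \<in> C" "lv i a \<in> C"
      using \<tau>(2) unfolding J_def connected_component_def by blast
    have "lv i (\<gamma> t) \<in> C" if t: "t \<in> {0..1}" for t
    proof -
      have "convex C" using C(1) by (simp flip: is_interval_convex_1 add: is_interval_connected_1)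
      then have "(1 - t) *\<^sub>R \<tau> + t *\<^sub>R lv i a \<in> C" using C(3,4) t by (auto simp: convex_alt)
      then show ?thesis using lev_cseg[OF ch[OF i] ab(2,1) t] b(2) by (simp add: \<gamma>_def)
    qed
    then have "\<gamma> t \<notin> \<Union>Z" if "t \<in> {0..1}" for t
      using B_iff[OF i \<gamma>c(1)[OF that]] C(2) that by blast
    then have sub: "(\<lambda>t. lv j (\<gamma> t)) ` {0..1} \<subseteq> B j" using B_iff[OF j] \<gamma>c(2) by blast
    have "continuous_on {0..1} (\<lambda>t. lv j (\<gamma> t))"
      by (rule continuous_on_compose2[OF lev_cont[OF ch[OF j]]])
        (use cseg_cont[OF ch[OF i] ab(2,1)] \<gamma>c(2) in \<open>auto simp: \<gamma>_def\<close>)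
    then have conn: "connected ((\<lambda>t. lv j (\<gamma> t)) ` {0..1})" by (rule connected_continuous_image) simp
    have ends: "lv j b \<in> (\<lambda>t. lv j (\<gamma> t)) ` {0..1}" "lv j a \<in> (\<lambda>t. lv j (\<gamma> t)) ` {0..1}"
      using imageI[of 0 "{0..1}" "\<lambda>t. lv j (\<gamma> t)"] imageI[of 1 "{0..1}" "\<lambda>t. lv j (\<gamma> t)"]
        cseg_ends[OF ch[OF i]] ab by (simp_all add: \<gamma>_def)
    have "J j (lv j b) (lv j a)" unfolding J_def connected_component_def using conn sub ends by blast
    moreover have "\<exists>V\<in>boxes k F. V \<subseteq> fst (ch i) \<inter> fst (ch j) \<and> a \<in> V \<and> b \<in> V" using V by blast
    ultimately show ?thesis using b bL by blast
  qed
  have S_I: "lv j b \<in> S j" if "b \<in> Cl j" "b \<in> L" for j b using that unfolding S_def by blast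
  define slab where "slab i = {x \<in> Op i. \<exists>\<tau>\<in>S i. J i \<tau> (lv i x)}" for i
  define W where "W = (\<Union>i\<in>I. slab i)"
  have openJ: "open {t. J i \<tau> t}" if "i \<in> I" for i \<tau>
    unfolding J_def using open_connected_component[OF B_open[OF that], of \<tau>] by simp
  have slab_open: "openin (top_of_set N) (slab i)" if i: "i \<in> I" for i
  proof -
    have "open (\<Union>\<tau>\<in>S i. {t. J i \<tau> t})" using openJ[OF i] by blast
    then have "openin (top_of_set N) (Op i \<inter> {x \<in> fst (ch i). lv i x \<in> (\<Union>\<tau>\<in>S i. {t. J i \<tau> t})})"
      by (intro openin_Int Op i openin_lev_vimage ch)
    moreover have "Op i \<inter> {x \<in> fst (ch i). lv i x \<in> (\<Union>\<tau>\<in>S i. {t. J i \<tau> t})} = slab i"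
      using Op_chart[OF i] unfolding slab_def by blast
    ultimately show ?thesis by simp
  qed
  have W_open: "openin (top_of_set N) W" unfolding W_def by (rule openin_Union) (use slab_open in blast)
  have W_N0: "W \<subseteq> N0" unfolding W_def slab_def N0_def by blast
  have WZ: "W \<inter> \<Union>Z = {}"
  proof -
    have "x \<notin> \<Union>Z" if "i \<in> I" "x \<in> slab i" for i x
      using B_iff[OF that(1), of x] J_B Op_chart[OF that(1)] that(2) unfolding slab_def by blast
    then show ?thesis unfolding W_def by blast
  qed
  have slab_saturated: "x \<in> slab j" if "x \<in> W" and xj: "x \<in> Op j" "j \<in> I" for x j
  proof -
    obtain i \<tau> where i: "i \<in> I" "x \<in> Op i" "\<tau> \<in> S i" "J i \<tau> (lv i x)"
      using \<open>x \<in> W\<close> unfolding W_def slab_def by blast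
    obtain b where "b \<in> Cl j" "b \<in> L" "J j (lv j b) (lv j x)"
      using transfer[OF i(1) xj(2) i(2) xj(1) i(3,4)] by blast
    then show ?thesis unfolding slab_def using S_I xj(1) by blast
  qed
  have rest_open: "openin (top_of_set N) (N0 - \<Union>Z - W)"
  proof (subst openin_subopen, intro ballI)
    fix x assume x: "x \<in> N0 - \<Union>Z - W"
    then obtain j where j: "j \<in> I" "x \<in> Op j" unfolding N0_def by blast
    have xc: "x \<in> fst (ch j)" using Op_chart j by blast
    define T where "T = Op j \<inter> {y \<in> fst (ch j). lv j y \<in> {t. J j (lv j x) t}}"
    have "openin (top_of_set N) T"
      unfolding T_def by (intro openin_Int Op j openin_lev_vimage ch openJ)
    moreover have "J j (lv j x) (lv j x)" using B_iff[OF j(1) xc] x unfolding J_def by simp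
    then have "x \<in> T" unfolding T_def using j xc by simp
    moreover have "T \<subseteq> N0 - \<Union>Z - W"
    proof
      fix y assume y: "y \<in> T"
      then have yj: "y \<in> Op j" "y \<in> fst (ch j)" "J j (lv j x) (lv j y)" unfolding T_def by auto
      have "y \<notin> \<Union>Z" using B_iff[OF j(1) yj(2)] J_B[OF yj(3)] by blast
      moreover have "y \<notin> W"
      proof
        assume "y \<in> W"
        then obtain \<tau> where \<tau>: "\<tau> \<in> S j" "J j \<tau> (lv j y)"
          using slab_saturated[OF _ yj(1) j(1)] unfolding slab_def by blast
        have "J j \<tau> (lv j x)"
          using \<tau>(2) yj(3) unfolding J_def by (meson connected_component_sym connected_component_trans)
        then have "x \<in> W" unfolding W_def slab_def using \<tau>(1) j by blast
        then show False using x by blast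
      qed
      ultimately show "y \<in> N0 - \<Union>Z - W" using yj(1) j(1) unfolding N0_def by blast
    qed
    ultimately show "\<exists>T. openin (top_of_set N) T \<and> x \<in> T \<and> T \<subseteq> N0 - \<Union>Z - W" by blast
  qed
  (* The section at a: from the leaf L to a inside a chart, corrected by the section m along L. *)
  obtain m where m: "\<And>x. x \<in> L \<Longrightarrow> m x \<in> carrier G"
    "\<And>c x y. c \<in> F \<Longrightarrow> x \<in> fst c \<Longrightarrow> y \<in> fst c \<Longrightarrow> lev k c x = lev k c y \<Longrightarrow> x \<in> L \<Longrightarrow> \<kappa> (fst c) x y = inv m x \<otimes> m y"
    using leaf_section[OF qN] unfolding L_def by blast
  define val where "val a g \<longleftrightarrow> (\<exists>i\<in>I. \<exists>b\<in>fst (ch i) \<inter> L. a \<in> Op i \<and> lv i b \<in> S i \<and> J i (lv i b) (lv i a) \<and>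
    g = m b \<otimes> \<kappa> (fst (ch i)) b a)" for a g
  have val_unique: "g = g'" if "val a g" "val a g'" for a g g'
  proof -
    obtain i b where i: "i \<in> I" "b \<in> fst (ch i)" "b \<in> L" "a \<in> Op i" "lv i b \<in> S i" "J i (lv i b) (lv i a)"
      "g = m b \<otimes> \<kappa> (fst (ch i)) b a" using \<open>val a g\<close> unfolding val_def by blast
    obtain j b' where j: "j \<in> I" "b' \<in> fst (ch j)" "b' \<in> L" "a \<in> Op j" "lv j b' \<in> S j" "J j (lv j b') (lv j a)"
      "g' = m b' \<otimes> \<kappa> (fst (ch j)) b' a" using \<open>val a g'\<close> unfolding val_def by blast
    obtain b0 V where b0: "b0 \<in> Cl i" "b0 \<in> Cl j" "b0 \<in> L" "lv i b0 = lv i b" "J j (lv j b0) (lv j a)"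
      and V: "V \<in> boxes k F" "V \<subseteq> fst (ch i)" "V \<subseteq> fst (ch j)" "a \<in> V" "b0 \<in> V"
      using transfer[OF i(1) j(1) i(4) j(4) i(5,6)] by blast
    have b0c: "b0 \<in> fst (ch i)" "b0 \<in> fst (ch j)" using V by blast+
    have ac: "a \<in> fst (ch i)" "a \<in> fst (ch j)" using V by blast+
    have "J j (lv j b') (lv j b0)"
      using j(6) b0(5) unfolding J_def by (meson connected_component_sym connected_component_trans)
    then have "\<bar>lv j b0 - lv j b'\<bar> < e" using J_close[OF j(1,5)] \<delta> by fastforce
    then have lj: "lv j b0 = lv j b'" by (rule R[OF j(1,5) b0c(2) b0(3)])
    have step: "m b0 \<otimes> \<kappa> (fst (ch l)) b0 a = m d \<otimes> \<kappa> (fst (ch l)) d a"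
      if l: "l \<in> I" and d: "d \<in> fst (ch l)" "d \<in> L" "lv l b0 = lv l d" and b0l: "b0 \<in> fst (ch l)" "a \<in> fst (ch l)" for l d
    proof -
      note cl = chart_in_boxes[OF ch[OF l]]
      have c: "m b0 \<in> carrier G" "m d \<in> carrier G" "\<kappa> (fst (ch l)) b0 a \<in> carrier G"
        using m(1) b0(3) d(2) c_closed[OF cl] b0l by auto
      have "\<kappa> (fst (ch l)) d a = \<kappa> (fst (ch l)) d b0 \<otimes> \<kappa> (fst (ch l)) b0 a"
        using c_cocycle[OF cl d(1) b0l] by simp
      also have "\<kappa> (fst (ch l)) d b0 = inv m d \<otimes> m b0"
        by (rule m(2)[OF ch[OF l] d(1) b0l(1) d(3)[symmetric] d(2)])
      finally show ?thesis using c by (simp add: m_assoc[symmetric])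
    qed
    have "g = m b0 \<otimes> \<kappa> (fst (ch i)) b0 a"
      unfolding i(7) by (rule step[symmetric, OF i(1,2,3) b0(4) b0c(1) ac(1)])
    also have "\<kappa> (fst (ch i)) b0 a = \<kappa> V b0 a"
      using c_restrict[OF chart_in_boxes[OF ch[OF i(1)]] V(1,2,5,4)] by simp
    also have "\<dots> = \<kappa> (fst (ch j)) b0 a"
      using c_restrict[OF chart_in_boxes[OF ch[OF j(1)]] V(1,3,5,4)] by simp
    also have "m b0 \<otimes> \<kappa> (fst (ch j)) b0 a = g'"
      unfolding j(7) by (rule step[OF j(1,2,3) lj b0c(2) ac(2)])
    finally show ?thesis .
  qed
  have val_ex: "\<exists>i b. i \<in> I \<and> b \<in> fst (ch i) \<and> b \<in> L \<and> a \<in> Op i \<and> lv i b \<in> S i \<and> J i (lv i b) (lv i a)"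
    if "a \<in> W" for a
  proof -
    obtain i \<tau> where i: "i \<in> I" "a \<in> Op i" "\<tau> \<in> S i" "J i \<tau> (lv i a)"
      using \<open>a \<in> W\<close> unfolding W_def slab_def by blast
    obtain b where "b \<in> fst (ch i)" "b \<in> L" "\<tau> = lv i b" using i(3) Cl(2)[OF i(1)] unfolding S_def by blast
    then show ?thesis using i by blast
  qed
  define n where "n a = (THE g. val a g)" for a
  have n_eq: "n a = g" if "val a g" for a g
    unfolding n_def using that val_unique by blast
  have sub_N: "(\<lambda>x. x) ` W \<subseteq> N" using W_N0 N0_sub by simp
  have "sec W (\<lambda>x. x) n"
  proof (rule secI[OF continuous_on_id sub_N])
    fix a assume a: "a \<in> W"
    obtain i b where i: "i \<in> I" "b \<in> fst (ch i)" "b \<in> L" "a \<in> Op i" "lv i b \<in> S i" "J i (lv i b) (lv i a)"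
      using val_ex[OF a] by blast
    note ci = chart_in_boxes[OF ch[OF i(1)]]
    have ac: "a \<in> fst (ch i)" using i Op_chart by blast
    have nval: "n y = m b \<otimes> \<kappa> (fst (ch i)) b y" if "y \<in> Op i" "J i (lv i b) (lv i y)" for y
      by (rule n_eq) (use that i in \<open>unfold val_def, blast\<close>)
    have mb: "m b \<in> carrier G" using m(1) i(3) .
    show "n a \<in> carrier G" unfolding nval[OF i(4,6)] using mb c_closed[OF ci i(2) ac] by simp
    define T where "T = Op i \<inter> {y \<in> fst (ch i). lv i y \<in> {t. J i (lv i b) t}}"
    have T: "openin (top_of_set N) T"
      unfolding T_def by (intro openin_Int Op i openin_lev_vimage ch openJ)
    have aT: "a \<in> T" unfolding T_def using i ac by simp
    have "\<forall>\<^sub>F y in at a within W. y \<in> T"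
      by (rule eventually_in_open[OF continuous_on_id sub_N a T aT])
    then have "\<forall>\<^sub>F y in at a within W. n y = n a \<otimes> \<kappa> (fst (ch i)) a y"
    proof eventually_elim
      case (elim y)
      then have y: "y \<in> Op i" "y \<in> fst (ch i)" "J i (lv i b) (lv i y)" unfolding T_def by auto
      have "\<kappa> (fst (ch i)) b y = \<kappa> (fst (ch i)) b a \<otimes> \<kappa> (fst (ch i)) a y"
        using c_cocycle[OF ci i(2) ac y(2)] by simp
      then show ?case
        unfolding nval[OF y(1,3)] nval[OF i(4,6)] using mb c_closed[OF ci] i(2) ac y(2) by (simp add: m_assoc)
    qed
    then show "\<exists>V\<in>boxes k F. a \<in> V \<and> (\<forall>\<^sub>F y in at a within W. n y = n a \<otimes> \<kappa> V a y)"
      using ci ac by blast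
  qed
  then have adapted: "adapted W Z"
    unfolding adapted_def using finZ ZN W_open W_N0 WZ rest_open by blast
  (* Cells that avoid q are avoided by a neighbourhood of q, as they are closed. *)
  define T where "T i = (if q \<in> Cl i then {x \<in> fst (ch i). lv i x \<in> {t. J i (lv i q) t}} else N - Cl i)" for i
  have T_open: "openin (top_of_set N) (T i)" if i: "i \<in> I" for i
  proof (cases "q \<in> Cl i")
    case True
    then show ?thesis unfolding T_def using openin_lev_vimage[OF ch[OF i] openJ[OF i]] by simp
  next
    case False
    have "closedin (top_of_set N) (Cl i)"
      using i chart_sub[OF ch[OF i]] Cl(2)[OF i] by (intro compact_closedin Cl) auto
    then show ?thesis unfolding T_def using False by (simp add: openin_diff)
  qed
  have qT: "q \<in> T i" if i: "i \<in> I" for i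
  proof (cases "q \<in> Cl i")
    case True
    then have qc: "q \<in> fst (ch i)" using Cl(2)[OF i] by blast
    have "q \<notin> \<Union>Z" using LZ unfolding L_def using leaf_self by blast
    then have "J i (lv i q) (lv i q)" unfolding J_def using B_iff[OF i qc] by simp
    then show ?thesis unfolding T_def using True qc by simp
  qed (simp add: T_def qN)
  define T0 where "T0 = (\<Inter>i\<in>I. T i) \<inter> N"
  have "openin (top_of_set N) T0"
    unfolding T0_def using openin_INT[of I "top_of_set N" T] finite_I T_open by simp
  moreover have "q \<in> T0" unfolding T0_def using qT qN by blast
  moreover have "T0 \<inter> N0 \<subseteq> W"
  proof
    fix x assume x: "x \<in> T0 \<inter> N0"
    then obtain i where i: "i \<in> I" "x \<in> Op i" unfolding N0_def by blast
    have xT: "x \<in> T i" using x i(1) unfolding T0_def by blast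
    have "x \<in> Cl i" using i Op by blast
    then have qC: "q \<in> Cl i" using xT unfolding T_def by (auto split: if_splits)
    then have "J i (lv i q) (lv i x)" using xT unfolding T_def by simp
    moreover have "lv i q \<in> S i" using S_I[OF qC] unfolding L_def by simp
    ultimately show "x \<in> W" unfolding W_def slab_def using i by blast
  qed
  ultimately show ?thesis using that[OF adapted] by blast
qed

end

section \<open>Factorization through a free group\<close>

context plane_cells
begin

lemma adapted_absorbs:
  assumes "adapted W Z" "connected D" "D \<subseteq> N0 - \<Union>Z" "D \<inter> W \<noteq> {}"
  shows "D \<subseteq> W"
proof -
  have "openin (top_of_set N) W" "openin (top_of_set N) (N0 - \<Union>Z - W)"
    using assms(1) unfolding adapted_def by blast+
  then obtain A1 A2 where A: "open A1" "W = N \<inter> A1" "open A2" "N0 - \<Union>Z - W = N \<inter> A2"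
    unfolding openin_open by blast
  have DN: "D \<subseteq> N" using assms(3) N0_sub by blast
  have "D \<subseteq> A1 \<union> A2" using assms(3) A DN by blast
  moreover have "A1 \<inter> A2 \<inter> D = {}" using A DN by blast
  ultimately have "A1 \<inter> D = {} \<or> A2 \<inter> D = {}" using connectedD[OF assms(2) A(1,3)] by blast
  then show ?thesis using assms(3,4) A DN by blast
qed

text \<open>Cover \<open>N0\<close> by finitely many adapted sets and let \<open>ZZ\<close> be the union of all leaves that bound them. The piece
  \<open>D a\<close> of a point \<open>a\<close> is its component in \<open>N0 - ZZ\<close>, or in its leaf if \<open>a\<close> lies on \<open>ZZ\<close>; it is contained in
  one of the adapted sets, whose section \<open>mm (D a)\<close> trivializes \<open>\<kappa>\<close> on \<open>D a\<close>. Measured by the gauge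
  \<open>u a = mm (D a) a\<close>, the local system changes only on passing from a component \<open>C\<close> to an adjacent piece \<open>E\<close>
  of a leaf. The adapted set of \<open>E\<close> contains \<open>C\<close> as well, so the quotient of the two sections is constant on \<open>C\<close>; it
  is the value \<open>\<phi> (C, E)\<close> of the letter \<open>(C, E)\<close>. If both sides of \<open>E\<close> belong to the same \<open>C\<close>, then the
  record of a passage through \<open>E\<close> is trivial, as is the change of \<open>\<kappa>\<close>.\<close>

theorem free_factorization:
  obtains \<G> and c :: "'a set \<Rightarrow> 'a \<Rightarrow> 'a \<Rightarrow> (('a set \<times> 'a set) \<times> bool) list" and \<phi> and u
  where "local_system FG N0 \<G> c" "\<phi> \<in> UNIV \<rightarrow> carrier G" "\<And>x. x \<in> N0 \<Longrightarrow> u x \<in> carrier G"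
    "\<G> \<subseteq> boxes k F"
    "\<And>V a b. V \<in> \<G> \<Longrightarrow> a \<in> V \<Longrightarrow> b \<in> V \<Longrightarrow> \<kappa> V a b = inv u a \<otimes> ev G \<phi> (c V a b) \<otimes> u b"
proof -
  define K where "K = (\<Union>i\<in>I. Cl i)"
  have "\<exists>W Z T. adapted W Z \<and> open T \<and> q \<in> T \<and> T \<inter> N0 \<subseteq> W" if "q \<in> K" for q
  proof -
    obtain W Z T where T: "adapted W Z" "openin (top_of_set N) T" "q \<in> T" "T \<inter> N0 \<subseteq> W"
      using adapted_nbhd \<open>q \<in> K\<close> unfolding K_def by metis
    obtain T' where "open T'" "T = N \<inter> T'" using T(2) unfolding openin_open by blast
    then show ?thesis using T N0_sub by blast
  qed
  then obtain W Z T where nb: "\<And>q. q \<in> K \<Longrightarrow> adapted (W q) (Z q) \<and> open (T q) \<and> q \<in> T q \<and> T q \<inter> N0 \<subseteq> W q"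
    by metis
  have "compact K" unfolding K_def using finite_I Cl(1) by (intro compact_UN)
  then obtain Q where Q: "Q \<subseteq> K" "finite Q" "K \<subseteq> (\<Union>q\<in>Q. T q)"
    by (rule compactE_image[of K K T]) (use nb in blast)+
  have nQ: "adapted (W q) (Z q)" if "q \<in> Q" for q using nb Q(1) that by blast
  have coverQ: "\<exists>q\<in>Q. a \<in> W q" if "a \<in> N0" for a
  proof -
    have "a \<in> K" using that Op unfolding N0_def K_def by blast
    then show ?thesis using Q nb that by blast
  qed
  define ZS where "ZS = (\<Union>q\<in>Q. Z q)"
  define ZZ where "ZZ = \<Union>ZS"
  have ZSfin: "finite ZS" unfolding ZS_def using Q(2) nQ unfolding adapted_def by blast
  have ZSleaf: "ZS \<subseteq> leaf k F ` N" unfolding ZS_def using nQ unfolding adapted_def by blast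
  have ZZ_leaf: "leaf k F x \<in> ZS" if "x \<in> ZZ" for x
  proof -
    obtain M where M: "M \<in> ZS" "x \<in> M" using \<open>x \<in> ZZ\<close> unfolding ZZ_def by blast
    then obtain y where "M = leaf k F y" using ZSleaf by blast
    then show ?thesis using M leaf_eq by metis
  qed
  have ZZ_sub: "leaf k F x \<subseteq> ZZ" if "x \<in> ZZ" for x using ZZ_leaf[OF that] unfolding ZZ_def by blast
  have closedM: "closedin (top_of_set N) (\<Union>S)" if "S \<subseteq> ZS" for S
  proof (rule closedin_Union)
    show "finite S" using that ZSfin finite_subset by blast
    show "closedin (top_of_set N) M" if "M \<in> S" for M using that \<open>S \<subseteq> ZS\<close> ZSleaf leaf_closed by blast
  qed
  define dom where "dom a = (if a \<in> ZZ then N0 \<inter> leaf k F a else N0 - ZZ)" for a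
  define D where "D a = connected_component_set (dom a) a" for a
  have dom_self: "a \<in> dom a" if "a \<in> N0" for a using that unfolding dom_def by simp
  have D_self: "a \<in> D a" if "a \<in> N0" for a unfolding D_def using dom_self[OF that] by simp
  have D_conn: "connected (D a)" for a unfolding D_def by (rule connected_connected_component)
  have D_dom: "D a \<subseteq> dom a" for a unfolding D_def by (rule connected_component_subset)
  have D_N0: "D a \<subseteq> N0" for a using D_dom[of a] unfolding dom_def by (auto split: if_splits)
  have dom_eq: "dom b = dom a" if "b \<in> dom a" for a b
  proof (cases "a \<in> ZZ")
    case True
    then have "leaf k F b = leaf k F a" "b \<in> ZZ"
      using that leaf_eq ZZ_sub[OF True] unfolding dom_def by auto
    then show ?thesis using True unfolding dom_def by simp
  next
    case False
    then show ?thesis using that unfolding dom_def by auto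
  qed
  have D_eq: "D b = D a" if "b \<in> D a" for a b
    using that dom_eq[of b a] D_dom[of a] connected_component_eq[of b "dom a" a] unfolding D_def by force
  have D_max: "S \<subseteq> D a" if "connected S" "S \<subseteq> dom a" "a \<in> S" for S a
    unfolding D_def by (rule connected_component_maximal[OF that(3,1,2)])
  have D_absorb: "D a \<subseteq> W q" if "a \<in> N0" and q: "q \<in> Q" and ne: "D a \<inter> W q \<noteq> {}" for a q
  proof (rule adapted_absorbs[OF nQ[OF q] D_conn _ ne])
    obtain b where b: "b \<in> D a" "b \<in> W q" using ne by blast
    have "b \<notin> \<Union>(Z q)" using nQ[OF q] b(2) unfolding adapted_def by blast
    then have bZ: "leaf k F b \<notin> Z q" using leaf_self by blast
    have ZqZZ: "\<Union>(Z q) \<subseteq> ZZ" unfolding ZZ_def ZS_def using q by blast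
    show "D a \<subseteq> N0 - \<Union>(Z q)"
    proof
      fix x assume x: "x \<in> D a"
      have db: "dom b = dom a" using dom_eq D_dom b(1) by blast
      have "x \<notin> \<Union>(Z q)"
      proof
        assume "x \<in> \<Union>(Z q)"
        then obtain M where M: "M \<in> Z q" "x \<in> M" by blast
        have "x \<in> ZZ" using M ZqZZ by blast
        then have "x \<notin> N0 - ZZ" by blast
        then have "dom a \<noteq> N0 - ZZ" using x D_dom by blast
        then have "dom b \<noteq> N0 - ZZ" unfolding db .
        then have bZZ: "b \<in> ZZ" by (cases "b \<in> ZZ") (simp_all add: dom_def)
        have "x \<in> dom b" unfolding db using x D_dom by blast
        then have "x \<in> leaf k F b" using bZZ by (simp add: dom_def)
        moreover obtain y where "M = leaf k F y" using M(1) nQ[OF q] unfolding adapted_def by blast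
        ultimately have "M = leaf k F b" using M(2) leaf_eq by metis
        then show False using M(1) bZ by blast
      qed
      then show "x \<in> N0 - \<Union>(Z q)" using x D_N0 by blast
    qed
  qed
  define wq where "wq E = (SOME q. q \<in> Q \<and> E \<subseteq> W q)" for E
  have wq: "wq (D a) \<in> Q \<and> D a \<subseteq> W (wq (D a))" if "a \<in> N0" for a
  proof -
    obtain q where "q \<in> Q" "a \<in> W q" using coverQ \<open>a \<in> N0\<close> by blast
    then have "q \<in> Q \<and> D a \<subseteq> W q" using D_absorb[OF that] D_self[OF that] by blast
    then show ?thesis unfolding wq_def by (rule someI)
  qed
  define WW where "WW E = W (wq E)" for E
  define mm where "mm E = (SOME m. sec (WW E) (\<lambda>x. x) m)" for E
  have D_WW: "D a \<subseteq> WW (D a)" if "a \<in> N0" for a using wq[OF that] unfolding WW_def by blast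
  have adaptedWW: "adapted (WW (D a)) (Z (wq (D a)))" if "a \<in> N0" for a
    using nQ wq[OF that] unfolding WW_def by blast
  have secmm: "sec (WW (D a)) (\<lambda>x. x) (mm (D a))" if "a \<in> N0" for a
  proof -
    have "\<exists>m. sec (WW (D a)) (\<lambda>x. x) m" using adaptedWW[OF that] unfolding adapted_def by blast
    then show ?thesis unfolding mm_def by (rule someI_ex)
  qed
  have WW_absorb: "D a \<subseteq> WW (D b)" if "a \<in> N0" "b \<in> N0" "D a \<inter> WW (D b) \<noteq> {}" for a b
    using D_absorb[OF that(1)] wq[OF that(2)] that(3) unfolding WW_def by blast
  have WW_N: "WW (D a) \<subseteq> N" if "a \<in> N0" for a
    using adaptedWW[OF that] N0_sub unfolding adapted_def by blast
  have mm_closed: "mm (D a) x \<in> carrier G" if "a \<in> N0" "x \<in> WW (D a)" for a x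
    using sec_closed[OF secmm[OF that(1)] that(2)] .
  define u where "u a = mm (D a) a" for a
  have u_closed: "u a \<in> carrier G" if "a \<in> N0" for a
    unfolding u_def using mm_closed[OF that] D_WW[OF that] D_self[OF that] by blast
  (* P\<phi> l x: the quotient of the sections that belong to the letter l has the constant value x. *)
  define P\<phi> where "P\<phi> l x \<longleftrightarrow> x \<in> carrier G \<and> fst l \<noteq> {} \<and> (\<forall>a\<in>fst l. mm (fst l) a \<otimes> inv mm (snd l) a = x)" for l x
  define \<phi> where "\<phi> l = (if \<exists>x. P\<phi> l x then SOME x. P\<phi> l x else \<one>)" for l
  have \<phi>_some: "P\<phi> l (\<phi> l)" if "P\<phi> l x" for l x
  proof -
    have ex: "\<exists>x. P\<phi> l x" using that by (rule exI)
    have "P\<phi> l (SOME x. P\<phi> l x)" using ex by (rule someI_ex)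
    moreover have "\<phi> l = (SOME x. P\<phi> l x)" unfolding \<phi>_def using ex by (rule if_P)
    ultimately show ?thesis by simp
  qed
  have \<phi>_closed: "\<phi> l \<in> carrier G" for l
  proof (cases "\<exists>x. P\<phi> l x")
    case True
    then have "P\<phi> l (\<phi> l)" using \<phi>_some by blast
    then show ?thesis unfolding P\<phi>_def by blast
  next
    case False
    then have "\<phi> l = \<one>" unfolding \<phi>_def by (rule if_not_P)
    then show ?thesis by simp
  qed
  have \<phi>_eq: "\<phi> (D a, D z) = mm (D a) a \<otimes> inv mm (D z) a"
    if a: "a \<in> N0" and z: "z \<in> N0" and sub: "D a \<subseteq> WW (D z)" for a z
  proof -
    have DN: "(\<lambda>x. x) ` D a \<subseteq> N" using D_N0 N0_sub by auto
    have "mm (D a) b \<otimes> inv mm (D z) b = mm (D a) a \<otimes> inv mm (D z) a" if "b \<in> D a" for b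
      by (rule sec_unique[OF D_conn continuous_on_id DN sec_subset[OF secmm[OF a] D_WW[OF a]] sec_subset[OF secmm[OF z] sub]])
        (use that D_self[OF a] in auto)
    moreover have "mm (D a) a \<otimes> inv mm (D z) a \<in> carrier G"
      by (intro m_closed inv_closed mm_closed a z subsetD[OF D_WW[OF a]] subsetD[OF sub] D_self)
    ultimately have "P\<phi> (D a, D z) (mm (D a) a \<otimes> inv mm (D z) a)"
      unfolding P\<phi>_def fst_conv snd_conv using D_self[OF a] by blast
    then have "P\<phi> (D a, D z) (\<phi> (D a, D z))"  by (rule \<phi>_some)
    then show ?thesis using D_self[OF a] unfolding P\<phi>_def by simp
  qed
  (* Small boxes: they meet ZZ in at most one plaque, and each side of this plaque belongs to a component
     that reaches into the adapted set of the plaque. *)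
  define good where "good V \<longleftrightarrow> V \<in> boxes k F \<and> V \<subseteq> N0 \<and> (\<forall>z\<in>V \<inter> ZZ. V \<inter> ZZ \<subseteq> D z) \<and>
    (V \<inter> ZZ = {} \<longrightarrow> (\<forall>a\<in>V. V \<subseteq> D a)) \<and> (\<forall>z\<in>V \<inter> ZZ. \<forall>a\<in>V - ZZ. D a \<inter> WW (D z) \<noteq> {})" for V
  have good_mid: "y \<in> D z" if "good V" "z \<in> V" "z \<in> ZZ" "y \<in> V" "y \<in> ZZ" for V y z
    using that unfolding good_def by blast
  have good_off: "y \<in> D z" if "good V" "V \<inter> ZZ = {}" "z \<in> V" "y \<in> V" for V y z
    using that unfolding good_def by blast
  have good_side: "D a \<inter> WW (D z) \<noteq> {}" if "good V" "z \<in> V" "z \<in> ZZ" "a \<in> V" "a \<notin> ZZ" for V a z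
    using that unfolding good_def by blast
  have good_box: "V \<in> boxes k F" "V \<subseteq> N0" if "good V" for V
    using that unfolding good_def by blast+
  have good_base: "\<exists>V\<in>Collect good. x \<in> V \<and> V \<subseteq> T" if x: "x \<in> T" and T0: "openin (top_of_set N0) T" for x T
  proof -
    have T: "openin (top_of_set N) T" using T0 N0_openin openin_trans by blast
    have TN0: "T \<subseteq> N0" using T0 openin_imp_subset by blast
    have xN0: "x \<in> N0" using x TN0 by blast
    then have xN: "x \<in> N" using N0_sub by blast
    obtain c where c: "c \<in> F" "x \<in> fst c" using chart_cover[OF xN] by blast
    show ?thesis
    proof (cases "x \<in> ZZ")
      case False
      have "openin (top_of_set N) (T - ZZ)" using T closedM[of ZS] unfolding ZZ_def by (intro openin_diff) auto
      then obtain V where V: "V \<in> boxes k F" "x \<in> V" "V \<subseteq> T - ZZ" using boxes_base[of x "T - ZZ"] x False by blast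
      have VZ: "V \<inter> ZZ = {}" using V(3) by blast
      have "V \<subseteq> D a" if "a \<in> V" for a
      proof (rule D_max[OF connected_box[OF V(1)] _ that])
        have "a \<notin> ZZ" using that VZ by blast
        then show "V \<subseteq> dom a" unfolding dom_def using V(3) TN0 by auto
      qed
      then have "good V" unfolding good_def using V TN0 VZ by blast
      then show ?thesis using V by blast
    next
      case True
      define M where "M = leaf k F x"
      define C where "C = \<Union>(ZS - {M})"
      have M: "M \<in> ZS" "x \<in> M" unfolding M_def using ZZ_leaf[OF True] by auto
      have xC: "x \<notin> C"
      proof
        assume "x \<in> C"
        then obtain M' where M': "M' \<in> ZS" "M' \<noteq> M" "x \<in> M'" unfolding C_def by blast
        then obtain y where "M' = leaf k F y" using ZSleaf by blast
        then show False using M'(2,3) leaf_eq unfolding M_def by metis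
      qed
      have ZZ_MC: "ZZ = M \<union> C" unfolding ZZ_def C_def using M(1) by blast
      have "openin (top_of_set N) (T - C)" using T closedM[of "ZS - {M}"] unfolding C_def by (intro openin_diff) auto
      then obtain e where e: "e > 0" "\<And>r s. r \<le> e \<Longrightarrow> s \<le> e \<Longrightarrow> Box k (snd c x) r s \<subseteq> snd c ` fst c"
         "\<And>r s. r \<le> e \<Longrightarrow> s \<le> e \<Longrightarrow> box_in k c (snd c x) r s \<subseteq> T - C"
        using small_box[OF c, of "T - C"] x xC by blast
      obtain e0 where e0: "e0 > 0" "\<And>y. y \<in> fst c \<inter> M \<Longrightarrow> \<bar>lev k c y - lev k c x\<bar> < e0 \<Longrightarrow> lev k c y = lev k c x"
        using levels_isolated[OF xN c leaf_self] unfolding isolated_level_def M_def by blast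
      define r where "r = min e e0"
      have r: "r > 0" "r \<le> e" "r \<le> e0" using e(1) e0(1) by (auto simp: r_def)
      define V where "V = box_in k c (snd c x) r r"
      have Vbox: "V \<in> boxes k F" unfolding V_def by (intro box_in_boxes c e(2) r)
      have VT: "V \<subseteq> T - C" unfolding V_def by (intro e(3) r)
      have xV: "x \<in> V" unfolding V_def using c(2) r(1) by simp
      have Vc: "V \<subseteq> fst c" unfolding V_def box_in_def by blast
      have VZ: "y \<in> ZZ \<longleftrightarrow> lev k c y = lev k c x" if "y \<in> V" for y
      proof
        assume "y \<in> ZZ"
        then have "y \<in> M" using VT that ZZ_MC by blast
        moreover have "\<bar>lev k c y - lev k c x\<bar> < e0"
          using that r(3) unfolding V_def box_in_def Box_def by (auto simp: dist_real_def)
        ultimately show "lev k c y = lev k c x" using e0(2) Vc that by blast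
      next
        assume l: "lev k c y = lev k c x"
        have "y \<in> fst c" using that Vc by blast
        then have "leaf k F x = leaf k F y" using leaf_same_level[OF c(1,2) _ l[symmetric]] by blast
        then have "y \<in> M" unfolding M_def by simp
        then show "y \<in> ZZ" using ZZ_MC by blast
      qed
      have \<gamma>V: "cseg c a b s \<in> V" if "a \<in> V" "b \<in> V" "s \<in> {0..1}" for a b s
        unfolding V_def by (rule cseg_in_box[OF c(1) that[unfolded V_def]])
      have lev\<gamma>: "lev k c (cseg c a b s) = (1 - s) * lev k c a + s * lev k c b" if "a \<in> V" "b \<in> V" "s \<in> {0..1}" for a b s
        using lev_cseg[OF c(1) _ _ that(3)] that(1,2) Vc by blast
      have "connected (V \<inter> ZZ)"
      proof (rule cseg_connected[OF c(1)])
        fix a b s assume ab: "a \<in> V \<inter> ZZ" "b \<in> V \<inter> ZZ" "s \<in> {0..1 :: real}"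
        then have abV: "a \<in> V" "b \<in> V" "lev k c a = lev k c x" "lev k c b = lev k c x" using VZ by auto
        have "lev k c (cseg c a b s) = lev k c x"
          using lev\<gamma>[OF abV(1,2) ab(3)] abV(3,4) by (simp add: algebra_simps)
        then show "cseg c a b s \<in> V \<inter> ZZ" using VZ[OF \<gamma>V[OF abV(1,2) ab(3)]] \<gamma>V[OF abV(1,2) ab(3)] by blast
      qed (use Vc in blast)
      then have 1: "V \<inter> ZZ \<subseteq> D z" if z: "z \<in> V \<inter> ZZ" for z
      proof (rule D_max[OF _ _ that])
        have "V \<inter> ZZ \<subseteq> leaf k F z"
        proof
          fix y assume y: "y \<in> V \<inter> ZZ"
          have "lev k c y = lev k c z" using y z VZ by auto
          then have "leaf k F y = leaf k F z" using leaf_same_level[OF c(1)] y z Vc by blast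
          then show "y \<in> leaf k F z" using leaf_self[of y] by simp
        qed
        then show "V \<inter> ZZ \<subseteq> dom z" unfolding dom_def using z VT TN0 by auto
      qed
      have 3: "D a \<inter> WW (D z) \<noteq> {}" if z: "z \<in> V \<inter> ZZ" and a: "a \<in> V - ZZ" for z a
      proof -
        have zV: "z \<in> V" "a \<in> V" "z \<in> fst c" "a \<in> fst c" using z a Vc by blast+
        have zN0: "z \<in> N0" "a \<in> N0" using zV VT TN0 by blast+
        define \<gamma> where "\<gamma> = cseg c z a"
        have \<gamma>c: "continuous_on {0..1} \<gamma>" unfolding \<gamma>_def by (rule cseg_cont[OF c(1) zV(3,4)])
        have lz: "lev k c z = lev k c x" "lev k c a \<noteq> lev k c x" using VZ zV z a by auto
        (* The segment leaves the plaque at once, so it runs in the component of a up to its starting point z. *)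
        have out: "\<gamma> s \<in> N0 - ZZ" if "s \<in> {0<..1}" for s
        proof -
          have s: "s \<in> {0..1}" "s \<noteq> 0" using that by auto
          have "lev k c (\<gamma> s) - lev k c x = s * (lev k c a - lev k c x)"
            unfolding \<gamma>_def lev\<gamma>[OF zV(1,2) s(1)] lz(1) by (simp add: algebra_simps)
          then have "lev k c (\<gamma> s) \<noteq> lev k c x" using s(2) lz(2) by auto
          moreover have "\<gamma> s \<in> V" unfolding \<gamma>_def by (rule \<gamma>V[OF zV(1,2) s(1)])
          ultimately show ?thesis using VZ VT TN0 by blast
        qed
        have "connected (\<gamma> ` {0<..1})"
          by (rule connected_continuous_image[OF continuous_on_subset[OF \<gamma>c]]) auto
        moreover have "\<gamma> ` {0<..1} \<subseteq> dom a" unfolding dom_def using out a by auto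
        moreover have "a \<in> \<gamma> ` {0<..1}"
          by (rule image_eqI[of _ _ 1]) (use cseg_ends(2)[OF c(1) zV(4)] in \<open>auto simp: \<gamma>_def\<close>)
        ultimately have sub: "\<gamma> ` {0<..1} \<subseteq> D a" by (rule D_max)
        have oW: "openin (top_of_set N) (WW (D z))" using adaptedWW[OF zN0(1)] unfolding adapted_def by blast
        have \<gamma>N: "\<gamma> ` {0..1} \<subseteq> N" unfolding \<gamma>_def using \<gamma>V[OF zV(1,2)] VT TN0 N0_sub by blast
        have \<gamma>0: "\<gamma> 0 = z" unfolding \<gamma>_def using cseg_ends(1)[OF c(1) zV(3)] .
        have "\<forall>\<^sub>F s in at 0 within {0..1}. \<gamma> s \<in> WW (D z)"
          by (rule eventually_in_open[OF \<gamma>c \<gamma>N _ oW]) (use \<gamma>0 D_WW[OF zN0(1)] D_self[OF zN0(1)] in auto)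
        then obtain d where d: "d > 0" "\<And>s. s \<in> {0..1} \<Longrightarrow> s \<noteq> 0 \<Longrightarrow> dist s 0 < d \<Longrightarrow> \<gamma> s \<in> WW (D z)"
          unfolding eventually_at by blast
        define s where "s = min (d / 2) 1"
        have s: "s \<in> {0..1}" "s \<noteq> 0" "dist s 0 < d" "s \<in> {0<..1}" using d(1) by (auto simp: s_def dist_real_def)
        then show ?thesis using d(2)[OF s(1-3)] sub by blast
      qed
      have "V \<inter> ZZ \<noteq> {}" using xV True by blast
      then have "good V" unfolding good_def using Vbox VT TN0 1 3 by blast
      then show ?thesis using xV VT by blast
    qed
  qed
  define zrep where "zrep V = (SOME z. z \<in> V \<inter> ZZ)" for V
  have zrep: "zrep V \<in> V \<inter> ZZ" if "V \<inter> ZZ \<noteq> {}" for V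
    unfolding zrep_def using that by (meson ex_in_conv someI_ex)
  (* The record of a passage from a to the plaque of V; the record from a to b goes through the plaque. *)
  define lam :: "'a set \<Rightarrow> 'a \<Rightarrow> (('a set \<times> 'a set) \<times> bool) list" where
    "lam V a = (if V \<inter> ZZ = {} \<or> a \<in> ZZ then [] else [((D a, D (zrep V)), True)])" for V a
  have lam_c: "lam V a \<in> carrier FG" for V a by (simp add: lam_def)
  define c where "c V a b = lam V a \<otimes>\<^bsub>FG\<^esub> inv\<^bsub>FG\<^esub> lam V b" for V a b
  have c_triv: "c V a b = \<one>\<^bsub>FG\<^esub>" if "lam V a = lam V b" for V a b
    unfolding c_def that by (rule FG.r_inv[OF lam_c])
  have sys: "local_system FG N0 (Collect good) c"
  proof (intro local_system.intro group_FG local_system_axioms.intro)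
    show "openin (top_of_set N0) V" if "V \<in> Collect good" for V
    proof -
      have V: "V \<in> boxes k F" "V \<subseteq> N0" using good_box that by blast+
      show ?thesis using openin_subset_trans[OF boxes_openin[OF V(1)] V(2) N0_sub] .
    qed
    show "\<exists>V\<in>Collect good. x \<in> V \<and> V \<subseteq> T" if "x \<in> T" "openin (top_of_set N0) T" for x T
      using good_base[OF that] .
    show "c V a b \<in> carrier FG" for V a b
      unfolding c_def by (intro FG.m_closed FG.inv_closed lam_c)
    show "c V a b \<otimes>\<^bsub>FG\<^esub> c V b d = c V a d" for V a b d
    proof -
      have "c V a b \<otimes>\<^bsub>FG\<^esub> c V b d = lam V a \<otimes>\<^bsub>FG\<^esub> ((inv\<^bsub>FG\<^esub> lam V b \<otimes>\<^bsub>FG\<^esub> lam V b) \<otimes>\<^bsub>FG\<^esub> inv\<^bsub>FG\<^esub> lam V d)"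
        unfolding c_def by (simp only: FG.m_assoc FG.m_closed FG.inv_closed lam_c)
      also have "\<dots> = c V a d"
        unfolding c_def by (simp only: FG.l_inv FG.l_one FG.inv_closed lam_c)
      finally show ?thesis .
    qed
    show "c U a b = c V a b" if "V \<in> Collect good" "U \<in> Collect good" "U \<subseteq> V" "a \<in> U" "b \<in> U" for V U a b
    proof (cases "U \<inter> ZZ = {}")
      case True
      have "lam U a = lam U b" unfolding lam_def using True by simp
      moreover have "D b = D a" by (rule D_eq[OF good_off[OF _ True that(4,5)]]) (use that(2) in simp)
      then have "lam V a = lam V b" unfolding lam_def using True that(4,5) by auto
      ultimately show ?thesis using c_triv by metis
    next
      case False
      have "zrep U \<in> V \<inter> ZZ" using zrep[OF False] that(3) by blast
      moreover from this have "zrep V \<in> V \<inter> ZZ" using zrep[of V] by blast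
      ultimately have "zrep U \<in> D (zrep V)" using that(1) by (intro good_mid[of V]) auto
      then have "D (zrep U) = D (zrep V)" by (rule D_eq)
      moreover have "V \<inter> ZZ \<noteq> {}" using False that(3) by blast
      ultimately show ?thesis unfolding c_def lam_def using False by simp
    qed
  qed
  have \<phi>c: "\<phi> \<in> UNIV \<rightarrow> carrier G" using \<phi>_closed by simp
  have rel: "\<kappa> V a b = inv u a \<otimes> ev G \<phi> (c V a b) \<otimes> u b" if V: "V \<in> Collect good" and ab: "a \<in> V" "b \<in> V" for V a b
  proof -
    have Vb: "V \<in> boxes k F" "V \<subseteq> N0" using good_box V by blast+
    have abN: "a \<in> N0" "b \<in> N0" using ab Vb by blast+
    have \<kappa>: "\<kappa> V a b = inv mm (D z) a \<otimes> mm (D z) b" if "z \<in> N0" "V \<subseteq> WW (D z)" for z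
      using sec_diff_in_base[OF connected_box[OF Vb(1)] continuous_on_id _ Vb(1) sec_subset[OF secmm[OF that(1)] that(2)] ab]
      by simp
    have evc: "ev G \<phi> (c V a b) = ev G \<phi> (lam V a) \<otimes> inv ev G \<phi> (lam V b)"
      unfolding c_def by (simp only: ev_mult_FG[OF \<phi>c] ev_inv_FG[OF \<phi>c lam_c])
    show ?thesis
    proof (cases "V \<inter> ZZ = {}")
      case True
      have sub: "V \<subseteq> D a" using good_off[OF _ True ab(1)] V by blast
      then have "V \<subseteq> WW (D a)" using D_WW[OF abN(1)] by blast
      from \<kappa>[OF abN(1) this] have "\<kappa> V a b = inv u a \<otimes> u b"
        using D_eq[of b a] sub ab unfolding u_def by auto
      moreover have "ev G \<phi> (c V a b) = \<one>" unfolding evc lam_def using True by simp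
      ultimately show ?thesis using u_closed abN by simp
    next
      case False
      define z where "z = zrep V"
      have z: "z \<in> V" "z \<in> ZZ" using zrep[OF False] unfolding z_def by auto
      have zN: "z \<in> N0" using z Vb by blast
      have Dsub: "D d \<subseteq> WW (D z)" if d: "d \<in> V" for d
      proof (cases "d \<in> ZZ")
        case True
        then have "d \<in> D z" using good_mid[OF _ z d] V by blast
        then have "D d = D z" by (rule D_eq)
        then show ?thesis using D_WW[OF zN] by simp
      next
        case False
        then have "D d \<inter> WW (D z) \<noteq> {}" using good_side[OF _ z d] V by blast
        then show ?thesis by (rule WW_absorb[OF subsetD[OF Vb(2) d] zN])
      qed
      have inWW: "d \<in> WW (D z)" if "d \<in> V" for d using Dsub[OF that] D_self that Vb(2) by blast
      have evlam: "ev G \<phi> (lam V d) = u d \<otimes> inv mm (D z) d" if d: "d \<in> V" for d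
      proof -
        have dN: "d \<in> N0" using d Vb by blast
        have cl: "u d \<in> carrier G" "mm (D z) d \<in> carrier G"
          using u_closed[OF dN] mm_closed[OF zN inWW[OF d]] by auto
        show ?thesis
        proof (cases "d \<in> ZZ")
          case True
          then have "d \<in> D z" using good_mid[OF _ z d] V by blast
          then have "D d = D z" by (rule D_eq)
          then have "u d = mm (D z) d" unfolding u_def by simp
          then show ?thesis using True cl unfolding lam_def by simp
        next
          case dZ: False
          have "ev G \<phi> (lam V d) = \<phi> (D d, D z)"
            unfolding lam_def z_def[symmetric] using False dZ \<phi>_closed by (simp add: ev_Cons)
          then show ?thesis unfolding \<phi>_eq[OF dN zN Dsub[OF d]] u_def .
        qed
      qed
      have "V \<subseteq> WW (D z)" using inWW by blast
      note \<kappa>z = \<kappa>[OF zN this]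
      have cl: "u a \<in> carrier G" "u b \<in> carrier G" "mm (D z) a \<in> carrier G" "mm (D z) b \<in> carrier G"
        using u_closed abN mm_closed[OF zN] inWW ab by auto
      have "ev G \<phi> (c V a b) = u a \<otimes> (inv mm (D z) a \<otimes> mm (D z) b) \<otimes> inv u b"
        unfolding evc evlam[OF ab(1)] evlam[OF ab(2)] using cl by (simp add: inv_mult_group m_assoc)
      then have "inv u a \<otimes> ev G \<phi> (c V a b) \<otimes> u b
          = (inv u a \<otimes> u a) \<otimes> (inv mm (D z) a \<otimes> mm (D z) b) \<otimes> (inv u b \<otimes> u b)"
        using cl by (simp only: m_assoc m_closed inv_closed)
      then show ?thesis unfolding \<kappa>z using cl by simp
    qed
  qed
  show ?thesis
    by (rule that[OF sys \<phi>c u_closed _ rel]) (use good_box in blast)+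
qed

end

section \<open>The fundamental group\<close>

text \<open>Any two paths in the unit interval with the same ends are homotopic. The groupoid laws for a path \<open>g\<close> in a
  topological space follow, as the paths involved are reparametrizations of \<open>g\<close>.\<close>

lemma homotopic_reparam:
  fixes g :: "real \<Rightarrow> 'a::topological_space" and a b :: "real \<Rightarrow> real"
  assumes g: "path g" "path_image g \<subseteq> M"
    and a: "path a" "path_image a \<subseteq> {0..1}" and b: "path b" "path_image b \<subseteq> {0..1}"
    and ends: "pathstart a = pathstart b" "pathfinish a = pathfinish b"
  shows "homotopic_paths M (g \<circ> a) (g \<circ> b)"
proof -
  have "closed_segment (a t) (b t) \<subseteq> {0..1}" if t: "t \<in> {0..1}" for t
  proof (rule closed_segment_subset)
    show "a t \<in> {0..1}" using a(2) t unfolding path_image_def by blast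
    show "b t \<in> {0..1}" using b(2) t unfolding path_image_def by blast
  qed simp
  then have "homotopic_paths {0..1} a b"
    using a b ends by (intro homotopic_paths_linear) auto
  then show ?thesis
    by (rule homotopic_paths_continuous_image) (use g in \<open>auto simp: path_def path_image_def\<close>)
qed

lemma homotopic_const_right:
  fixes g :: "real \<Rightarrow> 'a::topological_space"
  assumes g: "path g" "path_image g \<subseteq> M" and x: "pathfinish g = x"
  shows "homotopic_paths M (g +++ (\<lambda>_. x)) g"
proof -
  have "homotopic_paths M (g \<circ> (linepath 0 1 +++ linepath 1 1)) (g \<circ> linepath 0 1)"
    by (rule homotopic_reparam[OF g]) (auto simp: path_image_join closed_segment_eq_real_ivl)
  moreover have "g \<circ> (linepath 0 1 +++ linepath 1 1) = g +++ (\<lambda>_. x)"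
    using x by (auto simp: fun_eq_iff joinpaths_def linepath_def pathfinish_def)
  moreover have "g \<circ> linepath 0 1 = g" by (auto simp: fun_eq_iff linepath_def)
  ultimately show ?thesis by simp
qed

lemma homotopic_const_left:
  fixes g :: "real \<Rightarrow> 'a::topological_space"
  assumes g: "path g" "path_image g \<subseteq> M" and x: "pathstart g = x"
  shows "homotopic_paths M ((\<lambda>_. x) +++ g) g"
proof -
  have "homotopic_paths M (g \<circ> (linepath 0 0 +++ linepath 0 1)) (g \<circ> linepath 0 1)"
    by (rule homotopic_reparam[OF g]) (auto simp: path_image_join closed_segment_eq_real_ivl)
  moreover have "g \<circ> (linepath 0 0 +++ linepath 0 1) = (\<lambda>_. x) +++ g"
    using x by (auto simp: fun_eq_iff joinpaths_def linepath_def pathstart_def)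
  moreover have "g \<circ> linepath 0 1 = g" by (auto simp: fun_eq_iff linepath_def)
  ultimately show ?thesis by simp
qed

lemma homotopic_reverse_left:
  fixes g :: "real \<Rightarrow> 'a::topological_space"
  assumes g: "path g" "path_image g \<subseteq> M" and x: "pathfinish g = x"
  shows "homotopic_paths M (reversepath g +++ g) (\<lambda>_. x)"
proof -
  have "homotopic_paths M (g \<circ> (linepath 1 0 +++ linepath 0 1)) (g \<circ> linepath 1 1)"
    by (rule homotopic_reparam[OF g]) (auto simp: path_image_join closed_segment_eq_real_ivl)
  moreover have "g \<circ> (linepath 1 0 +++ linepath 0 1) = reversepath g +++ g"
    by (auto simp: fun_eq_iff joinpaths_def linepath_def reversepath_def)
  moreover have "g \<circ> linepath 1 1 = (\<lambda>_. x)" using x by (auto simp: fun_eq_iff linepath_def pathfinish_def)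
  ultimately show ?thesis by simp
qed

lemma path_const [simp]: "path (\<lambda>_. x)"
  by (simp add: path_def)

lemma path_image_const [simp]: "path_image (\<lambda>_. x) = {x}"
  by (auto simp: path_image_def)

lemma path_ends_const [simp]: "pathstart (\<lambda>_. x) = x" "pathfinish (\<lambda>_. x) = x"
  by (auto simp: pathstart_def pathfinish_def)

lemma reversepath_const [simp]: "reversepath (\<lambda>_. x) = (\<lambda>_. x)"
  by (simp add: reversepath_def)

lemma homotopy_class_eq: "homotopic_paths M g h \<Longrightarrow> homotopy_class M g = homotopy_class M h"
  unfolding homotopy_class_def
  by (rule Collect_cong) (meson homotopic_paths_trans homotopic_paths_sym)

lemma homotopy_class_eqD:
  assumes "homotopy_class M g = homotopy_class M h" "path h" "path_image h \<subseteq> M"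
  shows "homotopic_paths M g h"
proof -
  have "h \<in> homotopy_class M h" using assms by (simp add: homotopy_class_def)
  then have "h \<in> homotopy_class M g" using assms(1) by simp
  then show ?thesis by (simp add: homotopy_class_def)
qed

lemma loopsD:
  assumes "g \<in> loops M p"
  shows "path g" "path_image g \<subseteq> M" "pathstart g = p" "pathfinish g = p"
  using assms by (auto simp: loops_def)

lemma loops_join: "g \<in> loops M p \<Longrightarrow> h \<in> loops M p \<Longrightarrow> g +++ h \<in> loops M p"
  by (auto simp: loops_def path_image_join)

lemma loops_reverse: "g \<in> loops M p \<Longrightarrow> reversepath g \<in> loops M p"
  by (auto simp: loops_def)

lemma loops_const: "p \<in> M \<Longrightarrow> (\<lambda>_. p) \<in> loops M p"
  by (auto simp: loops_def)

lemma fundamental_group_simps: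
  "carrier (fundamental_group M p) = homotopy_class M ` loops M p"
  "\<one>\<^bsub>fundamental_group M p\<^esub> = homotopy_class M (\<lambda>_. p)"
  by (auto simp: fundamental_group_def)

lemma fundamental_group_mult:
  assumes g: "g \<in> loops M p" and h: "h \<in> loops M p"
  shows "homotopy_class M g \<otimes>\<^bsub>fundamental_group M p\<^esub> homotopy_class M h = homotopy_class M (g +++ h)"
proof -
  have eq: "homotopy_class M (g' +++ h') = homotopy_class M (g +++ h)"
    if "g' \<in> homotopy_class M g" "h' \<in> homotopy_class M h" for g' h'
  proof -
    have "homotopic_paths M (g +++ h) (g' +++ h')"
      using that loopsD[OF g] loopsD[OF h] by (intro homotopic_paths_join) (auto simp: homotopy_class_def)
    then show ?thesis using homotopy_class_eq by metis
  qed
  have ne: "g \<in> homotopy_class M g" "h \<in> homotopy_class M h"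
    using loopsD[OF g] loopsD[OF h] by (auto simp: homotopy_class_def)
  have "(\<Union>g'\<in>homotopy_class M g. \<Union>h'\<in>homotopy_class M h. homotopy_class M (g' +++ h')) = homotopy_class M (g +++ h)"
    using eq ne by blast
  then show ?thesis by (simp add: fundamental_group_def)
qed

lemma group_fundamental_group:
  assumes p: "p \<in> M"
  shows "group (fundamental_group M p)"
proof (rule groupI)
  let ?G = "fundamental_group M p"
  note fs = fundamental_group_simps fundamental_group_mult
  show "\<one>\<^bsub>?G\<^esub> \<in> carrier ?G" using loops_const[OF p] by (auto simp: fs)
  fix X assume "X \<in> carrier ?G"
  then obtain g where g: "g \<in> loops M p" "X = homotopy_class M g" by (auto simp: fs)
  note gD = loopsD[OF g(1)]
  show "\<one>\<^bsub>?G\<^esub> \<otimes>\<^bsub>?G\<^esub> X = X"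
    using fundamental_group_mult[OF loops_const[OF p] g(1)]
      homotopy_class_eq[OF homotopic_const_left[OF gD(1,2,3)]] by (simp add: g(2) fundamental_group_simps)
  show "\<exists>Y\<in>carrier ?G. Y \<otimes>\<^bsub>?G\<^esub> X = \<one>\<^bsub>?G\<^esub>"
  proof
    show "homotopy_class M (reversepath g) \<otimes>\<^bsub>?G\<^esub> X = \<one>\<^bsub>?G\<^esub>"
      using fundamental_group_mult[OF loops_reverse[OF g(1)] g(1)]
        homotopy_class_eq[OF homotopic_reverse_left[OF gD(1,2,4)]] by (simp add: g(2) fundamental_group_simps)
    show "homotopy_class M (reversepath g) \<in> carrier ?G" using loops_reverse[OF g(1)] by (auto simp: fs)
  qed
  fix Y assume "Y \<in> carrier ?G"
  then obtain h where h: "h \<in> loops M p" "Y = homotopy_class M h" by (auto simp: fs)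
  show "X \<otimes>\<^bsub>?G\<^esub> Y \<in> carrier ?G"
    using loops_join[OF g(1) h(1)] by (auto simp: g h fs)
  fix Z assume "Z \<in> carrier ?G"
  then obtain j where j: "j \<in> loops M p" "Z = homotopy_class M j" by (auto simp: fs)
  have "homotopic_paths M (g +++ (h +++ j)) ((g +++ h) +++ j)"
    using loopsD[OF g(1)] loopsD[OF h(1)] loopsD[OF j(1)] by (intro homotopic_paths_assoc) auto
  from homotopy_class_eq[OF this] show "X \<otimes>\<^bsub>?G\<^esub> Y \<otimes>\<^bsub>?G\<^esub> Z = X \<otimes>\<^bsub>?G\<^esub> (Y \<otimes>\<^bsub>?G\<^esub> Z)"
    unfolding g(2) h(2) j(2)
    using g(1) h(1) j(1) by (simp add: fundamental_group_mult loops_join)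
qed

lemma inv_homotopy_class:
  assumes "p \<in> M" "g \<in> loops M p"
  shows "inv\<^bsub>fundamental_group M p\<^esub> homotopy_class M g = homotopy_class M (reversepath g)"
proof -
  interpret group "fundamental_group M p" using assms(1) by (rule group_fundamental_group)
  note gD = loopsD[OF assms(2)]
  show ?thesis
  proof (rule inv_equality)
    show "homotopy_class M (reversepath g) \<otimes>\<^bsub>fundamental_group M p\<^esub> homotopy_class M g = \<one>\<^bsub>fundamental_group M p\<^esub>"
      using fundamental_group_mult[OF loops_reverse[OF assms(2)] assms(2)]
        homotopy_class_eq[OF homotopic_reverse_left[OF gD(1,2,4)]] by (simp add: fundamental_group_simps)
  qed (use assms(2) loops_reverse[OF assms(2)] in \<open>auto simp: fundamental_group_simps\<close>)
qed

section \<open>Paths as a local system\<close>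

context closed_planes
begin

lemma homotopic_in_box:
  assumes V: "V \<in> boxes k F" and g: "path g" "path_image g \<subseteq> V" and h: "path h" "path_image h \<subseteq> V"
    and ends: "pathstart g = pathstart h" "pathfinish g = pathfinish h"
  shows "homotopic_paths N g h"
proof -
  obtain c a r s where c: "c \<in> F" "V = box_in k c a r s" "Box k a r s \<subseteq> snd c ` fst c"
    using V unfolding boxes_def by blast
  have Vc: "V \<subseteq> fst c" unfolding c(2) box_in_def by blast
  have im: "snd c ` V \<subseteq> Box k a r s" unfolding c(2) box_in_def by blast
  have pc: "path (snd c \<circ> l)" "path_image (snd c \<circ> l) \<subseteq> Box k a r s" if "path l" "path_image l \<subseteq> V" for l
  proof -
    show "path (snd c \<circ> l)"
      by (rule path_continuous_image[OF that(1)]) (rule continuous_on_subset[OF chart_cont[OF c(1)]], use that Vc in blast)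
    show "path_image (snd c \<circ> l) \<subseteq> Box k a r s" using that(2) im by (auto simp: path_image_def)
  qed
  have "homotopic_paths (Box k a r s) (snd c \<circ> g) (snd c \<circ> h)"
  proof (rule homotopic_paths_linear)
    show "closed_segment ((snd c \<circ> g) t) ((snd c \<circ> h) t) \<subseteq> Box k a r s" if "t \<in> {0..1}" for t
      by (rule closed_segment_subset[OF _ _ convex_Box])
        (use that pc(2)[OF g] pc(2)[OF h] in \<open>auto simp: path_image_def\<close>)
  qed (use pc g h ends in \<open>auto simp: pathstart_compose pathfinish_compose\<close>)
  then have "homotopic_paths N (chinv c \<circ> (snd c \<circ> g)) (chinv c \<circ> (snd c \<circ> h))"
  proof (rule homotopic_paths_continuous_image)
    show "continuous_on (Box k a r s) (chinv c)" by (rule continuous_on_subset[OF chinv_cont[OF c(1)] c(3)])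
    show "chinv c \<in> Box k a r s \<rightarrow> N" using chinv_in[OF c(1)] c(3) chart_sub[OF c(1)] by blast
  qed
  moreover have lift_back: "homotopic_paths N l (chinv c \<circ> (snd c \<circ> l))" if "path l" "path_image l \<subseteq> V" for l
  proof (rule homotopic_paths_eq[OF that(1)])
    show "path_image l \<subseteq> N" using that(2) Vc chart_sub[OF c(1)] by blast
    show "l t = (chinv c \<circ> (snd c \<circ> l)) t" if "t \<in> {0..1}" for t
    proof -
      have "l t \<in> fst c" using Vc \<open>path_image l \<subseteq> V\<close> that unfolding path_image_def by blast
      then show ?thesis using chinv_chart[OF c(1)] by simp
    qed
  qed
  ultimately show ?thesis using lift_back[OF g] lift_back[OF h] homotopic_paths_trans homotopic_paths_sym by metis
qed

lemma box_path:
  assumes V: "V \<in> boxes k F" and ab: "a \<in> V" "b \<in> V"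
  obtains g where "path g" "path_image g \<subseteq> V" "pathstart g = a" "pathfinish g = b"
proof -
  obtain c y r s where c: "c \<in> F" "V = box_in k c y r s"
    using V unfolding boxes_def by blast
  have Vc: "V \<subseteq> fst c" unfolding c(2) box_in_def by blast
  have abc: "a \<in> fst c" "b \<in> fst c" using ab Vc by blast+
  show ?thesis
  proof (rule that[of "cseg c a b"])
    show "path (cseg c a b)" unfolding path_def by (rule cseg_cont[OF c(1) abc])
    show "path_image (cseg c a b) \<subseteq> V"
      unfolding path_image_def c(2) using cseg_in_box[OF c(1) ab[unfolded c(2)]] by blast
  qed (use cseg_ends[OF c(1)] abc in \<open>auto simp: pathstart_def pathfinish_def\<close>)
qed

lemma path_connected_N:
  assumes N: "connected N" and p: "p \<in> N" and a: "a \<in> N"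
  shows "\<exists>g. path g \<and> path_image g \<subseteq> N \<and> pathstart g = p \<and> pathfinish g = a"
proof -
  define R where "R = {a \<in> N. \<exists>g. path g \<and> path_image g \<subseteq> N \<and> pathstart g = p \<and> pathfinish g = a}"
  have step: "y \<in> R" if "x \<in> R" and V: "V \<in> boxes k F" "x \<in> V" "y \<in> V" for x y V
  proof -
    obtain g where g: "path g" "path_image g \<subseteq> N" "pathstart g = p" "pathfinish g = x"
      using \<open>x \<in> R\<close> unfolding R_def by blast
    obtain h where h: "path h" "path_image h \<subseteq> V" "pathstart h = x" "pathfinish h = y"
      using box_path[OF V] by blast
    have VN: "V \<subseteq> N" using boxes_openin[OF V(1)] openin_imp_subset by blast
    have "path (g +++ h)" "path_image (g +++ h) \<subseteq> N" "pathstart (g +++ h) = p" "pathfinish (g +++ h) = y"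
      using g h VN by (auto simp: path_image_join)
    then show ?thesis unfolding R_def using VN V(3) by blast
  qed
  have nb: "\<exists>V\<in>boxes k F. x \<in> V" if "x \<in> N" for x using boxes_base[OF that openin_subtopology_self] by blast
  have VN: "V \<subseteq> N" "openin (top_of_set N) V" if "V \<in> boxes k F" for V
    using boxes_openin[OF that] openin_imp_subset by blast+
  have "openin (top_of_set N) R"
  proof (subst openin_subopen, intro ballI)
    fix x assume x: "x \<in> R"
    then obtain V where V: "V \<in> boxes k F" "x \<in> V" using nb unfolding R_def by blast
    show "\<exists>T. openin (top_of_set N) T \<and> x \<in> T \<and> T \<subseteq> R" using step[OF x V] VN[OF V(1)] V(2) by blast
  qed
  moreover have "openin (top_of_set N) (N - R)"
  proof (subst openin_subopen, intro ballI)
    fix x assume x: "x \<in> N - R"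
    then obtain V where V: "V \<in> boxes k F" "x \<in> V" using nb by blast
    have "V \<subseteq> N - R" using step[OF _ V(1) _ V(2)] x VN[OF V(1)] by blast
    then show "\<exists>T. openin (top_of_set N) T \<and> x \<in> T \<and> T \<subseteq> N - R" using VN[OF V(1)] V(2) by blast
  qed
  moreover have RN: "R \<subseteq> N" unfolding R_def by blast
  ultimately have "openin (top_of_set N) R \<and> closedin (top_of_set N) R" by (simp add: closedin_def)
  then have "R = {} \<or> R = N" using N unfolding connected_clopen by blast
  moreover have "p \<in> R" unfolding R_def using p by (intro CollectI conjI exI[of _ "\<lambda>_. p"]) auto
  ultimately show ?thesis using a unfolding R_def by blast
qed

end

locale based_planes = closed_planes k N A F
  for k :: "'n::finite" and N :: "'a::topological_space set" and A F :: "('a, 'n) chart set" +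
  fixes p :: 'a
  assumes conn: "connected N" and p: "p \<in> N"
begin

abbreviation \<Gamma> where "\<Gamma> \<equiv> fundamental_group N p"

interpretation \<Gamma>: group \<Gamma>
  using p by (rule group_fundamental_group)

text \<open>A path from \<open>p\<close> to \<open>a\<close>. It is constant for \<open>a = p\<close>, so that closing up a loop at \<open>p\<close> by tails does not
  conjugate it.\<close>

definition tail :: "'a \<Rightarrow> real \<Rightarrow> 'a" where
  "tail a = (if a = p then \<lambda>_. p else SOME g. path g \<and> path_image g \<subseteq> N \<and> pathstart g = p \<and> pathfinish g = a)"

lemma tail: "a \<in> N \<Longrightarrow> path (tail a) \<and> path_image (tail a) \<subseteq> N \<and> pathstart (tail a) = p \<and> pathfinish (tail a) = a"
proof (cases "a = p")
  case True
  then show ?thesis using p by (simp add: tail_def)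
next
  case False
  assume "a \<in> N"
  from someI_ex[OF path_connected_N[OF conn p this]] show ?thesis using False by (simp add: tail_def)
qed

definition tailed_loop :: "(real \<Rightarrow> 'a) \<Rightarrow> real \<Rightarrow> 'a" where
  "tailed_loop g = tail (pathstart g) +++ (g +++ reversepath (tail (pathfinish g)))"

definition path_class :: "(real \<Rightarrow> 'a) \<Rightarrow> (real \<Rightarrow> 'a) set" where
  "path_class g = homotopy_class N (tailed_loop g)"

lemma path_ends_in: "path_image g \<subseteq> N \<Longrightarrow> pathstart g \<in> N" "path_image g \<subseteq> N \<Longrightarrow> pathfinish g \<in> N"
  using pathstart_in_path_image pathfinish_in_path_image by blast+

lemma tailed_loop:
  assumes "path g" "path_image g \<subseteq> N"
  shows "tailed_loop g \<in> loops N p"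
  using assms tail[OF path_ends_in(1)[OF assms(2)]] tail[OF path_ends_in(2)[OF assms(2)]]
  by (auto simp: loops_def tailed_loop_def path_image_join)

lemma path_class_closed: "path g \<Longrightarrow> path_image g \<subseteq> N \<Longrightarrow> path_class g \<in> carrier \<Gamma>"
  unfolding path_class_def fundamental_group_simps by (intro imageI tailed_loop)

lemma path_class_homotopic:
  assumes "homotopic_paths N g h"
  shows "path_class g = path_class h"
proof -
  have ends: "pathstart g = pathstart h" "pathfinish g = pathfinish h"
    using homotopic_paths_imp_pathstart[OF assms] homotopic_paths_imp_pathfinish[OF assms] by auto
  have N: "path_image g \<subseteq> N" "path g" using homotopic_paths_imp_subset[OF assms] homotopic_paths_imp_path[OF assms] by auto
  note t = tail[OF path_ends_in(1)[OF N(1)]] tail[OF path_ends_in(2)[OF N(1)]]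
  have "homotopic_paths N (tailed_loop g) (tailed_loop h)"
    unfolding tailed_loop_def ends[symmetric]
    by (intro homotopic_paths_join assms) (use t N in \<open>auto\<close>)
  then show ?thesis unfolding path_class_def by (rule homotopy_class_eq)
qed

lemma path_class_join:
  assumes g: "path g" "path_image g \<subseteq> N" and h: "path h" "path_image h \<subseteq> N" and gh: "pathfinish g = pathstart h"
  shows "path_class (g +++ h) = path_class g \<otimes>\<^bsub>\<Gamma>\<^esub> path_class h"
proof -
  define s where "s = tail (pathstart g)"
  define t where "t = tail (pathstart h)"
  define r where "r = reversepath (tail (pathfinish h))"
  have s: "path s" "path_image s \<subseteq> N" "pathfinish s = pathstart g" "pathstart s = p"
    using tail[OF path_ends_in(1)[OF g(2)]] by (auto simp: s_def)
  have t: "path t" "path_image t \<subseteq> N" "pathfinish t = pathstart h" "pathstart t = p"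
    using tail[OF path_ends_in(1)[OF h(2)]] by (auto simp: t_def)
  have r: "path r" "path_image r \<subseteq> N" "pathstart r = pathfinish h" "pathfinish r = p"
    using tail[OF path_ends_in(2)[OF h(2)]] by (auto simp: r_def)
  have hr: "path (h +++ r)" "path_image (h +++ r) \<subseteq> N" "pathstart (h +++ r) = pathstart h"
    using h r by (auto simp: path_image_join)
  have trev: "path (reversepath t)" "path_image (reversepath t) \<subseteq> N" "pathstart (reversepath t) = pathfinish g"
    using t gh by auto
  (* Let s, t, r be the tails involved: (s g t^-1)(t h r) = s g ((t^-1 t) h r) = s ((g h) r). *)
  have "homotopic_paths N ((reversepath t +++ t) +++ (h +++ r)) ((\<lambda>_. pathstart h) +++ (h +++ r))"
    by (intro homotopic_paths_join homotopic_reverse_left t) (use hr t h r in auto)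
  also have "homotopic_paths N ((\<lambda>_. pathstart h) +++ (h +++ r)) (h +++ r)"
    by (rule homotopic_const_left[OF hr])
  finally have 1: "homotopic_paths N ((reversepath t +++ t) +++ (h +++ r)) (h +++ r)" .
  have 2: "homotopic_paths N (reversepath t +++ (t +++ (h +++ r))) ((reversepath t +++ t) +++ (h +++ r))"
    by (rule homotopic_paths_assoc) (use t trev hr in auto)
  have 3: "homotopic_paths N (reversepath t +++ (t +++ (h +++ r))) (h +++ r)"
    using homotopic_paths_trans[OF 2 1] .
  have thr: "path (t +++ (h +++ r))" "path_image (t +++ (h +++ r)) \<subseteq> N" "pathstart (t +++ (h +++ r)) = p"
    using t hr by (auto simp: path_image_join)
  have 4: "homotopic_paths N (g +++ (reversepath t +++ (t +++ (h +++ r)))) (g +++ (h +++ r))"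
    by (intro homotopic_paths_join 3) (use g trev in auto)
  have 5: "homotopic_paths N (g +++ (reversepath t +++ (t +++ (h +++ r)))) ((g +++ reversepath t) +++ (t +++ (h +++ r)))"
    by (rule homotopic_paths_assoc) (use g trev thr t in auto)
  have 6: "homotopic_paths N ((g +++ reversepath t) +++ (t +++ (h +++ r))) (g +++ (h +++ r))"
    using homotopic_paths_trans[OF homotopic_paths_sym[OF 5] 4] .
  have 7: "homotopic_paths N (s +++ ((g +++ reversepath t) +++ (t +++ (h +++ r)))) (s +++ (g +++ (h +++ r)))"
    by (intro homotopic_paths_join 6) (use s g trev in auto)
  have gt: "path (g +++ reversepath t)" "path_image (g +++ reversepath t) \<subseteq> N" "pathfinish (g +++ reversepath t) = p"
    "pathstart (g +++ reversepath t) = pathstart g"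
    using g trev t by (auto simp: path_image_join)
  have 8: "homotopic_paths N (s +++ ((g +++ reversepath t) +++ (t +++ (h +++ r)))) ((s +++ (g +++ reversepath t)) +++ (t +++ (h +++ r)))"
    by (rule homotopic_paths_assoc) (use s gt thr in auto)
  have 9: "homotopic_paths N (s +++ (g +++ (h +++ r))) (s +++ ((g +++ h) +++ r))"
    by (intro homotopic_paths_join homotopic_paths_assoc) (use s g h r gh in auto)
  have "homotopic_paths N ((s +++ (g +++ reversepath t)) +++ (t +++ (h +++ r))) (s +++ ((g +++ h) +++ r))"
    using homotopic_paths_trans[OF homotopic_paths_trans[OF homotopic_paths_sym[OF 8] 7] 9] .
  moreover have "tailed_loop g = s +++ (g +++ reversepath t)" "tailed_loop h = t +++ (h +++ r)" "tailed_loop (g +++ h) = s +++ ((g +++ h) +++ r)"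
    by (auto simp: tailed_loop_def s_def t_def r_def gh)
  ultimately have "homotopic_paths N (tailed_loop g +++ tailed_loop h) (tailed_loop (g +++ h))" by simp
  from homotopy_class_eq[OF this] show ?thesis
    unfolding path_class_def using fundamental_group_mult[OF tailed_loop[OF g] tailed_loop[OF h]] by simp
qed

lemma path_class_const:
  assumes "x \<in> N"
  shows "path_class (\<lambda>_. x) = \<one>\<^bsub>\<Gamma>\<^esub>"
proof -
  let ?c = "\<lambda>_. x"
  have "homotopic_paths N (?c +++ ?c) ?c" using assms by (intro homotopic_const_left) auto
  from path_class_homotopic[OF this] have "path_class ?c \<otimes>\<^bsub>\<Gamma>\<^esub> path_class ?c = path_class ?c"
    using path_class_join[of ?c ?c] assms by simp
  then show ?thesis using path_class_closed[of ?c] assms by simp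
qed

lemma path_class_loop:
  assumes g: "g \<in> loops N p"
  shows "path_class g = homotopy_class N g"
proof -
  note D = loopsD[OF g]
  have 1: "homotopic_paths N (g +++ (\<lambda>_. p)) g" by (rule homotopic_const_right[OF D(1,2,4)])
  have "homotopic_paths N ((\<lambda>_. p) +++ (g +++ (\<lambda>_. p))) (g +++ (\<lambda>_. p))"
    by (rule homotopic_const_left) (use D p in \<open>auto simp: path_image_join\<close>)
  from homotopic_paths_trans[OF this 1] have "homotopic_paths N (tailed_loop g) g"
    using D by (simp add: tailed_loop_def tail_def)
  then show ?thesis unfolding path_class_def by (rule homotopy_class_eq)
qed

definition \<kappa> :: "'a set \<Rightarrow> 'a \<Rightarrow> 'a \<Rightarrow> (real \<Rightarrow> 'a) set" where
  "\<kappa> V a b = path_class (SOME g. path g \<and> path_image g \<subseteq> V \<and> pathstart g = a \<and> pathfinish g = b)"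

lemma \<kappa>_eq:
  assumes V: "V \<in> boxes k F" and g: "path g" "path_image g \<subseteq> V"
  shows "\<kappa> V (pathstart g) (pathfinish g) = path_class g"
proof -
  define h where "h = (SOME h. path h \<and> path_image h \<subseteq> V \<and> pathstart h = pathstart g \<and> pathfinish h = pathfinish g)"
  have "path h \<and> path_image h \<subseteq> V \<and> pathstart h = pathstart g \<and> pathfinish h = pathfinish g"
    unfolding h_def by (rule someI[of _ g]) (use g in blast)
  then have "homotopic_paths N h g" using homotopic_in_box[OF V _ _ g] by blast
  from path_class_homotopic[OF this] show ?thesis unfolding \<kappa>_def h_def .
qed

lemma box_sub: "V \<in> boxes k F \<Longrightarrow> V \<subseteq> N"
  using boxes_openin openin_imp_subset by blast

sublocale plane_system k N A F \<Gamma> \<kappa>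
proof (intro plane_system.intro closed_planes_axioms local_system.intro local_system_axioms.intro)
  show "group \<Gamma>" by (rule \<Gamma>.is_group)
  show "openin (top_of_set N) V" if "V \<in> boxes k F" for V using boxes_openin that .
  show "\<exists>V\<in>boxes k F. x \<in> V \<and> V \<subseteq> T" if "x \<in> T" "openin (top_of_set N) T" for x T using boxes_base that .
  show "\<kappa> V a b \<in> carrier \<Gamma>" if V: "V \<in> boxes k F" and ab: "a \<in> V" "b \<in> V" for V a b
  proof -
    obtain g where g: "path g" "path_image g \<subseteq> V" "pathstart g = a" "pathfinish g = b" using box_path[OF V ab] .
    then show ?thesis using \<kappa>_eq[OF V g(1,2)] path_class_closed[OF g(1)] box_sub[OF V] by auto
  qed
  show "\<kappa> V a b \<otimes>\<^bsub>\<Gamma>\<^esub> \<kappa> V b d = \<kappa> V a d" if V: "V \<in> boxes k F" and ab: "a \<in> V" "b \<in> V" and d: "d \<in> V" for V a b d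
  proof -
    obtain g where g: "path g" "path_image g \<subseteq> V" "pathstart g = a" "pathfinish g = b" using box_path[OF V ab] .
    obtain h where h: "path h" "path_image h \<subseteq> V" "pathstart h = b" "pathfinish h = d" using box_path[OF V ab(2) d] .
    have gh: "path (g +++ h)" "path_image (g +++ h) \<subseteq> V" using g h by (auto simp: path_image_join)
    have "path_class (g +++ h) = path_class g \<otimes>\<^bsub>\<Gamma>\<^esub> path_class h" by (rule path_class_join) (use g h box_sub[OF V] in auto)
    then show ?thesis using \<kappa>_eq[OF V g(1,2)] \<kappa>_eq[OF V h(1,2)] \<kappa>_eq[OF V gh] g h by simp
  qed
  show "\<kappa> W a b = \<kappa> V a b" if V: "V \<in> boxes k F" and W: "W \<in> boxes k F" "W \<subseteq> V" and ab: "a \<in> W" "b \<in> W" for V W a b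
  proof -
    obtain g where g: "path g" "path_image g \<subseteq> W" "pathstart g = a" "pathfinish g = b" using box_path[OF W(1) ab] .
    have "path_image g \<subseteq> V" using g(2) W(2) by blast
    then show ?thesis using \<kappa>_eq[OF W(1) g(1,2)] \<kappa>_eq[OF V g(1)] g by simp
  qed
qed

text \<open>The classes of the initial parts of \<open>g\<close> form a section along \<open>g\<close>.\<close>

lemma transp_eq_path_class:
  assumes g: "path g" "path_image g \<subseteq> N"
  shows "transp g = path_class g"
proof -
  define m where "m t = path_class (g \<circ> linepath 0 t)" for t :: real
  have gc: "continuous_on {0..1} g" "g ` {0..1} \<subseteq> N" using g by (auto simp: path_def path_image_def)
  have lp: "path (linepath s t)" "path_image (linepath s t) \<subseteq> {0..1}" if "s \<in> {0..1}" "t \<in> {0..1}" for s t :: real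
    using that closed_segment_subset[of s "{0..1}" t] by auto
  have gl: "path (g \<circ> linepath s t)" "path_image (g \<circ> linepath s t) \<subseteq> N" if "s \<in> {0..1}" "t \<in> {0..1}" for s t
  proof -
    show "path (g \<circ> linepath s t)"
      by (rule path_continuous_image[OF lp(1)[OF that] continuous_on_subset[OF gc(1) lp(2)[OF that]]])
    show "path_image (g \<circ> linepath s t) \<subseteq> N"
      unfolding path_image_compose using gc(2) lp(2)[OF that] by blast
  qed
  have "sec {0..1} g m"
  proof (rule secI[OF gc])
    show "m t \<in> carrier \<Gamma>" if "t \<in> {0..1}" for t
      unfolding m_def by (rule path_class_closed[OF gl]) (use that in auto)
    fix t :: real assume t: "t \<in> {0..1}"
    then obtain V where V: "V \<in> boxes k F" "g t \<in> V" using base_at gc(2) by blast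
    have "\<forall>\<^sub>F s in at t within {0..1}. g s \<in> V"
      by (rule eventually_in_open[OF gc t boxes_openin[OF V(1)] V(2)])
    then obtain d where d: "d > 0" "\<And>s. s \<in> {0..1} \<Longrightarrow> s \<noteq> t \<Longrightarrow> dist s t < d \<Longrightarrow> g s \<in> V"
      unfolding eventually_at by blast
    have gV: "g s \<in> V" if "s \<in> {0..1}" "dist s t < d" for s using d(2)[OF that(1) _ that(2)] V(2) by (cases "s = t") auto
    have "m s = m t \<otimes>\<^bsub>\<Gamma>\<^esub> \<kappa> V (g t) (g s)" if s: "s \<in> {0..1}" "dist s t < d" for s
    proof -
      have 0: "(0 :: real) \<in> {0..1}" by simp
      have "path_image (g \<circ> linepath t s) \<subseteq> V"
      proof -
        have "g r \<in> V" if r: "r \<in> closed_segment t s" for r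
        proof (rule gV)
          show "r \<in> {0..1}" using lp(2)[OF t s(1)] r by auto
          show "dist r t < d" using r s(2) by (auto simp: closed_segment_eq_real_ivl dist_real_def split: if_splits)
        qed
        then show ?thesis unfolding path_image_compose by auto
      qed
      from \<kappa>_eq[OF V(1) gl(1)[OF t s(1)] this]
      have \<kappa>: "\<kappa> V (g t) (g s) = path_class (g \<circ> linepath t s)" by (simp add: pathstart_compose pathfinish_compose)
      have "homotopic_paths N (g \<circ> (linepath 0 t +++ linepath t s)) (g \<circ> linepath 0 s)"
        by (rule homotopic_reparam[OF g]) (use lp[OF 0 t] lp[OF t s(1)] lp[OF 0 s(1)] in \<open>auto simp: path_image_join\<close>)
      moreover have "g \<circ> (linepath 0 t +++ linepath t s) = (g \<circ> linepath 0 t) +++ (g \<circ> linepath t s)"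
        by (rule path_compose_join)
      ultimately have "m s = path_class ((g \<circ> linepath 0 t) +++ (g \<circ> linepath t s))"
        unfolding m_def using path_class_homotopic by simp
      also have "\<dots> = m t \<otimes>\<^bsub>\<Gamma>\<^esub> path_class (g \<circ> linepath t s)"
        unfolding m_def by (rule path_class_join[OF gl[OF 0 t] gl[OF t s(1)]]) (simp add: pathstart_compose pathfinish_compose)
      finally show ?thesis unfolding \<kappa> .
    qed
    then have "\<forall>\<^sub>F s in at t within {0..1}. m s = m t \<otimes>\<^bsub>\<Gamma>\<^esub> \<kappa> V (g t) (g s)"
      unfolding eventually_at using d(1) by blast
    then show "\<exists>V\<in>boxes k F. g t \<in> V \<and> (\<forall>\<^sub>F s in at t within {0..1}. m s = m t \<otimes>\<^bsub>\<Gamma>\<^esub> \<kappa> V (g t) (g s))"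
      using V by blast
  qed
  from transp_eq[OF g this] have "transp g = inv\<^bsub>\<Gamma>\<^esub> m 0 \<otimes>\<^bsub>\<Gamma>\<^esub> m 1" .
  have "g \<circ> linepath 0 0 = (\<lambda>_. g 0)" "g \<circ> linepath 0 1 = g" by (auto simp: fun_eq_iff linepath_def)
  moreover have "g 0 \<in> N" using gc(2) by auto
  ultimately have "m 0 = \<one>\<^bsub>\<Gamma>\<^esub>" "m 1 = path_class g" unfolding m_def using path_class_const[of "g 0"] by simp_all
  with \<open>transp g = inv\<^bsub>\<Gamma>\<^esub> m 0 \<otimes>\<^bsub>\<Gamma>\<^esub> m 1\<close> show ?thesis using path_class_closed[OF g] by simp
qed

end

section \<open>Freeness of the fundamental group\<close>

text \<open>If \<open>m\<close> is a section of \<open>d\<close> along \<open>g\<close>, then the product of \<open>\<theta> \<circ> m\<close> with the gauge is a section of \<open>c\<close>.\<close>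

lemma (in local_system) transp_gauge:
  assumes L: "local_system H N0 \<G> d" and hom: "\<theta> \<in> hom H G" and sub: "N0 \<subseteq> M" "\<G> \<subseteq> \<B>"
    and u: "\<And>x. x \<in> N0 \<Longrightarrow> u x \<in> carrier G"
    and gauge: "\<And>V a b. V \<in> \<G> \<Longrightarrow> a \<in> V \<Longrightarrow> b \<in> V \<Longrightarrow> c V a b = inv u a \<otimes> \<theta> (d V a b) \<otimes> u b"
    and g: "path g" "path_image g \<subseteq> N0"
  shows "transp g = inv u (pathstart g) \<otimes> \<theta> (local_system.transp H \<G> d g) \<otimes> u (pathfinish g)"
proof -
  interpret L: local_system H N0 \<G> d by (rule L)
  interpret \<theta>: group_hom H G \<theta>
    using hom L.group_axioms group_axioms by (simp add: group_hom_def group_hom_axioms_def)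
  obtain m where m: "L.sec {0..1} g m" using L.sec_path_exists g by blast
  define n where "n t = \<theta> (m t) \<otimes> u (g t)" for t
  have gc: "continuous_on {0..1} g" "g ` {0..1} \<subseteq> N0" using g by (auto simp: path_def path_image_def)
  have gM: "path_image g \<subseteq> M" "g ` {0..1} \<subseteq> M" using g gc sub by auto
  have mc: "m t \<in> carrier H" "\<theta> (m t) \<in> carrier G" "u (g t) \<in> carrier G" if "t \<in> {0..1}" for t
  proof -
    have "g t \<in> N0" using gc(2) that by blast
    then show "u (g t) \<in> carrier G" by (rule u)
  qed (use L.sec_closed[OF m that] in auto)
  have "sec {0..1} g n"
  proof (rule secI[OF gc(1) gM(2)])
    show "n t \<in> carrier G" if "t \<in> {0..1}" for t unfolding n_def using mc[OF that] by simp
    fix t :: real assume t: "t \<in> {0..1}"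
    then obtain V where V: "V \<in> \<G>" "g t \<in> V" using L.base_at gc(2) by blast
    have "\<forall>\<^sub>F s in at t within {0..1}. s \<in> {0..1}" by (auto simp: eventually_at_topological)
    with L.sec_at[OF m t V] L.eventually_in_open[OF gc t L.base_open[OF V(1)] V(2)]
    have "\<forall>\<^sub>F s in at t within {0..1}. n s = n t \<otimes> c V (g t) (g s)"
    proof eventually_elim
      case (elim s)
      have cl: "\<theta> (m t) \<in> carrier G" "u (g t) \<in> carrier G" "u (g s) \<in> carrier G" 
        "\<theta> (d V (g t) (g s)) \<in> carrier G" "m t \<in> carrier H" "d V (g t) (g s) \<in> carrier H"
        using mc[OF t] mc[OF elim(3)] L.c_closed[OF V elim(2)] by auto
      have "n t \<otimes> c V (g t) (g s) = \<theta> (m t) \<otimes> (u (g t) \<otimes> inv u (g t)) \<otimes> \<theta> (d V (g t) (g s)) \<otimes> u (g s)"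
        unfolding n_def gauge[OF V elim(2)] using cl by (simp only: m_assoc m_closed inv_closed)
      also have "\<dots> = \<theta> (m t \<otimes>\<^bsub>H\<^esub> d V (g t) (g s)) \<otimes> u (g s)"
        using cl by (simp add: \<theta>.hom_mult)
      finally show ?case unfolding n_def elim(1) by simp
    qed
    then show "\<exists>V\<in>\<B>. g t \<in> V \<and> (\<forall>\<^sub>F s in at t within {0..1}. n s = n t \<otimes> c V (g t) (g s))"
      using V sub(2) by blast
  qed
  note 1 = transp_eq[OF g(1) gM(1) this]
  have I: "(0 :: real) \<in> {0..1}" "(1 :: real) \<in> {0..1}" by auto
  have "\<theta> (L.transp g) = inv \<theta> (m 0) \<otimes> \<theta> (m 1)"
    unfolding L.transp_eq[OF g m] using mc[OF I(1)] mc[OF I(2)] by simp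
  then show ?thesis
    unfolding 1 n_def pathstart_def pathfinish_def using mc[OF I(1)] mc[OF I(2)]
    by (simp add: inv_mult_group m_assoc)
qed

context plane_system
begin

lemma compact_in_cells:
  assumes K: "compact K" "K \<subseteq> N"
  obtains I :: "'a set" and ch Op Cl where "plane_cells k N A F G \<kappa> I ch Op Cl" "K \<subseteq> (\<Union>i\<in>I. Op i)"
proof -
  have "\<exists>c C T. c \<in> F \<and> compact C \<and> C \<subseteq> fst c \<and> openin (top_of_set N) T \<and> T \<subseteq> C \<and> x \<in> T" if x: "x \<in> N" for x
  proof -
    obtain c where c: "c \<in> F" "x \<in> fst c" using chart_cover[OF x] by blast
    obtain e where e: "e > 0" "cball (snd c x) e \<subseteq> snd c ` fst c"
      using chart_open_image[OF c(1)] c(2) open_contains_cball by blast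
    define C where "C = chinv c ` cball (snd c x) e"
    define T where "T = {y \<in> fst c. snd c y \<in> ball (snd c x) e}"
    have "compact C" unfolding C_def
      by (rule compact_continuous_image[OF continuous_on_subset[OF chinv_cont[OF c(1)] e(2)] compact_cball])
    moreover have "C \<subseteq> fst c" unfolding C_def using chinv_in[OF c(1)] e(2) by blast
    moreover have "openin (top_of_set N) T" unfolding T_def by (rule openin_chart_vimage[OF c(1) open_ball])
    moreover have "T \<subseteq> C"
    proof
      fix y assume y: "y \<in> T"
      then have "y = chinv c (snd c y)" "snd c y \<in> cball (snd c x) e"
        using chinv_chart[OF c(1)] unfolding T_def by auto
      then show "y \<in> C" unfolding C_def by blast
    qed
    moreover have "x \<in> T" unfolding T_def using c(2) e(1) by simp
    ultimately show ?thesis using c(1) by blast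
  qed
  then obtain ch Cl Op where cells: "\<And>x. x \<in> N \<Longrightarrow> ch x \<in> F \<and> compact (Cl x) \<and> Cl x \<subseteq> fst (ch x) \<and>
    openin (top_of_set N) (Op x) \<and> Op x \<subseteq> Cl x \<and> x \<in> Op x" by metis
  have "\<exists>T. open T \<and> Op x = N \<inter> T" if "x \<in> N" for x using cells[OF that] unfolding openin_open by blast
  then obtain T where T: "\<And>x. x \<in> N \<Longrightarrow> open (T x) \<and> Op x = N \<inter> T x" by metis
  have cover: "K \<subseteq> (\<Union>x\<in>K. T x)" using cells T K(2) by blast
  obtain I where I: "I \<subseteq> K" "finite I" "K \<subseteq> (\<Union>x\<in>I. T x)"
    by (rule compactE_image[OF K(1) _ cover]) (use T K(2) in blast)+
  have IN: "I \<subseteq> N" using I(1) K(2) by blast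
  show ?thesis
  proof (rule that[of I ch Op Cl])
    show "plane_cells k N A F G \<kappa> I ch Op Cl"
      by (intro plane_cells.intro plane_system_axioms plane_cells_axioms.intro I(2)) (use cells IN in blast)+
    show "K \<subseteq> (\<Union>i\<in>I. Op i)" using I(3) T IN K(2) by blast
  qed
qed

end

lemma (in group) ev_conj:
  assumes v: "v \<in> carrier G" and f: "\<And>l. f l \<in> carrier G"
  shows "ev G (\<lambda>l. inv v \<otimes> f l \<otimes> v) w = inv v \<otimes> ev G f w \<otimes> v"
proof (induction w)
  case Nil
  then show ?case using v by simp
next
  case (Cons x w)
  have c: "ev G f w \<in> carrier G" using f by (intro ev_closed) auto
  define y where "y = (if snd x then f (fst x) else inv f (fst x))"
  have y: "y \<in> carrier G" using f by (simp add: y_def)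
  have "(if snd x then inv v \<otimes> f (fst x) \<otimes> v else inv (inv v \<otimes> f (fst x) \<otimes> v)) = inv v \<otimes> y \<otimes> v"
    using v f[of "fst x"] by (simp add: y_def inv_mult_group m_assoc)
  then have "ev G (\<lambda>l. inv v \<otimes> f l \<otimes> v) (x # w) = (inv v \<otimes> y \<otimes> v) \<otimes> (inv v \<otimes> ev G f w \<otimes> v)"
    by (simp add: ev_Cons Cons.IH)
  also have "\<dots> = inv v \<otimes> y \<otimes> (v \<otimes> inv v) \<otimes> ev G f w \<otimes> v"
    using v y c by (simp only: m_assoc m_closed inv_closed)
  also have "\<dots> = inv v \<otimes> ev G f (x # w) \<otimes> v"
    using v y c by (simp add: ev_Cons y_def[symmetric] m_assoc)
  finally show ?case .
qed

context based_planes
begin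

fun word_loop :: "('x \<Rightarrow> real \<Rightarrow> 'a) \<Rightarrow> ('x \<times> bool) list \<Rightarrow> real \<Rightarrow> 'a" where
  "word_loop \<gamma> [] = (\<lambda>_. p)"
| "word_loop \<gamma> (x # w) = (if snd x then \<gamma> (fst x) else reversepath (\<gamma> (fst x))) +++ word_loop \<gamma> w"

lemma word_loop_in:
  assumes "p \<in> M" "\<And>x. x \<in> fst ` set w \<Longrightarrow> \<gamma> x \<in> loops M p"
  shows "word_loop \<gamma> w \<in> loops M p"
  using assms(2) by (induction w) (auto simp: loops_const assms(1) intro!: loops_join loops_reverse)

lemma word_loop_class:
  assumes "\<And>x. x \<in> fst ` set w \<Longrightarrow> \<gamma> x \<in> loops N p"
  shows "homotopy_class N (word_loop \<gamma> w) = ev \<Gamma> (\<lambda>x. homotopy_class N (\<gamma> x)) w"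
  using assms
proof (induction w)
  case Nil
  then show ?case by (simp add: fundamental_group_simps)
next
  case (Cons x w)
  have x: "\<gamma> (fst x) \<in> loops N p" using Cons.prems by simp
  have w: "word_loop \<gamma> w \<in> loops N p" using Cons.prems by (intro word_loop_in p) auto
  have IH: "homotopy_class N (word_loop \<gamma> w) = ev \<Gamma> (\<lambda>x. homotopy_class N (\<gamma> x)) w"
    using Cons by simp
  show ?case
    using fundamental_group_mult[OF x w] fundamental_group_mult[OF loops_reverse[OF x] w]
    by (auto simp: ev_Cons IH inv_homotopy_class[OF p x])
qed

text \<open>Represent the elements of \<open>S\<close> by loops. These loops, and a contraction of the loop that the relation \<open>e\<close> spells,
  lie in finitely many cells. The lift of an element is the record of its loop in the free group; the
  contraction shows that the lifts satisfy \<open>e\<close>. The gauge at \<open>p\<close> conjugates the map back to the fundamental group.\<close>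

theorem fundamental_group_free:
  assumes fg: "finitely_generated \<Gamma>"
  shows "free_group \<Gamma>"
proof (rule free_group_criterion[where ?'l = "'a set \<times> 'a set", OF group_fundamental_group[OF p] fg])
  fix S and e :: "((real \<Rightarrow> 'a) set \<times> bool) list"
  assume S: "finite S" "S \<subseteq> carrier \<Gamma>" and e: "fst ` set e \<subseteq> S" "word_eval \<Gamma> e = \<one>\<^bsub>\<Gamma>\<^esub>"
  have "\<exists>g. g \<in> loops N p \<and> X = homotopy_class N g" if "X \<in> S" for X
    using that S(2) unfolding fundamental_group_simps by blast
  then obtain \<gamma> where \<gamma>: "\<And>X. X \<in> S \<Longrightarrow> \<gamma> X \<in> loops N p" "\<And>X. X \<in> S \<Longrightarrow> homotopy_class N (\<gamma> X) = X" by metis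
  define E where "E = word_loop \<gamma> e"
  have "homotopy_class N E = ev \<Gamma> (\<lambda>x. homotopy_class N (\<gamma> x)) e"
    unfolding E_def by (rule word_loop_class) (use \<gamma>(1) e(1) in blast)
  also have "\<dots> = ev \<Gamma> (\<lambda>x. x) e"
    unfolding ev_def using \<gamma>(2) e(1) by (intro foldr_cong) (auto split: prod.split)
  also have "\<dots> = homotopy_class N (\<lambda>_. p)"
    using e(2) by (simp add: word_eval_eq_ev fundamental_group_simps)
  finally have "homotopic_paths N E (\<lambda>_. p)" by (rule homotopy_class_eqD) (use p in auto)
  then obtain H :: "real \<times> real \<Rightarrow> 'a" where H: "continuous_on ({0..1} \<times> {0..1}) H"
      "H \<in> ({0..1} \<times> {0..1}) \<rightarrow> N"
      "\<forall>x\<in>{0..1}. H (0, x) = E x" "\<forall>x\<in>{0..1}. H (1, x) = p"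
      "\<forall>t\<in>{0..1}. pathstart (H \<circ> Pair t) = pathstart E \<and> pathfinish (H \<circ> Pair t) = pathfinish E"
    unfolding homotopic_paths by blast
  define Sq where "Sq = ({0..1} \<times> {0..1} :: (real \<times> real) set)"
  define K where "K = H ` Sq \<union> (\<Union>X\<in>S. path_image (\<gamma> X))"
  have "compact (H ` Sq)" unfolding Sq_def by (intro compact_continuous_image H(1) compact_Times) auto
  moreover have "compact (\<Union>X\<in>S. path_image (\<gamma> X))"
    using S(1) \<gamma>(1) loopsD(1) by (intro compact_UN) (auto simp: path_def path_image_def intro!: compact_continuous_image)
  ultimately have Kc: "compact K" unfolding K_def by (rule compact_Un)
  have KN: "K \<subseteq> N" unfolding K_def Sq_def using H(2) loopsD(2)[OF \<gamma>(1)] by blast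
  obtain I :: "'a set" and ch Op Cl where cells: "plane_cells k N A F \<Gamma> \<kappa> I ch Op Cl" "K \<subseteq> (\<Union>i\<in>I. Op i)"
    using compact_in_cells[OF Kc KN] .
  interpret C: plane_cells k N A F \<Gamma> \<kappa> I ch Op Cl by (rule cells(1))
  obtain \<G> and c :: "'a set \<Rightarrow> 'a \<Rightarrow> 'a \<Rightarrow> (('a set \<times> 'a set) \<times> bool) list" and \<phi> u where
    L: "local_system FG C.N0 \<G> c" and \<phi>: "\<phi> \<in> UNIV \<rightarrow> carrier \<Gamma>" and u: "\<And>x. x \<in> C.N0 \<Longrightarrow> u x \<in> carrier \<Gamma>"
    and \<G>: "\<G> \<subseteq> boxes k F"
    and rel: "\<And>V a b. V \<in> \<G> \<Longrightarrow> a \<in> V \<Longrightarrow> b \<in> V \<Longrightarrow> \<kappa> V a b = inv\<^bsub>\<Gamma>\<^esub> u a \<otimes>\<^bsub>\<Gamma>\<^esub> ev \<Gamma> \<phi> (c V a b) \<otimes>\<^bsub>\<Gamma>\<^esub> u b"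
    using C.free_factorization by blast
  interpret L: local_system FG C.N0 \<G> c by (rule L)
  have KN0: "K \<subseteq> C.N0" using cells(2) unfolding C.N0_def .
  have pN0: "p \<in> C.N0"
  proof -
    have "H (1, 0) \<in> K" unfolding K_def Sq_def by auto
    moreover have "H (1, 0) = p" using H(4) by auto
    ultimately show ?thesis using KN0 by auto
  qed
  have \<gamma>0: "\<gamma> X \<in> loops C.N0 p" if "X \<in> S" for X
    using loopsD[OF \<gamma>(1)[OF that]] that KN0 unfolding K_def loops_def by blast
  have E0: "homotopic_paths C.N0 E (\<lambda>_. p)"
    unfolding homotopic_paths
  proof (intro exI[of _ H] conjI)
    show "H \<in> {0..1} \<times> {0..1} \<rightarrow> C.N0" using KN0 unfolding K_def Sq_def by blast
  qed (use H in auto)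
  define y where "y X = L.transp (\<gamma> X)" for X
  define f where "f l = inv\<^bsub>\<Gamma>\<^esub> u p \<otimes>\<^bsub>\<Gamma>\<^esub> \<phi> l \<otimes>\<^bsub>\<Gamma>\<^esub> u p" for l
  have up: "u p \<in> carrier \<Gamma>" using u pN0 .
  have "ev \<Gamma> \<phi> w \<in> carrier \<Gamma>" for w using \<phi> by (intro ev_closed) auto
  then have hom: "ev \<Gamma> \<phi> \<in> hom FG \<Gamma>"
    using ev_mult_FG[OF \<phi>] by (simp add: hom_def del: FG_simps)
  have ev_y: "ev \<Gamma> f (y X) = X" if X: "X \<in> S" for X
  proof -
    note D = loopsD[OF \<gamma>0[OF X]]
    have "X = path_class (\<gamma> X)" using path_class_loop[OF \<gamma>(1)[OF X]] \<gamma>(2)[OF X] by simp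
    also have "\<dots> = transp (\<gamma> X)" using transp_eq_path_class loopsD[OF \<gamma>(1)[OF X]] by simp
    also have "\<dots> = inv\<^bsub>\<Gamma>\<^esub> u p \<otimes>\<^bsub>\<Gamma>\<^esub> ev \<Gamma> \<phi> (y X) \<otimes>\<^bsub>\<Gamma>\<^esub> u p"
      using transp_gauge[OF L hom C.N0_sub \<G> u rel D(1,2)] D(3,4) by (simp add: y_def)
    also have "\<dots> = ev \<Gamma> f (y X)"
      unfolding f_def by (rule ev_conj[symmetric, OF up]) (use \<phi> in auto)
    finally show ?thesis ..
  qed
  have tr: "L.transp (word_loop \<gamma> w) = ev FG y w" if "fst ` set w \<subseteq> S" for w
    using that
  proof (induction w)
    case Nil
    then show ?case using L.transp_const[OF pN0] by simp
  next
    case (Cons x w)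
    have x: "\<gamma> (fst x) \<in> loops C.N0 p" using Cons.prems \<gamma>0 by simp
    have w: "word_loop \<gamma> w \<in> loops C.N0 p" using Cons.prems \<gamma>0 by (intro word_loop_in pN0) auto
    have IH: "L.transp (word_loop \<gamma> w) = ev FG y w" using Cons by simp
    have yx: "L.transp (\<gamma> (fst x)) = y (fst x)" unfolding y_def ..
    show ?case
    proof (cases "snd x")
      case True
      then show ?thesis
        using L.transp_join[of "\<gamma> (fst x)" "word_loop \<gamma> w"] loopsD[OF x] loopsD[OF w]
        by (simp add: ev_Cons IH yx del: FG_simps)
    next
      case False
      then show ?thesis
        using L.transp_join[of "reversepath (\<gamma> (fst x))" "word_loop \<gamma> w"] L.transp_reversepath[of "\<gamma> (fst x)"]
          loopsD[OF x] loopsD[OF w]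
        by (simp add: ev_Cons IH yx del: FG_simps)
    qed
  qed
  have "ev FG y e = L.transp E" unfolding E_def using tr e(1) by simp
  also have "\<dots> = []" using L.transp_homotopic[OF E0] L.transp_const[OF pN0] by simp
  finally have "ev FG y e = []" .
  moreover have "f \<in> UNIV \<rightarrow> carrier \<Gamma>" unfolding f_def using up \<phi> by auto
  moreover have "y X \<in> carrier FG" if "X \<in> S" for X
    unfolding y_def by (rule L.transp_closed) (use loopsD[OF \<gamma>0[OF that]] in auto)
  then have "y ` S \<subseteq> carrier FG" by blast
  ultimately show "\<exists>(f :: 'a set \<times> 'a set \<Rightarrow> (real \<Rightarrow> 'a) set) y. f \<in> UNIV \<rightarrow> carrier \<Gamma> \<and> y ` S \<subseteq> carrier FG \<and>
        (\<forall>g\<in>S. ev \<Gamma> f (y g) = g) \<and> ev FG y e = []"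
    using ev_y by blast
qed

end

theorem theorem1:
  fixes N :: "'a::topological_space set"
    and A :: "('a, 'n::finite) chart set"
    and k :: 'n
    and p :: 'a
  assumes "open_manifold N A"
    and "connected N"
    and "\<exists>F. foliation_by_closed_planes k N A F"
    and "p \<in> N"
    and "finitely_generated (fundamental_group N p)"
  shows "free_group (fundamental_group N p)"
proof -
  obtain F where F: "foliation_by_closed_planes k N A F" using assms(3) by blast
  have "Hausdorff_space (top_of_set N)"
    using assms(1) by (simp add: open_manifold_def C2_manifold_def)
  then interpret based_planes k N A F p
    using F assms by unfold_locales
  show ?thesis using assms(5) by (rule fundamental_group_free)
qed

end
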